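(* Let $\mathcal{D}=(D_1,D_2,\ldots)$ be a sequence of decay functions and let $D_\infty$ be its pointwise limit, $D_\infty(x)=\lim_{j\to\infty}D_j(x)$. In the adversarial order model and in the random order model, for every instance $I=(F_1,\ldots,F_n)$ of non-negative distributions with finite expectation and every algorithm $\textsf{ALG}$, \[ \textsf{CR}^{\mathcal{D}}(\textsf{ALG}) \le \sup_{\textsf{A}} \frac{\mathbb{E}[\textsf{A}^{D_\infty}(I)]}{\mathbb{E}[\textsf{OPT}(I)]}, \] where the supremum is over all online algorithms $\textsf{A}$. In the IID model the same inequality holds up to an additional additive term of order $O(n^{-1/3})$ that depends only on the size $n$ of the instance (and not on the distribution or on the algorithm).
   Context: A sequence of decay functions is a sequence $\mathcal{D}=(D_1,D_2,\ldots)$ of non-negative functions on $[0,\infty)$ such that (i) $D_1(x)\le x$ for all $x\ge0$, (ii) $(D_j(x))_{j\ge1}$ is non-increasing in $j$ for every $x\ge 0$, (iii) each $D_j$ is non-decreasing. Its pointwise limit $D_\infty$ exists, is non-decreasing and satisfies $0\le D_\infty(x)\le x$; the constant sequence $(D_\infty,D_\infty,\ldots)$ is again a sequence of decay functions. For a sequence of decay functions $\mathcal{D}$, the $\mathcal{D}$-prophet inequality problem is: an instance is a finite tuple $I=(F_1,\ldots,F_n)$ of distributions on $[0,\infty)$ with finite expectation, known to the decision maker; independent values $X_i\sim F_i$ are revealed one at a time in an order $\pi$ (a permutation of $[n]$), i.e. $X_{\pi(1)},X_{\pi(2)},\ldots$. An (online) algorithm is a stopping rule: after seeing $X_{\pi(t)}$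 it decides, based only on the values observed so far (and the known distributions and decay functions), whether to stop; its stopping time is $\tau\in\{1,\ldots,n+1\}$ ($\tau=n+1$ meaning it never stops). Its reward is $\textsf{ALG}^{\mathcal{D}}(I)=\max_{0\le i\le \tau-1} D_i(X_{\pi(\tau-i)})$ with $D_0(x)=x$ (for $\tau=n+1$ this is $\max_{1\le i\le n}D_i(X_{\pi(n-i+1)})$). The same stopping rule can be run in the $\mathcal{D}'$-prophet inequality for any other decay sequence $\mathcal{D}'$; writing $\mathcal{D}=D_\infty$ or $\mathcal{D}=D$ means all decay functions equal that function. $\textsf{OPT}(I)=\max_{i\in[n]}X_i$. Order models: adversarial order ($\pi$ is the identity, the instance is arbitrary), random order ($\pi$ uniformly random, independent of the values), IID model (instances $I=(F,\ldots,F)$ of $n$ copies of one distribution $F$). The competitive ratio is $\textsf{CR}^{\mathcal{D}}(\textsf{ALG})=\inf_I \mathbb{E}[\textsf{ALG}^{\mathcal{D}}(I)]/\mathbb{E}[\textsf{OPT}(I)]$, the infimum over all instances of all sizes admissible in the model. *)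

theory Defs
  imports "HOL-Probability.Probability" "HOL-Combinatorics.Permutations"
    "HOL-Library.Landau_Symbols"
begin

(* The j-th decay function is D j for j \<ge> 1, considered on [0,\<infinity>) only; D 0 is ignored. *)
definition decay_sequence :: "(nat \<Rightarrow> real \<Rightarrow> real) \<Rightarrow> bool" where
  "decay_sequence D \<longleftrightarrow>
     (\<forall>j\<ge>1. \<forall>x\<ge>0. 0 \<le> D j x) \<and>
     (\<forall>x\<ge>0. D 1 x \<le> x) \<and>
     (\<forall>x\<ge>0. \<forall>i\<ge>1. \<forall>j\<ge>i. D j x \<le> D i x) \<and>
     (\<forall>j\<ge>1. mono_on {0..} (D j))"

definition decay_limit :: "(nat \<Rightarrow> real \<Rightarrow> real) \<Rightarrow> real \<Rightarrow> real" where
  "decay_limit D x = lim (\<lambda>j. D j x)"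

definition nonneg_borel :: "real measure" where
  "nonneg_borel = restrict_space borel {0..}"

definition nonneg_distribution :: "real measure \<Rightarrow> bool" where
  "nonneg_distribution F \<longleftrightarrow>
     prob_space F \<and> sets F = sets nonneg_borel \<and> integrable F (\<lambda>x. x)"

type_synonym prophet_instance = "real measure list"

datatype order_model = Adversarial | Random_Order | IID

definition admissible :: "order_model \<Rightarrow> prophet_instance \<Rightarrow> bool" where
  "admissible m I \<longleftrightarrow>
     I \<noteq> [] \<and> (\<forall>F\<in>set I. nonneg_distribution F) \<and>
     (m = IID \<longrightarrow> (\<exists>F. I = replicate (length I) F))"

(* In the IID model the order is immaterial, so it is taken to be the identity. *)
definition order_pmf :: "order_model \<Rightarrow> nat \<Rightarrow> (nat \<Rightarrow> nat) pmf" where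
  "order_pmf m n =
     (case m of
        Random_Order \<Rightarrow> pmf_of_set {\<pi>. \<pi> permutes {1..n}}
      | _ \<Rightarrow> return_pmf id)"

definition values_dist :: "prophet_instance \<Rightarrow> (nat \<Rightarrow> real) measure" where
  "values_dist I = PiM {1..length I} (\<lambda>i. I ! (i - 1))"

(* A stopping rule maps the list of the values observed so far, in order of observation,
   to the decision whether to stop now. *)
type_synonym stopping_rule = "real list \<Rightarrow> bool"

definition measurable_rule :: "stopping_rule \<Rightarrow> bool" where
  "measurable_rule S \<longleftrightarrow>
     (\<forall>t\<ge>1. Measurable.pred (PiM {1..t} (\<lambda>_. nonneg_borel)) (\<lambda>y. S (map y [1..<t + 1])))"

type_synonym algorithm = "prophet_instance \<Rightarrow> stopping_rule"

definition online_algorithms :: "algorithm set" where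
  "online_algorithms = {A. \<forall>I. measurable_rule (A I)}"

(* Here and below y t is the value observed at time t, for 1 \<le> t \<le> n. *)
definition stop_time :: "stopping_rule \<Rightarrow> nat \<Rightarrow> (nat \<Rightarrow> real) \<Rightarrow> nat" where
  "stop_time S n y = (LEAST t. (t \<in> {1..n} \<and> S (map y [1..<t + 1])) \<or> t = n + 1)"

definition reward :: "(nat \<Rightarrow> real \<Rightarrow> real) \<Rightarrow> stopping_rule \<Rightarrow> nat \<Rightarrow> (nat \<Rightarrow> real) \<Rightarrow> real" where
  "reward D S n y =
     (let \<tau> = stop_time S n y in
      if \<tau> \<le> n then (MAX i\<in>{0..\<tau> - 1}. if i = 0 then y \<tau> else D i (y (\<tau> - i)))
      else (MAX i\<in>{1..n}. D i (y (n - i + 1))))"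

(* The iterated integral expresses that the order is independent of the values. *)
definition expected_reward ::
    "order_model \<Rightarrow> (nat \<Rightarrow> real \<Rightarrow> real) \<Rightarrow> algorithm \<Rightarrow> prophet_instance \<Rightarrow> real" where
  "expected_reward m D A I =
     (\<integral>\<pi>. (\<integral>X. reward D (A I) (length I) (X \<circ> \<pi>) \<partial>values_dist I)
        \<partial>measure_pmf (order_pmf m (length I)))"

definition expected_opt :: "prophet_instance \<Rightarrow> real" where
  "expected_opt I = (\<integral>X. (MAX i\<in>{1..length I}. X i) \<partial>values_dist I)"

(* Instances with expected_opt I = 0 are left out: there the ratio would be 0 / 0, which HOL
   evaluates to 0, forcing the infimum to be 0 for every algorithm. *)
definition competitive_ratio ::
    "order_model \<Rightarrow> (nat \<Rightarrow> real \<Rightarrow> real) \<Rightarrow> algorithm \<Rightarrow> real" where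
  "competitive_ratio m D A =
     (INF I\<in>{I. admissible m I \<and> 0 < expected_opt I}. expected_reward m D A I / expected_opt I)"

end

theory Submission
  imports Defs
begin

text \<open>
  An algorithm facing the decay functions \<open>D\<^sub>j\<close> is run on an instance in which the values of \<open>I\<close> are
  separated by long runs of zeros. There a discarded value that still matters is at least \<open>g\<close> steps
  old, so it is worth at most \<open>D\<^sub>g\<close> of it, while the maximum of the instance is unchanged. A stopping
  rule for \<open>I\<close> imitates this run by inserting the zeros itself, and it stops as soon as the
  imitated rule stops before the next value of \<open>I\<close>. Its reward under \<open>D\<^sub>\<infinity>\<close> falls short by at most
  \<open>\<Sum>\<^sub>j (D\<^sub>g - D\<^sub>\<infinity>)(X\<^sub>j)\<close>, whose expectation tends to 0 by dominated convergence.

  In adversarial order the zeros are inserted deterministically. In random order many zeros are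
  appended to the instance: the positions of the values of \<open>I\<close> are then far apart with high
  probability, and given the positions their relative order is uniform. In the IID model, \<open>F\<close> is
  thinned to \<open>(1 - p) \<delta>\<^sub>0 + p F\<close> with \<open>N p = n - n\<^bsup>2/3\<^esup>\<close>. The number \<open>K\<close> of retained values has
  variance at most \<open>n\<close>, so the contribution of \<open>K > n\<close>, where the imitation is impossible, and the
  loss in the expected maximum are both \<open>O(n\<^bsup>-1/3\<^esup>)\<close>. Both estimates use that the expected maximum
  of \<open>k\<close> samples, divided by \<open>k\<close>, is non-increasing in \<open>k\<close>.
\<close>

subsection \<open>Decay functions, stopping times and rewards\<close>

text \<open>A rule may stop on a zero shortly after a value and still collect that value at a small
  delay, where \<open>D\<^sub>j\<close> can be far above the limit. The imitation must not wait for
  this. The zeros before the next value are known beforehand, so on seeing a value it can already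
  tell whether the imitated rule would stop within the run that follows, and by stopping at once it
  earns the value undiminished. A rule that never stops is paid at the end, so a gap is needed after
  the last value too.

  An algorithm may choose its rule by looking at the instance, so each amount of padding meets a
  different rule. No limit of rules is formed: each of them is imitated on the same
  \<open>I\<close>, and the supremum bounds them all. Where a parameter \<open>N\<close> controls
  the probability of badly placed values, \<open>N\<close> tends to infinity for fixed
  \<open>g\<close>, and \<open>g\<close> afterwards.

  Identical distributions exclude deterministic zeros, which makes the number of retained values
  random. If its mean is \<open>n - s\<close>, the shortfall costs a fraction \<open>s / n\<close>
  and the excess about \<open>n / s^2\<close> by a second moment bound; the two balance at
  \<open>s = n powr (2/3)\<close>.\<close>

lemma decay_nonneg: "decay_sequence D \<Longrightarrow> 1 \<le> j \<Longrightarrow> 0 \<le> x \<Longrightarrow> 0 \<le> D j x"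
  by (simp add: decay_sequence_def)

lemma decay_antimono:
  "decay_sequence D \<Longrightarrow> 1 \<le> i \<Longrightarrow> i \<le> j \<Longrightarrow> 0 \<le> x \<Longrightarrow> D j x \<le> D i x"
  by (simp add: decay_sequence_def)

lemma decay_le: "decay_sequence D \<Longrightarrow> 1 \<le> j \<Longrightarrow> 0 \<le> x \<Longrightarrow> D j x \<le> x"
  by (rule order_trans[OF decay_antimono[of D 1 j x]]) (simp_all add: decay_sequence_def)

lemma decay_tendsto:
  assumes "decay_sequence D" "0 \<le> x"
  shows "(\<lambda>j. D j x) \<longlonglongrightarrow> decay_limit D x"
proof -
  \<comment> \<open>\<open>D 0\<close> is unconstrained, so monotonicity starts at
    \<open>D 1\<close>; the limit is shifted back afterwards.\<close>
  have "decseq (\<lambda>j. D (Suc j) x)"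
    using assms by (auto simp: decseq_def intro: decay_antimono)
  moreover have "0 \<le> D (Suc j) x" for j
    using assms by (simp add: decay_nonneg)
  ultimately obtain L where "(\<lambda>j. D (Suc j) x) \<longlonglongrightarrow> L"
    by (blast intro: decseq_convergent)
  then have "(\<lambda>j. D j x) \<longlonglongrightarrow> L"
    by (rule LIMSEQ_imp_Suc)
  then show ?thesis
    unfolding decay_limit_def by (simp add: limI)
qed

lemma decay_limit_le:
  assumes "decay_sequence D" "1 \<le> j" "0 \<le> x"
  shows "decay_limit D x \<le> D j x"
  by (rule LIMSEQ_le_const2[OF decay_tendsto[OF assms(1,3)]])
     (use assms in \<open>auto intro!: exI[of _ j] decay_antimono\<close>)

text \<open>Makes every fact about rewards available for the limit problem as well, in particular
  integrability and the bounds behind the supremum over algorithms.\<close>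

lemma decay_sequence_decay_limit:
  assumes D: "decay_sequence D"
  shows "decay_sequence (\<lambda>_. decay_limit D)"
proof -
  have "0 \<le> decay_limit D x" if "0 \<le> x" for x
  proof (rule LIMSEQ_le_const[OF decay_tendsto[OF D that]])
    show "\<exists>N. \<forall>j\<ge>N. 0 \<le> D j x"
      using D that by (intro exI[of _ 1]) (simp add: decay_nonneg)
  qed
  moreover have "decay_limit D x \<le> x" if "0 \<le> x" for x
    using decay_limit_le[OF D, of 1 x] decay_le[OF D, of 1 x] that by simp
  moreover have "decay_limit D x \<le> decay_limit D y" if "0 \<le> x" "x \<le> y" for x y
  proof (rule LIMSEQ_le[OF decay_tendsto[OF D] decay_tendsto[OF D]])
    show "\<exists>N. \<forall>j\<ge>N. D j x \<le> D j y"
      using D that by (intro exI[of _ 1]) (simp add: decay_sequence_def mono_on_def)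
  qed (use that in simp_all)
  ultimately show ?thesis
    by (simp add: decay_sequence_def mono_on_def)
qed

section \<open>Stopping times as first times at which the rule says stop\<close>

lemma stop_time_bounds: "1 \<le> stop_time S n y" "stop_time S n y \<le> n + 1"
proof -
  let ?P = "\<lambda>t. (t \<in> {1..n} \<and> S (map y [1..<t + 1])) \<or> t = n + 1"
  have "?P (stop_time S n y)"
    unfolding stop_time_def by (rule LeastI[of ?P "n + 1"]) simp
  then show "1 \<le> stop_time S n y" "stop_time S n y \<le> n + 1"
    by auto
qed

lemma stop_time_stops:
  assumes "stop_time S n y \<le> n"
  shows "S (map y [1..<stop_time S n y + 1])"
proof -
  let ?P = "\<lambda>t. (t \<in> {1..n} \<and> S (map y [1..<t + 1])) \<or> t = n + 1"
  have "?P (stop_time S n y)"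
    unfolding stop_time_def by (rule LeastI[of ?P "n + 1"]) simp
  then show ?thesis
    using assms by auto
qed

lemma not_stopped_before_stop_time:
  assumes "1 \<le> u" "u < stop_time S n y"
  shows "\<not> S (map y [1..<u + 1])"
  using assms not_less_Least[of u "\<lambda>t. (t \<in> {1..n} \<and> S (map y [1..<t + 1])) \<or> t = n + 1"]
    stop_time_bounds(2)[of S n y]
  unfolding stop_time_def by auto

lemma stop_time_eqI:
  assumes "t \<in> {1..n}" "S (map y [1..<t + 1])" "\<And>u. 1 \<le> u \<Longrightarrow> u < t \<Longrightarrow> \<not> S (map y [1..<u + 1])"
  shows "stop_time S n y = t"
proof (rule antisym)
  show "stop_time S n y \<le> t"
    unfolding stop_time_def by (rule Least_le) (use assms in auto)
  show "t \<le> stop_time S n y"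
  proof (rule ccontr)
    assume "\<not> t \<le> stop_time S n y"
    then show False
      using assms(1,3) stop_time_stops[of S n y] stop_time_bounds(1)[of S n y] by simp
  qed
qed

lemma stop_time_never:
  assumes "\<And>u. u \<in> {1..n} \<Longrightarrow> \<not> S (map y [1..<u + 1])"
  shows "stop_time S n y = n + 1"
proof (rule ccontr)
  assume "stop_time S n y \<noteq> n + 1"
  then have "stop_time S n y \<in> {1..n}"
    using stop_time_bounds[of S n y] by simp
  with assms show False
    using stop_time_stops[of S n y] by simp
qed

lemma stop_time_cong:
  assumes "\<And>j. j \<in> {1..n} \<Longrightarrow> y j = z j"
  shows "stop_time S n y = stop_time S n z"
proof -
  have "map y [1..<t + 1] = map z [1..<t + 1]" if "t \<in> {1..n}" for t
    using that assms by auto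
  then have "(t \<in> {1..n} \<and> S (map y [1..<t + 1])) = (t \<in> {1..n} \<and> S (map z [1..<t + 1]))" for t
    by (cases "t \<in> {1..n}") (simp_all only: simp_thms)
  then show ?thesis
    unfolding stop_time_def by simp
qed

text \<open>Indexing the maximum by the time of observation instead of the delay merges the two branches
  of the definition: the value of time \<open>j\<close> has delay \<open>\<tau> - j\<close> also when \<open>\<tau> = n + 1\<close>.\<close>

definition payoff :: "(nat \<Rightarrow> real \<Rightarrow> real) \<Rightarrow> nat \<Rightarrow> (nat \<Rightarrow> real) \<Rightarrow> nat \<Rightarrow> real" where
  "payoff D \<tau> y j = (if j = \<tau> then y j else D (\<tau> - j) (y j))"

lemma reward_eq:
  "reward D S n y = Max (payoff D (stop_time S n y) y ` {1..min (stop_time S n y) n})"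
proof -
  define \<tau> where "\<tau> = stop_time S n y"
  have \<tau>: "1 \<le> \<tau>" "\<tau> \<le> n + 1"
    using stop_time_bounds[of S n y] by (simp_all add: \<tau>_def)
  have "(\<lambda>i. if i = 0 then y \<tau> else D i (y (\<tau> - i))) ` {0..\<tau> - 1} = payoff D \<tau> y ` {1..\<tau>}"
  proof -
    have *: "{1..\<tau>} = (\<lambda>j. \<tau> - j) ` {0..\<tau> - 1}"
    proof (intro equalityI subsetI)
      fix j assume "j \<in> {1..\<tau>}"
      then show "j \<in> (\<lambda>j. \<tau> - j) ` {0..\<tau> - 1}"
        by (intro image_eqI[of _ _ "\<tau> - j"]) auto
    qed (use \<tau> in auto)
    have "payoff D \<tau> y ` {1..\<tau>} = (\<lambda>i. payoff D \<tau> y (\<tau> - i)) ` {0..\<tau> - 1}"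
      by (subst *) (rule image_image)
    also have "\<dots> = (\<lambda>i. if i = 0 then y \<tau> else D i (y (\<tau> - i))) ` {0..\<tau> - 1}"
      using \<tau> by (intro image_cong) (auto simp: payoff_def)
    finally show ?thesis by simp
  qed
  moreover have "(\<lambda>i. D i (y (n - i + 1))) ` {1..n} = payoff D (n + 1) y ` {1..n}"
  proof -
    have *: "{1..n} = (\<lambda>j. n - j + 1) ` {1..n}"
    proof (intro equalityI subsetI)
      fix j assume "j \<in> {1..n}"
      then show "j \<in> (\<lambda>j. n - j + 1) ` {1..n}"
        by (intro image_eqI[of _ _ "n + 1 - j"]) auto
    qed auto
    have "payoff D (n + 1) y ` {1..n} = (\<lambda>i. payoff D (n + 1) y (n - i + 1)) ` {1..n}"
      by (subst *) (rule image_image)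
    also have "\<dots> = (\<lambda>i. D i (y (n - i + 1))) ` {1..n}"
      by (intro image_cong) (auto simp: payoff_def)
    finally show ?thesis by simp
  qed
  moreover have "\<tau> = n + 1" if "\<not> \<tau> \<le> n"
    using \<tau> that by simp
  ultimately show ?thesis
    unfolding reward_def \<tau>_def[symmetric] Let_def by (auto simp: min_def)
qed

lemma reward_leI:
  assumes "1 \<le> n"
    and "\<And>j. j \<in> {1..n} \<Longrightarrow> j \<le> stop_time S n y \<Longrightarrow> payoff D (stop_time S n y) y j \<le> B"
  shows "reward D S n y \<le> B"
  unfolding reward_eq by (subst Max_le_iff) (use assms stop_time_bounds(1)[of S n y] in auto)

lemma payoff_le_reward:
  assumes "j \<in> {1..n}" "j \<le> stop_time S n y"
  shows "payoff D (stop_time S n y) y j \<le> reward D S n y"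
  unfolding reward_eq by (rule Max_ge) (use assms in auto)

lemma payoff_nonneg:
  "decay_sequence D \<Longrightarrow> 0 \<le> y j \<Longrightarrow> j \<le> \<tau> \<Longrightarrow> 0 \<le> payoff D \<tau> y j"
  by (auto simp: payoff_def intro: decay_nonneg)

lemma payoff_le:
  "decay_sequence D \<Longrightarrow> 0 \<le> y j \<Longrightarrow> j \<le> \<tau> \<Longrightarrow> payoff D \<tau> y j \<le> y j"
  by (auto simp: payoff_def intro: decay_le)

lemma reward_nonneg:
  assumes "decay_sequence D" "1 \<le> n" "\<And>j. j \<in> {1..n} \<Longrightarrow> 0 \<le> y j"
  shows "0 \<le> reward D S n y"
  by (rule order_trans[OF payoff_nonneg payoff_le_reward, of D y 1])
     (use assms stop_time_bounds(1)[of S n y] in auto)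

lemma reward_le_Max:
  assumes "decay_sequence D" "1 \<le> n" "\<And>j. j \<in> {1..n} \<Longrightarrow> 0 \<le> y j"
  shows "reward D S n y \<le> Max (y ` {1..n})"
proof (rule reward_leI)
  fix j assume "j \<in> {1..n}" "j \<le> stop_time S n y"
  then show "payoff D (stop_time S n y) y j \<le> Max (y ` {1..n})"
    by (intro order_trans[OF payoff_le] Max_ge) (use assms in auto)
qed fact

lemma reward_cong:
  assumes "\<And>j. j \<in> {1..n} \<Longrightarrow> y j = z j"
  shows "reward D S n y = reward D S n z"
proof -
  have "stop_time S n y = stop_time S n z"
    by (rule stop_time_cong) (rule assms)
  then show ?thesis
    unfolding reward_eq
    by (auto intro!: arg_cong[of _ _ Max] image_cong simp: payoff_def assms)
qed

section \<open>Measurability of decay functions, stopping times and rewards\<close>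

lemma space_nonneg_borel [simp]: "space nonneg_borel = {0..}"
  by (simp add: nonneg_borel_def space_restrict_space)

lemma borel_measurable_nonneg_borel [measurable]: "(\<lambda>x. x) \<in> borel_measurable nonneg_borel"
  by (simp add: nonneg_borel_def measurable_restrict_space1)

text \<open>Monotonicity on the half-line already implies Borel measurability. Nothing is known
  about \<open>D j\<close> at negative arguments, hence the restricted space.\<close>

lemma borel_measurable_decay:
  assumes "decay_sequence D" "1 \<le> j"
  shows "D j \<in> borel_measurable nonneg_borel"
  unfolding nonneg_borel_def
  by (rule borel_measurable_mono_on_fnc) (use assms in \<open>simp add: decay_sequence_def\<close>)

lemma measurable_component_nonneg_borel:
  "j \<in> J \<Longrightarrow> (\<lambda>y. y j) \<in> borel_measurable (PiM J (\<lambda>_. nonneg_borel))"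
  by (rule measurable_compose[OF _ borel_measurable_nonneg_borel]) simp

text \<open>\<open>measurable_rule\<close> refers to the canonical product space. Here the
  observations may be measurable functions on any space, such as padded values computed from fewer
  samples.\<close>

lemma measurable_ruleD:
  assumes S: "measurable_rule S" and t: "1 \<le> t"
    and f: "\<And>j. j \<in> {1..t} \<Longrightarrow> (\<lambda>x. f x j) \<in> measurable M nonneg_borel"
  shows "Measurable.pred M (\<lambda>x. S (map (f x) [1..<t + 1]))"
proof -
  have "(\<lambda>x. restrict (f x) {1..t}) \<in> measurable M (PiM {1..t} (\<lambda>_. nonneg_borel))"
    by (rule measurable_restrict) (use f in auto)
  from measurable_compose[OF this] S t
  have "Measurable.pred M (\<lambda>x. S (map (restrict (f x) {1..t}) [1..<t + 1]))"
    unfolding measurable_rule_def by blast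
  moreover have "map (restrict (f x) {1..t}) [1..<t + 1] = map (f x) [1..<t + 1]" for x
    by auto
  ultimately show ?thesis by (simp only:)
qed

lemma measurable_stop_time:
  assumes "measurable_rule S"
  shows "stop_time S n \<in> measurable (PiM {1..n} (\<lambda>_. nonneg_borel)) (count_space UNIV)"
proof -
  have "Measurable.pred (PiM {1..n} (\<lambda>_. nonneg_borel))
    (\<lambda>y. (t \<in> {1..n} \<and> S (map y [1..<t + 1])) \<or> t = n + 1)" for t
  proof (cases "t \<in> {1..n}")
    case True
    then have "Measurable.pred (PiM {1..n} (\<lambda>_. nonneg_borel)) (\<lambda>y. S (map y [1..<t + 1]))"
      by (intro measurable_ruleD[OF assms]) auto
    moreover have "t \<noteq> n + 1"
      using True by simp
    ultimately show ?thesis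
      using True by (simp only: simp_thms)
  next
    case False
    then show ?thesis
      by (simp only: simp_thms) simp
  qed
  then show ?thesis
    unfolding stop_time_def[abs_def] by (rule measurable_Least)
qed

lemma borel_measurable_reward:
  assumes D: "decay_sequence D" and S: "measurable_rule S"
  shows "reward D S n \<in> borel_measurable (PiM {1..n} (\<lambda>_. nonneg_borel))"
proof -
  have "(\<lambda>y. payoff D \<tau> y j) \<in> borel_measurable (PiM {1..n} (\<lambda>_. nonneg_borel))"
    if "j \<in> {1..n}" "j \<le> \<tau>" for j \<tau>
  proof (cases "j = \<tau>")
    case True
    then show ?thesis
      using that by (simp add: payoff_def measurable_component_nonneg_borel)
  next
    case False
    then have "(\<lambda>y. D (\<tau> - j) (y j)) \<in> borel_measurable (PiM {1..n} (\<lambda>_. nonneg_borel))"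
      using that by (intro measurable_compose[OF measurable_component_singleton]
          borel_measurable_decay D) auto
    then show ?thesis
      using False by (simp add: payoff_def)
  qed
  then have "(\<lambda>y. Max ((\<lambda>j. payoff D \<tau> y j) ` {1..min \<tau> n})) \<in>
      borel_measurable (PiM {1..n} (\<lambda>_. nonneg_borel))" for \<tau>
    by (intro borel_measurable_Max) auto
  \<comment> \<open>For a fixed \<open>\<tau>\<close> the maximum runs over a fixed index set. The
    random \<open>\<tau>\<close> is inserted afterwards, which is allowed because it takes countably
    many values.\<close>
  from measurable_compose_countable[OF this measurable_stop_time[OF S]]
  show ?thesis
    by (simp add: reward_eq[abs_def])
qed

subsection \<open>Simulation on a zero-padded sequence\<close>

text \<open>\<open>t j\<close> is the time at which the \<open>j\<close>-th of \<open>k\<close>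
  values is placed. For injective \<open>t\<close> at most one term of the sum survives; a finite
  sum yields measurability and bounds term by term.\<close>

definition pad :: "(nat \<Rightarrow> nat) \<Rightarrow> nat \<Rightarrow> (nat \<Rightarrow> real) \<Rightarrow> nat \<Rightarrow> real" where
  "pad t k y s = (\<Sum>j=1..k. if t j = s then y j else 0)"

text \<open>\<open>k\<close> may be smaller than the number of observations: in the IID model only
  the first \<open>k\<close> values are placed, and the guard \<open>i \<le> k\<close> prevents a
  stop on the others. That \<open>u\<close> starts at 1 and not at \<open>t i\<close> does not
  affect the first stop, except that a stop among zeros before the first value is postponed to that
  value.\<close>

definition simulate :: "stopping_rule \<Rightarrow> (nat \<Rightarrow> nat) \<Rightarrow> nat \<Rightarrow> nat \<Rightarrow> stopping_rule" where
  "simulate S t k M xs \<longleftrightarrow>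
     (let i = length xs in i \<le> k \<and>
        (\<exists>u\<in>{1..<(if i < k then t (i + 1) else M + 1)}.
           S (map (pad t i (\<lambda>j. xs ! (j - 1))) [1..<u + 1])))"

text \<open>The deadline \<open>M + 1\<close> counts as one more position, because a rule that never
  stops has its delays measured from there.\<close>

definition gapped :: "nat \<Rightarrow> nat \<Rightarrow> nat set \<Rightarrow> bool" where
  "gapped g M T \<longleftrightarrow> (\<forall>s\<in>T. s + g \<le> M + 1 \<and> (\<forall>s'\<in>T. s < s' \<longrightarrow> s + g \<le> s'))"

lemma pad_at:
  assumes "inj_on t {1..k}" "j \<in> {1..k}"
  shows "pad t k y (t j) = y j"
proof -
  have "pad t k y (t j) = (\<Sum>i=1..k. if i = j then y i else 0)"
    unfolding pad_def by (rule sum.cong) (use assms in \<open>auto dest: inj_onD\<close>)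
  then show ?thesis
    using assms(2) by simp
qed

lemma pad_off: "s \<notin> t ` {1..k} \<Longrightarrow> pad t k y s = 0"
  unfolding pad_def by (rule sum.neutral) auto

text \<open>The reason why the imitation is online: up to the position of value \<open>i + 1\<close>
  the padded sequence depends on the first \<open>i\<close> values only.\<close>

lemma pad_truncate:
  assumes "strict_mono_on {1..k} t" "i \<le> k" "i < k \<Longrightarrow> s < t (i + 1)"
  shows "pad t i y s = pad t k y s"
  unfolding pad_def
proof (rule sum.mono_neutral_left)
  show "\<forall>j\<in>{1..k} - {1..i}. (if t j = s then y j else 0) = 0"
  proof
    fix j assume j: "j \<in> {1..k} - {1..i}"
    then have "i < k" "i + 1 \<le> j" by auto
    then have "t (i + 1) \<le> t j"
      using j assms(1) by (intro strict_mono_on_leD[OF assms(1)]) auto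
    with assms(3)[OF \<open>i < k\<close>] show "(if t j = s then y j else 0) = 0"
      by simp
  qed
qed (use assms in auto)

lemma simulate_map:
  "simulate S t k M (map y [1..<i + 1]) \<longleftrightarrow>
     i \<le> k \<and> (\<exists>u\<in>{1..<(if i < k then t (i + 1) else M + 1)}. S (map (pad t i y) [1..<u + 1]))"
proof -
  have "pad t i (\<lambda>j. map y [1..<i + 1] ! (j - 1)) = pad t i y"
    unfolding pad_def by (intro ext sum.cong refl if_cong) (auto simp del: upt_Suc)
  moreover have "length (map y [1..<i + 1]) = i"
    by simp
  ultimately show ?thesis
    unfolding simulate_def Let_def by (simp only:)
qed

text \<open>Passes to the complete padded sequence, so that the run of \<open>S\<close> and its
  imitation can be compared on one and the same sequence.\<close>

lemma simulate_map_pad: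
  assumes "strict_mono_on {1..k} t"
  shows "simulate S t k M (map y [1..<i + 1]) \<longleftrightarrow>
     i \<le> k \<and> (\<exists>u\<in>{1..<(if i < k then t (i + 1) else M + 1)}. S (map (pad t k y) [1..<u + 1]))"
proof -
  have "map (pad t i y) [1..<u + 1] = map (pad t k y) [1..<u + 1]"
    if "i \<le> k" "u \<in> {1..<(if i < k then t (i + 1) else M + 1)}" for u
    by (rule map_cong[OF refl], rule pad_truncate[OF assms]) (use that in \<open>auto split: if_splits\<close>)
  then show ?thesis
    unfolding simulate_map by (metis (no_types, lifting))
qed

lemma measurable_pad:
  assumes "i \<le> n"
  shows "(\<lambda>y. pad t i y s) \<in> measurable (PiM {1..n} (\<lambda>_. nonneg_borel)) nonneg_borel"
  unfolding nonneg_borel_def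
proof (rule measurable_restrict_space2)
  show "(\<lambda>y. pad t i y s) \<in> space (PiM {1..n} (\<lambda>_. restrict_space borel {0..})) \<rightarrow> {0..}"
    unfolding pad_def using assms by (auto intro!: sum_nonneg simp: space_PiM space_restrict_space)
  show "(\<lambda>y. pad t i y s) \<in> borel_measurable (PiM {1..n} (\<lambda>_. restrict_space borel {0..}))"
    unfolding pad_def nonneg_borel_def[symmetric]
    by (rule borel_measurable_sum) (use assms in \<open>auto intro!: measurable_component_nonneg_borel\<close>)
qed

lemma measurable_rule_simulate:
  assumes "measurable_rule S"
  shows "measurable_rule (simulate S t k M)"
  unfolding measurable_rule_def
proof (intro allI impI)
  fix i :: nat assume "1 \<le> i"
  have "Measurable.pred (PiM {1..i} (\<lambda>_. nonneg_borel)) (\<lambda>y. S (map (pad t i y) [1..<u + 1]))"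
    if "u \<in> {1..<(if i < k then t (i + 1) else M + 1)}" for u
    by (rule measurable_ruleD[OF assms]) (use that measurable_pad in auto)
  then have "Measurable.pred (PiM {1..i} (\<lambda>_. nonneg_borel))
    (\<lambda>y. \<exists>u\<in>{1..<(if i < k then t (i + 1) else M + 1)}. S (map (pad t i y) [1..<u + 1]))"
    by (intro pred_intros_finite) auto
  then show "Measurable.pred (PiM {1..i} (\<lambda>_. nonneg_borel))
      (\<lambda>y. simulate S t k M (map y [1..<i + 1]))"
    unfolding simulate_map by (rule pred_intros_conj1')
qed

text \<open>The maximum is bounded term by term. A zero contributes nothing. A value at least
  \<open>g\<close> old contributes at most its \<open>D g\<close>, and the simulated rule is
  credited with its limit decay. The only fresher candidate is the last value revealed before
  \<open>S\<close> stops, and the simulated rule stops on exactly that value. Each single error is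
  dominated by the sum of all of them.\<close>

lemma reward_pad_le:
  assumes D: "decay_sequence D" and t: "strict_mono_on {1..k} t" "t ` {1..k} \<subseteq> {1..M}"
    and n: "k \<le> n" "1 \<le> n" and M: "1 \<le> M" and g: "1 \<le> g" "gapped g M (t ` {1..k})"
    and y: "\<And>j. j \<in> {1..n} \<Longrightarrow> 0 \<le> y j"
  shows "reward D S M (pad t k y) \<le>
    reward (\<lambda>_. decay_limit D) (simulate S t k M) n y + (\<Sum>j=1..n. D g (y j) - decay_limit D (y j))"
proof (rule reward_leI[OF M])
  let ?L = "\<lambda>_::nat. decay_limit D"
  define z where "z = pad t k y"
  define \<tau> where "\<tau> = stop_time S M z"
  define \<sigma> where "\<sigma> = stop_time (simulate S t k M) n y"
  define R where "R = reward ?L (simulate S t k M) n y"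
  define E where "E = (\<Sum>j=1..n. D g (y j) - decay_limit D (y j))"
  have L: "decay_sequence ?L"
    by (rule decay_sequence_decay_limit[OF D])
  have inj: "inj_on t {1..k}"
    using t(1) by (rule strict_mono_on_imp_inj_on)
  have err_nonneg: "0 \<le> D g (y j) - decay_limit D (y j)" if "j \<in> {1..n}" for j
    using decay_limit_le[OF D g(1) y[OF that]] by simp
  have E: "0 \<le> E"
    unfolding E_def by (rule sum_nonneg) (rule err_nonneg)
  have err_le: "D g (y j) - decay_limit D (y j) \<le> E" if "j \<in> {1..n}" for j
    unfolding E_def by (rule member_le_sum) (use that err_nonneg in auto)
  have R: "0 \<le> R"
    unfolding R_def by (rule reward_nonneg[OF L n(2) y])
  have z_nonneg: "0 \<le> z s" for s
    unfolding z_def pad_def using y n by (intro sum_nonneg) auto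
  have not_before: "\<not> S (map z [1..<u + 1])" if "1 \<le> u" "u < \<tau>" for u
    using not_stopped_before_stop_time that unfolding \<tau>_def by blast
  fix s assume s: "s \<in> {1..M}" "s \<le> stop_time S M (pad t k y)"
  have "payoff D \<tau> z s \<le> R + E"
  proof (cases "s \<in> t ` {1..k}")
    case False
    have "payoff D \<tau> z s \<le> z s"
      by (rule payoff_le[of D z s, OF D z_nonneg]) (use s in \<open>simp add: \<tau>_def z_def\<close>)
    also have "z s = 0"
      using False by (simp add: z_def pad_off)
    finally show ?thesis
      using R E by simp
  next
    case True
    then obtain j where j: "j \<in> {1..k}" "s = t j" by blast
    then have jn: "j \<in> {1..n}" using n by simp
    have zs: "z s = y j"
      using pad_at[OF inj j(1)] by (simp add: z_def j)
    have s\<tau>: "t j \<le> \<tau>"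
      using s j by (simp add: \<tau>_def z_def)
    \<comment> \<open>The case of an old value. The hypothesis \<open>j < \<sigma>\<close> says that
      the simulated rule has passed it, so its payoff there is the limit decay and not the full
      value.\<close>
    have far: "payoff D \<tau> z s \<le> R + E" if "t j + g \<le> \<tau>" "j < \<sigma>"
    proof -
      have "payoff D \<tau> z s = D (\<tau> - t j) (y j)"
        using that g j zs by (simp add: payoff_def)
      also have "\<dots> \<le> D g (y j)"
        by (rule decay_antimono[OF D g(1)]) (use that y[OF jn] in auto)
      also have "\<dots> \<le> decay_limit D (y j) + E"
        using err_le[OF jn] by simp
      also have "decay_limit D (y j) \<le> R"
        using payoff_le_reward[of j n "simulate S t k M" y ?L] jn that
        unfolding R_def \<sigma>_def by (simp add: payoff_def)
      finally show ?thesis by simp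
    qed
    show ?thesis
    proof (cases "\<tau> \<le> M")
      case False
      then have \<tau>: "\<tau> = M + 1"
        using stop_time_bounds(2)[of S M z] by (simp add: \<tau>_def)
      have "\<sigma> = n + 1"
        unfolding \<sigma>_def
      proof (rule stop_time_never)
        fix i assume "i \<in> {1..n}"
        have "u < \<tau>" if "i \<le> k" "u \<in> {1..<(if i < k then t (i + 1) else M + 1)}" for u
        proof (cases "i < k")
          case True
          then have "t (i + 1) \<in> t ` {1..k}"
            by (intro imageI) simp
          then have "t (i + 1) \<le> M"
            using t(2) by auto
          with True that show ?thesis by (simp add: \<tau>)
        qed (use that in \<open>simp add: \<tau>\<close>)
        then show "\<not> simulate S t k M (map y [1..<i + 1])"
          unfolding simulate_map_pad[OF t(1)] z_def[symmetric] using not_before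
          by (metis atLeastLessThan_iff)
      qed
      \<comment> \<open>The deadline clause of \<open>gapped\<close> makes even the last value old
        when the run ends without a stop.\<close>
      moreover have "t j + g \<le> \<tau>"
        using g(2) j unfolding gapped_def \<tau> by blast
      ultimately show ?thesis
        using jn by (intro far) auto
    next
      case \<tau>: True
      \<comment> \<open>The last value revealed up to \<open>\<tau>\<close>. The simulated rule
        stops exactly there: \<open>\<tau>\<close> lies before the next value, while at an earlier
        index all times inspected lie before \<open>t i\<close> and hence before
        \<open>\<tau>\<close>.\<close>
      define i where "i = Max {i\<in>{1..k}. t i \<le> \<tau>}"
      have "i \<in> {i\<in>{1..k}. t i \<le> \<tau>}"
        unfolding i_def by (rule Max_in) (use j s\<tau> in auto)
      then have i: "i \<in> {1..k}" "t i \<le> \<tau>" by auto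
      have ji: "j \<le> i"
        unfolding i_def by (rule Max_ge) (use j s\<tau> in auto)
      have next_i: "\<tau> < t (i + 1)" if "i < k"
      proof (rule ccontr)
        assume "\<not> \<tau> < t (i + 1)"
        then have "i + 1 \<le> i"
          by (subst (2) i_def, intro Max_ge) (use that in auto)
        then show False by simp
      qed
      have \<sigma>: "\<sigma> = i"
        unfolding \<sigma>_def
      proof (rule stop_time_eqI)
        show "i \<in> {1..n}" using i n by simp
        have "S (map z [1..<\<tau> + 1])"
          using stop_time_stops \<tau> unfolding \<tau>_def by blast
        moreover have "\<tau> \<in> {1..<(if i < k then t (i + 1) else M + 1)}"
          using next_i \<tau> stop_time_bounds(1)[of S M z] by (simp add: \<tau>_def)
        ultimately show "simulate S t k M (map y [1..<i + 1])"
          unfolding simulate_map_pad[OF t(1)] z_def[symmetric] using i by auto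
      next
        fix i' assume i': "1 \<le> i'" "i' < i"
        then have "t (i' + 1) \<le> t i"
          using i by (intro strict_mono_on_leD[OF t(1)]) auto
        then have "u < \<tau>" if "u \<in> {1..<(if i' < k then t (i' + 1) else M + 1)}" for u
          using that i i' by simp
        then show "\<not> simulate S t k M (map y [1..<i' + 1])"
          unfolding simulate_map_pad[OF t(1)] z_def[symmetric] using not_before
          by (metis atLeastLessThan_iff)
      qed
      show ?thesis
      proof (cases "j = i")
        case True
        have "payoff D \<tau> z s \<le> y j"
          using payoff_le[of D z s \<tau>] D z_nonneg[of s] s\<tau> zs j by simp
        also have "\<dots> \<le> R"
          using payoff_le_reward[of j n "simulate S t k M" y ?L] jn True \<sigma>
          unfolding R_def \<sigma>_def by (simp add: payoff_def)
        finally show ?thesis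
          using E by simp
      next
        case False
        then have "j < i" using ji by simp
        then have "t j < t i"
          using i j by (intro strict_mono_onD[OF t(1)]) auto
        then have "t j + g \<le> t i"
          using g(2) i j unfolding gapped_def by blast
        then show ?thesis
          using i \<open>j < i\<close> \<sigma> by (intro far) auto
      qed
    qed
  qed
  then show "payoff D (stop_time S M (pad t k y)) (pad t k y) s \<le>
    reward ?L (simulate S t k M) n y + (\<Sum>j=1..n. D g (y j) - decay_limit D (y j))"
    unfolding \<tau>_def z_def R_def E_def .
qed

subsection \<open>Expected rewards\<close>

lemma nonneg_distributionD:
  assumes "nonneg_distribution F"
  shows "prob_space F" "sets F = sets nonneg_borel" "space F = {0..}" "integrable F (\<lambda>x. x)"
  using assms sets_eq_imp_space_eq[of F nonneg_borel] by (auto simp: nonneg_distribution_def)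

lemma sets_PiM_nonneg:
  assumes "\<And>j. j \<in> J \<Longrightarrow> nonneg_distribution (M j)"
  shows "sets (PiM J M) = sets (PiM J (\<lambda>_. nonneg_borel))"
  by (rule sets_PiM_cong) (use assms nonneg_distributionD in auto)

lemma measurable_PiM_nonneg:
  assumes "\<And>j. j \<in> J \<Longrightarrow> nonneg_distribution (M j)"
  shows "measurable (PiM J M) N = measurable (PiM J (\<lambda>_. nonneg_borel)) N"
  by (rule measurable_cong_sets) (simp_all add: sets_PiM_nonneg[OF assms])

lemma PiM_nonneg:
  assumes "\<And>j. j \<in> J \<Longrightarrow> nonneg_distribution (M j)" "X \<in> space (PiM J M)" "j \<in> J"
  shows "0 \<le> X j"
  using assms nonneg_distributionD(3)[OF assms(1)[OF assms(3)]] by (auto simp: space_PiM)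

lemma integrable_PiM_component:
  assumes "\<And>j. j \<in> J \<Longrightarrow> nonneg_distribution (M j)" "j \<in> J"
  shows "integrable (PiM J M) (\<lambda>X. X j)"
proof -
  have "distr (PiM J M) (M j) (\<lambda>X. X j) = M j"
    by (rule distr_PiM_component) (use assms nonneg_distributionD in auto)
  then have "integrable (distr (PiM J M) (M j) (\<lambda>X. X j)) (\<lambda>x. x)"
    using nonneg_distributionD(4)[OF assms(1)[OF assms(2)]] by simp
  then show ?thesis
    by (subst (asm) integrable_distr_eq)
       (use assms nonneg_distributionD(2)[OF assms(1)[OF assms(2)]] in
         \<open>auto simp: measurable_cong_sets[of "M j" nonneg_borel]\<close>)
qed

text \<open>One argument for the different ways of feeding a sample to a rule: permuted, padded or
  masked. The sum of the sample is an integrable majorant in each of them.\<close>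

lemma integrable_reward_comp:
  assumes D: "decay_sequence D" and S: "measurable_rule S" and N: "1 \<le> N"
    and M: "finite J" "\<And>j. j \<in> J \<Longrightarrow> nonneg_distribution (M j)"
    and \<phi>: "\<And>s. s \<in> {1..N} \<Longrightarrow> (\<lambda>X. \<phi> X s) \<in> measurable (PiM J (\<lambda>_. nonneg_borel)) nonneg_borel"
    and le: "\<And>X s. X \<in> space (PiM J M) \<Longrightarrow> s \<in> {1..N} \<Longrightarrow> \<phi> X s \<le> (\<Sum>j\<in>J. X j)"
  shows "integrable (PiM J M) (\<lambda>X. reward D S N (\<phi> X))"
proof (rule Bochner_Integration.integrable_bound)
  show "integrable (PiM J M) (\<lambda>X. \<Sum>j\<in>J. X j)"
    by (intro Bochner_Integration.integrable_sum integrable_PiM_component M)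
  have "(\<lambda>X. restrict (\<phi> X) {1..N}) \<in>
      measurable (PiM J (\<lambda>_. nonneg_borel)) (PiM {1..N} (\<lambda>_. nonneg_borel))"
    by (rule measurable_restrict) (rule \<phi>)
  from measurable_compose[OF this borel_measurable_reward[OF D S]]
  have "(\<lambda>X. reward D S N (restrict (\<phi> X) {1..N})) \<in> borel_measurable (PiM J (\<lambda>_. nonneg_borel))" .
  moreover have "reward D S N (restrict (\<phi> X) {1..N}) = reward D S N (\<phi> X)" for X
    by (rule reward_cong) simp
  ultimately show "(\<lambda>X. reward D S N (\<phi> X)) \<in> borel_measurable (PiM J M)"
    by (simp add: measurable_PiM_nonneg[OF M(2)])
  have sp: "space (PiM J M) = space (PiM J (\<lambda>_. nonneg_borel))"
    by (rule sets_eq_imp_space_eq) (rule sets_PiM_nonneg[OF M(2)])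
  show "AE X in PiM J M. norm (reward D S N (\<phi> X)) \<le> norm (\<Sum>j\<in>J. X j)"
  proof (rule AE_I2)
    fix X assume X: "X \<in> space (PiM J M)"
    have nn: "0 \<le> \<phi> X s" if "s \<in> {1..N}" for s
      using measurable_space[OF \<phi>[OF that]] X by (simp add: sp)
    have "reward D S N (\<phi> X) \<le> Max (\<phi> X ` {1..N})"
      by (rule reward_le_Max[OF D N nn])
    also have "\<dots> \<le> (\<Sum>j\<in>J. X j)"
      using le[OF X] N by (subst Max_le_iff) auto
    finally show "norm (reward D S N (\<phi> X)) \<le> norm (\<Sum>j\<in>J. X j)"
      using reward_nonneg[OF D N nn, where S = S] by simp
  qed
qed

text \<open>A subfamily of independent coordinates, renumbered, is again a product sample.
  Injectivity of \<open>f\<close> is essential, since a repeated coordinate would not be independent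
  of itself.\<close>

lemma integral_PiM_reindex:
  fixes h :: "(nat \<Rightarrow> real) \<Rightarrow> real"
  assumes "\<And>i. i \<in> K \<Longrightarrow> prob_space (M i)" "inj_on f J" "f \<in> J \<rightarrow> K"
    and "h \<in> borel_measurable (PiM J (\<lambda>i. M (f i)))"
  shows "(\<integral>X. h (\<lambda>j\<in>J. X (f j)) \<partial>PiM K M) = (\<integral>X. h X \<partial>PiM J (\<lambda>i. M (f i)))"
proof -
  have "(\<lambda>X. \<lambda>j\<in>J. X (f j)) \<in> measurable (PiM K M) (PiM J (\<lambda>i. M (f i)))"
    by (intro measurable_restrict measurable_component_singleton) (use assms(3) in auto)
  from integral_distr[OF this assms(4)] show ?thesis
    by (subst (asm) distr_PiM_reindex[OF assms(1-3)]) simp_all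
qed

text \<open>The error term of \<open>reward_pad_le\<close>. As a symmetric sum it is the same for
  every order of arrival.\<close>

definition decay_gap :: "(nat \<Rightarrow> real \<Rightarrow> real) \<Rightarrow> nat \<Rightarrow> nat \<Rightarrow> (nat \<Rightarrow> real) \<Rightarrow> real" where
  "decay_gap D g n y = (\<Sum>j=1..n. D g (y j) - decay_limit D (y j))"

lemma borel_measurable_decay_component:
  assumes D: "decay_sequence D" and j: "1 \<le> i" "j \<in> J"
  shows "(\<lambda>y. D i (y j)) \<in> borel_measurable (PiM J (\<lambda>_. nonneg_borel))"
  by (rule measurable_compose[OF _ borel_measurable_decay[OF D j(1)]]) (use j in simp)

lemma borel_measurable_decay_gap:
  assumes D: "decay_sequence D" and g: "1 \<le> g"
  shows "decay_gap D g n \<in> borel_measurable (PiM {1..n} (\<lambda>_. nonneg_borel))"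
  unfolding decay_gap_def
  by (intro borel_measurable_sum borel_measurable_diff borel_measurable_decay_component[OF D g]
      borel_measurable_decay_component[OF decay_sequence_decay_limit[OF D] order_refl]) auto

lemma decay_gap_bounds:
  assumes "decay_sequence D" "1 \<le> g" "\<And>j. j \<in> {1..n} \<Longrightarrow> 0 \<le> y j"
  shows "0 \<le> decay_gap D g n y" "decay_gap D g n y \<le> (\<Sum>j=1..n. y j)"
proof -
  have "0 \<le> D g (y j) - decay_limit D (y j)" if "j \<in> {1..n}" for j
    using decay_limit_le[OF assms(1,2) assms(3)[OF that]] by simp
  then show "0 \<le> decay_gap D g n y"
    unfolding decay_gap_def by (rule sum_nonneg)
  have "D g (y j) - decay_limit D (y j) \<le> y j" if "j \<in> {1..n}" for j
    using decay_le[OF assms(1,2) assms(3)[OF that]]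
      decay_nonneg[OF decay_sequence_decay_limit[OF assms(1)] order_refl assms(3)[OF that]] by simp
  then show "decay_gap D g n y \<le> (\<Sum>j=1..n. y j)"
    unfolding decay_gap_def by (rule sum_mono)
qed

lemma integrable_decay_gap:
  assumes D: "decay_sequence D" and g: "1 \<le> g"
    and M: "\<And>j. j \<in> {1..n} \<Longrightarrow> nonneg_distribution (M j)"
  shows "integrable (PiM {1..n} M) (decay_gap D g n)"
proof (rule Bochner_Integration.integrable_bound)
  show "integrable (PiM {1..n} M) (\<lambda>X. \<Sum>j=1..n. X j)"
    by (intro Bochner_Integration.integrable_sum integrable_PiM_component M)
  show "decay_gap D g n \<in> borel_measurable (PiM {1..n} M)"
    by (simp only: measurable_PiM_nonneg[OF M] borel_measurable_decay_gap[OF D g])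
  show "AE X in PiM {1..n} M. norm (decay_gap D g n X) \<le> norm (\<Sum>j=1..n. X j)"
  proof (rule AE_I2)
    fix X assume X: "X \<in> space (PiM {1..n} M)"
    have "0 \<le> decay_gap D g n X" "decay_gap D g n X \<le> (\<Sum>j=1..n. X j)"
      by (rule decay_gap_bounds[OF D g PiM_nonneg[OF M X]]; assumption)+
    then show "norm (decay_gap D g n X) \<le> norm (\<Sum>j=1..n. X j)"
      by simp
  qed
qed

text \<open>The sum of the values is the majorant, integrable because expectations are finite.
  \<open>Suc g\<close> keeps the index in the range where \<open>D\<close> is constrained.\<close>

lemma decay_gap_integral_tendsto:
  assumes D: "decay_sequence D" and M: "\<And>j. j \<in> {1..n} \<Longrightarrow> nonneg_distribution (M j)"
  shows "(\<lambda>g. \<integral>X. decay_gap D (Suc g) n X \<partial>PiM {1..n} M) \<longlonglongrightarrow> 0"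
proof -
  have "(\<lambda>g. \<integral>X. decay_gap D (Suc g) n X \<partial>PiM {1..n} M) \<longlonglongrightarrow> (\<integral>X. 0 \<partial>PiM {1..n} M)"
  proof (rule integral_dominated_convergence)
    show "integrable (PiM {1..n} M) (\<lambda>X. \<Sum>j=1..n. X j)"
      by (intro Bochner_Integration.integrable_sum integrable_PiM_component M)
    show "decay_gap D (Suc g) n \<in> borel_measurable (PiM {1..n} M)" for g
      using integrable_decay_gap[OF D _ M, of "Suc g"] by auto
    show "AE X in PiM {1..n} M. (\<lambda>g. decay_gap D (Suc g) n X) \<longlonglongrightarrow> 0"
    proof (rule AE_I2)
      fix X assume X: "X \<in> space (PiM {1..n} M)"
      have "(\<lambda>g. decay_gap D g n X) \<longlonglongrightarrow> (\<Sum>j=1..n. decay_limit D (X j) - decay_limit D (X j))"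
        unfolding decay_gap_def
        by (intro tendsto_sum tendsto_diff tendsto_const decay_tendsto[OF D] PiM_nonneg[OF M X])
      then show "(\<lambda>g. decay_gap D (Suc g) n X) \<longlonglongrightarrow> 0"
        using LIMSEQ_Suc by fastforce
    qed
    show "AE X in PiM {1..n} M. norm (decay_gap D (Suc g) n X) \<le> (\<Sum>j=1..n. X j)" for g
    proof (rule AE_I2)
      fix X assume X: "X \<in> space (PiM {1..n} M)"
      have "1 \<le> Suc g" by simp
      have "0 \<le> decay_gap D (Suc g) n X" "decay_gap D (Suc g) n X \<le> (\<Sum>j=1..n. X j)"
        by (rule decay_gap_bounds[OF D \<open>1 \<le> Suc g\<close> PiM_nonneg[OF M X]]; assumption)+
      then show "norm (decay_gap D (Suc g) n X) \<le> (\<Sum>j=1..n. X j)"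
        by simp
    qed
  qed auto
  then show ?thesis by simp
qed

text \<open>Inserting 0 changes nothing for a nonempty set of nonnegative values and gives the empty
  set the maximum 0, which is needed when thinning retains no value.\<close>

definition largest :: "nat set \<Rightarrow> (nat \<Rightarrow> real) \<Rightarrow> real" where
  "largest T X = Max (insert 0 (X ` T))"

lemma largest_nonneg: "finite T \<Longrightarrow> 0 \<le> largest T X"
  by (simp add: largest_def)

lemma le_largest: "finite T \<Longrightarrow> i \<in> T \<Longrightarrow> X i \<le> largest T X"
  by (simp add: largest_def)

lemma largest_le:
  "finite T \<Longrightarrow> 0 \<le> B \<Longrightarrow> (\<And>i. i \<in> T \<Longrightarrow> X i \<le> B) \<Longrightarrow> largest T X \<le> B"
  by (auto simp: largest_def)

lemma largest_cong: "(\<And>i. i \<in> T \<Longrightarrow> X i = Y i) \<Longrightarrow> largest T X = largest T Y"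
  by (simp add: largest_def)

lemma Max_eq_largest:
  assumes "finite T" "T \<noteq> {}" "\<And>i. i \<in> T \<Longrightarrow> 0 \<le> X i"
  shows "Max (X ` T) = largest T X"
proof -
  obtain i where "i \<in> T" using assms(2) by blast
  then have "0 \<le> Max (X ` T)"
    using assms(1) assms(3)[of i] by (intro order_trans[OF _ Max_ge[of _ "X i"]]) auto
  then show ?thesis
    unfolding largest_def by (subst Max_insert) (use assms in auto)
qed

lemma borel_measurable_largest:
  assumes "finite T" "T \<subseteq> J"
  shows "largest T \<in> borel_measurable (PiM J (\<lambda>_. nonneg_borel))"
proof (cases "T = {}")
  case True
  then show ?thesis by (simp add: largest_def[abs_def])
next
  case False
  have "largest T = (\<lambda>X. max 0 (Max ((\<lambda>i. X i) ` T)))"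
    unfolding largest_def by (rule ext, subst Max_insert) (use assms False in auto)
  moreover have "(\<lambda>X. max 0 (Max ((\<lambda>i. X i) ` T))) \<in> borel_measurable (PiM J (\<lambda>_. nonneg_borel))"
    by (intro borel_measurable_max borel_measurable_const borel_measurable_Max assms
        measurable_component_nonneg_borel) (use assms in auto)
  ultimately show ?thesis by simp
qed

lemma integrable_largest:
  assumes J: "finite J" "T \<subseteq> J" and M: "\<And>j. j \<in> J \<Longrightarrow> nonneg_distribution (M j)"
  shows "integrable (PiM J M) (largest T)"
proof (rule Bochner_Integration.integrable_bound)
  show "integrable (PiM J M) (\<lambda>X. \<Sum>j\<in>J. X j)"
    by (intro Bochner_Integration.integrable_sum integrable_PiM_component M)
  have fin: "finite T" using J finite_subset by blast
  show "largest T \<in> borel_measurable (PiM J M)"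
    by (simp only: measurable_PiM_nonneg[OF M] borel_measurable_largest[OF fin J(2)])
  show "AE X in PiM J M. norm (largest T X) \<le> norm (\<Sum>j\<in>J. X j)"
  proof (rule AE_I2)
    fix X assume X: "X \<in> space (PiM J M)"
    have "largest T X \<le> (\<Sum>j\<in>J. X j)"
    proof (rule largest_le[OF fin])
      show "0 \<le> (\<Sum>j\<in>J. X j)"
        by (rule sum_nonneg) (rule PiM_nonneg[OF M X])
      show "X i \<le> (\<Sum>j\<in>J. X j)" if "i \<in> T" for i
        by (rule member_le_sum) (use that J PiM_nonneg[OF M X] in auto)
    qed
    then show "norm (largest T X) \<le> norm (\<Sum>j\<in>J. X j)"
      using largest_nonneg[OF fin, of X] by simp
  qed
qed

section \<open>Bounds on expected rewards and their use with infimum and supremum\<close>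

lemma admissible_nonneg_distribution:
  "admissible m I \<Longrightarrow> j \<in> {1..length I} \<Longrightarrow> nonneg_distribution (I ! (j - 1))"
  by (auto simp: admissible_def)

lemma admissible_length: "admissible m I \<Longrightarrow> 1 \<le> length I"
  by (cases I) (auto simp: admissible_def)

lemma values_dist_nonneg:
  assumes "admissible m I" "X \<in> space (values_dist I)" "j \<in> {1..length I}"
  shows "0 \<le> X j"
  by (rule PiM_nonneg[OF _ assms(2)[unfolded values_dist_def] assms(3)])
     (rule admissible_nonneg_distribution[OF assms(1)])

lemma expected_opt_eq:
  assumes "admissible m I"
  shows "expected_opt I = (\<integral>X. largest {1..length I} X \<partial>values_dist I)"
  unfolding expected_opt_def
proof (rule Bochner_Integration.integral_cong[OF refl])
  fix X assume "X \<in> space (values_dist I)"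
  then show "(MAX i\<in>{1..length I}. X i) = largest {1..length I} X"
    by (intro Max_eq_largest values_dist_nonneg[OF assms]) (use admissible_length[OF assms] in auto)
qed

lemma integrable_reward_permuted:
  assumes D: "decay_sequence D" and S: "measurable_rule S" and I: "admissible m I"
    and p: "\<pi> permutes {1..length I}"
  shows "integrable (values_dist I) (\<lambda>X. reward D S (length I) (X \<circ> \<pi>))"
  unfolding values_dist_def
proof (rule integrable_reward_comp[OF D S admissible_length[OF I] _ admissible_nonneg_distribution[OF I]])
  have p': "\<pi> s \<in> {1..length I}" if "s \<in> {1..length I}" for s
    using p that permutes_in_image by fastforce
  fix s assume s: "s \<in> {1..length I}"
  show "(\<lambda>X. (X \<circ> \<pi>) s) \<in> measurable (PiM {1..length I} (\<lambda>_. nonneg_borel)) nonneg_borel"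
    using p'[OF s] by simp
  fix X assume X: "X \<in> space (PiM {1..length I} (\<lambda>i. I ! (i - 1)))"
  show "(X \<circ> \<pi>) s \<le> sum X {1..length I}"
    unfolding comp_def
    by (rule member_le_sum) (use p'[OF s] values_dist_nonneg[OF I X[folded values_dist_def]] in auto)
qed auto

lemma reward_permuted_le:
  assumes D: "decay_sequence D" and I: "admissible m I" and p: "\<pi> permutes {1..length I}"
    and X: "X \<in> space (values_dist I)"
  shows "0 \<le> reward D S (length I) (X \<circ> \<pi>)"
    "reward D S (length I) (X \<circ> \<pi>) \<le> largest {1..length I} X"
proof -
  have X0: "0 \<le> X j" if "j \<in> {1..length I}" for j
    by (rule values_dist_nonneg[OF I X that])
  have nn: "0 \<le> (X \<circ> \<pi>) s" if "s \<in> {1..length I}" for s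
    using X0[of "\<pi> s"] p that permutes_in_image by fastforce
  show "0 \<le> reward D S (length I) (X \<circ> \<pi>)"
    by (rule reward_nonneg[OF D admissible_length[OF I] nn])
  have "reward D S (length I) (X \<circ> \<pi>) \<le> Max ((X \<circ> \<pi>) ` {1..length I})"
    by (rule reward_le_Max[OF D admissible_length[OF I] nn])
  also have "(X \<circ> \<pi>) ` {1..length I} = X ` {1..length I}"
    using permutes_image[OF p] by (metis image_comp)
  also have "Max (X ` {1..length I}) = largest {1..length I} X"
    by (rule Max_eq_largest) (use admissible_length[OF I] X0 in auto)
  finally show "reward D S (length I) (X \<circ> \<pi>) \<le> largest {1..length I} X" .
qed

lemma set_order_pmf: "\<pi> \<in> set_pmf (order_pmf m n) \<Longrightarrow> \<pi> permutes {1..n}"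
proof -
  have "set_pmf (pmf_of_set {\<pi>. \<pi> permutes {1..n}}) = {\<pi>. \<pi> permutes {1..n}}"
    by (rule set_pmf_of_set) (auto intro: finite_permutations permutes_id)
  then show "\<pi> \<in> set_pmf (order_pmf m n) \<Longrightarrow> \<pi> permutes {1..n}"
    by (cases m) (auto simp: order_pmf_def permutes_id)
qed

lemma finite_set_order_pmf: "finite (set_pmf (order_pmf m n))"
  by (rule finite_subset[of _ "{\<pi>. \<pi> permutes {1..n}}"]) (use set_order_pmf finite_permutations in blast)+

text \<open>Real infima and suprema are informative only for bounded families. The lower bound
  serves the infimum over instances, the upper bound the supremum over algorithms.\<close>

lemma expected_reward_bounds:
  assumes D: "decay_sequence D" and A: "A \<in> online_algorithms" and I: "admissible m I"
  shows "0 \<le> expected_reward m D A I" "expected_reward m D A I \<le> expected_opt I"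
proof -
  have S: "measurable_rule (A I)"
    using A by (simp add: online_algorithms_def)
  define e where "e \<pi> = (\<integral>X. reward D (A I) (length I) (X \<circ> \<pi>) \<partial>values_dist I)" for \<pi>
  have e: "0 \<le> e \<pi> \<and> e \<pi> \<le> expected_opt I" if "\<pi> \<in> set_pmf (order_pmf m (length I))" for \<pi>
  proof
    have p: "\<pi> permutes {1..length I}"
      using that by (rule set_order_pmf)
    show "0 \<le> e \<pi>"
      unfolding e_def by (rule Bochner_Integration.integral_nonneg) (rule reward_permuted_le[OF D I p])
    show "e \<pi> \<le> expected_opt I"
      unfolding e_def expected_opt_eq[OF I]
    proof (rule integral_mono)
      show "integrable (values_dist I) (largest {1..length I})"
        unfolding values_dist_def
        by (rule integrable_largest) (use admissible_nonneg_distribution[OF I] in auto)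
    qed (use integrable_reward_permuted[OF D S I p] reward_permuted_le[OF D I p] in auto)
  qed
  have int: "integrable (measure_pmf (order_pmf m (length I))) e"
    by (rule integrable_measure_pmf_finite) (rule finite_set_order_pmf)
  show "0 \<le> expected_reward m D A I"
    unfolding expected_reward_def e_def[symmetric]
    by (rule integral_nonneg_AE) (use e in \<open>auto simp: AE_measure_pmf_iff\<close>)
  show "expected_reward m D A I \<le> expected_opt I"
    unfolding expected_reward_def e_def[symmetric]
    by (rule measure_pmf.integral_le_const[OF int]) (use e in \<open>auto simp: AE_measure_pmf_iff\<close>)
qed

lemma competitive_ratio_le:
  assumes "decay_sequence D" "A \<in> online_algorithms" "admissible m I" "0 < expected_opt I"
  shows "competitive_ratio m D A \<le> expected_reward m D A I / expected_opt I"
  unfolding competitive_ratio_def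
proof (rule cINF_lower)
  show "bdd_below ((\<lambda>I. expected_reward m D A I / expected_opt I) `
      {I. admissible m I \<and> 0 < expected_opt I})"
    by (rule bdd_belowI2[of _ 0]) (use expected_reward_bounds(1)[OF assms(1,2)] in auto)
qed (use assms in auto)

lemma expected_reward_le_SUP:
  assumes "decay_sequence D" "A \<in> online_algorithms" "admissible m I" "0 < expected_opt I"
  shows "expected_reward m D A I \<le>
    (SUP A\<in>online_algorithms. expected_reward m D A I / expected_opt I) * expected_opt I"
proof -
  have "expected_reward m D A I / expected_opt I \<le>
      (SUP A\<in>online_algorithms. expected_reward m D A I / expected_opt I)"
  proof (rule cSUP_upper[OF assms(2)])
    show "bdd_above ((\<lambda>A. expected_reward m D A I / expected_opt I) ` online_algorithms)"
      by (rule bdd_aboveI2[of _ _ 1])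
         (use expected_reward_bounds(2)[OF assms(1) _ assms(3)] assms(4) in simp)
  qed
  then show ?thesis
    using assms(4) by (simp add: divide_le_eq)
qed

lemma online_algorithms_const: "measurable_rule S \<Longrightarrow> (\<lambda>_. S) \<in> online_algorithms"
  by (simp add: online_algorithms_def)

subsection \<open>Zero-padded instances and adversarial order\<close>

abbreviation zero_dist :: "real measure" where
  "zero_dist \<equiv> return nonneg_borel 0"

lemma nonneg_distribution_zero_dist: "nonneg_distribution zero_dist"
proof -
  have "integrable zero_dist (\<lambda>x. x) \<longleftrightarrow> integrable zero_dist (\<lambda>x. 0 :: real)"
  proof (rule integrable_cong_AE)
    show "(\<lambda>x. x) \<in> borel_measurable zero_dist"
      by (simp add: measurable_cong_sets[of zero_dist nonneg_borel])
    show "AE x in zero_dist. x = 0"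
      by (subst AE_return) (simp_all add: borel_measurable_nonneg_borel)
  qed simp
  then show ?thesis
    by (simp add: nonneg_distribution_def prob_space_return)
qed

lemma pad_bounds:
  assumes "k \<le> n" "\<And>j. j \<in> {1..n} \<Longrightarrow> 0 \<le> y j"
  shows "0 \<le> pad t k y s" "pad t k y s \<le> (\<Sum>j=1..n. y j)"
proof -
  show "0 \<le> pad t k y s"
    unfolding pad_def by (rule sum_nonneg) (use assms in auto)
  have "pad t k y s \<le> (\<Sum>j=1..k. y j)"
    unfolding pad_def by (rule sum_mono) (use assms in auto)
  also have "\<dots> \<le> (\<Sum>j=1..n. y j)"
    by (rule sum_mono2) (use assms in auto)
  finally show "pad t k y s \<le> (\<Sum>j=1..n. y j)" .
qed

lemma pad_cong: "(\<And>j. j \<in> {1..k} \<Longrightarrow> y j = z j) \<Longrightarrow> pad t k y = pad t k z"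
  unfolding pad_def by (intro ext sum.cong) auto

lemma largest_pad:
  assumes t: "inj_on t {1..k}" "t ` {1..k} \<subseteq> {1..N}" and y: "\<And>j. j \<in> {1..k} \<Longrightarrow> 0 \<le> y j"
  shows "largest {1..N} (pad t k y) = largest {1..k} y"
proof (rule antisym)
  show "largest {1..N} (pad t k y) \<le> largest {1..k} y"
  proof (rule largest_le)
    fix s
    show "pad t k y s \<le> largest {1..k} y"
    proof (cases "s \<in> t ` {1..k}")
      case True
      then obtain j where "j \<in> {1..k}" "s = t j" by blast
      then show ?thesis
        by (simp add: pad_at[OF t(1)] le_largest)
    qed (simp add: pad_off largest_nonneg)
  qed (simp_all add: largest_nonneg)
  show "largest {1..k} y \<le> largest {1..N} (pad t k y)"
  proof (rule largest_le)
    fix j assume j: "j \<in> {1..k}"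
    have "pad t k y (t j) \<le> largest {1..N} (pad t k y)"
      using t(2) j by (intro le_largest) blast+
    then show "y j \<le> largest {1..N} (pad t k y)"
      by (simp add: pad_at[OF t(1) j])
  qed (simp_all add: largest_nonneg)
qed

lemma measurable_restrict_pad:
  assumes "k \<le> n"
  shows "(\<lambda>y. restrict (pad t k y) {1..N}) \<in>
    measurable (PiM {1..n} (\<lambda>_. nonneg_borel)) (PiM {1..N} (\<lambda>_. nonneg_borel))"
  by (intro measurable_restrict measurable_pad assms)

text \<open>Coordinates outside the range of \<open>t\<close> vanish almost surely, so a sample
  almost surely equals the padding of its coordinates along \<open>t\<close>. Those form a product
  sample by \<open>integral_PiM_reindex\<close>. The \<open>restrict\<close> makes the padded
  sequence a point of the product space.\<close>

lemma integral_zero_padded: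
  fixes h :: "(nat \<Rightarrow> real) \<Rightarrow> real"
  assumes M: "\<And>s. s \<in> {1..N} \<Longrightarrow> nonneg_distribution (M s)"
    and t: "inj_on t {1..n}" "t ` {1..n} \<subseteq> {1..N}"
    and Z: "\<And>s. s \<in> {1..N} - t ` {1..n} \<Longrightarrow> M s = zero_dist"
    and h: "h \<in> borel_measurable (PiM {1..N} (\<lambda>_. nonneg_borel))"
  shows "(\<integral>X. h X \<partial>PiM {1..N} M) =
    (\<integral>X. h (restrict (pad t n X) {1..N}) \<partial>PiM {1..n} (\<lambda>j. M (t j)))"
proof -
  have Mt: "nonneg_distribution (M (t j))" if "j \<in> {1..n}" for j
    using t(2) that by (intro M) blast
  have hM: "h \<in> borel_measurable (PiM {1..N} M)"
    by (simp only: measurable_PiM_nonneg[OF M] h)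
  have h': "(\<lambda>X. h (restrict (pad t n X) {1..N})) \<in> borel_measurable (PiM {1..n} (\<lambda>j. M (t j)))"
    by (subst measurable_PiM_nonneg, erule Mt, rule measurable_compose[OF measurable_restrict_pad h])
       simp
  have tN: "t \<in> {1..n} \<rightarrow> {1..N}"
    using t by auto
  have meas: "(\<lambda>X. \<lambda>j\<in>{1..n}. X (t j)) \<in> measurable (PiM {1..N} M) (PiM {1..n} (\<lambda>j. M (t j)))"
    by (intro measurable_restrict measurable_component_singleton) (use tN in auto)
  have "AE X in PiM {1..N} M. X s = 0" if s: "s \<in> {1..N} - t ` {1..n}" for s
  proof (rule AE_PiM_component)
    show "AE x in M s. x = 0"
      unfolding Z[OF s] by (subst AE_return) (simp_all add: borel_measurable_nonneg_borel)
  qed (use s M nonneg_distributionD in auto)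
  then have "AE X in PiM {1..N} M. \<forall>s\<in>{1..N} - t ` {1..n}. X s = 0"
    by (intro AE_finite_allI) auto
  then have "AE X in PiM {1..N} M. h X = h (restrict (pad t n (\<lambda>j\<in>{1..n}. X (t j))) {1..N})"
  proof (rule AE_mp, intro AE_I2 impI)
    fix X assume X: "X \<in> space (PiM {1..N} M)" "\<forall>s\<in>{1..N} - t ` {1..n}. X s = 0"
    have "X s = restrict (pad t n (\<lambda>j\<in>{1..n}. X (t j))) {1..N} s" for s
    proof (cases "s \<in> {1..N}")
      case s: True
      show ?thesis
      proof (cases "s \<in> t ` {1..n}")
        case True
        then obtain j where "j \<in> {1..n}" "s = t j" by blast
        with s show ?thesis
          by (simp add: pad_at[OF t(1)])
      next
        case False
        with s X show ?thesis by (simp add: pad_off)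
      qed
    next
      case False
      moreover have "X \<in> extensional {1..N}"
        using X(1) by (simp add: space_PiM PiE_def)
      ultimately show ?thesis
        using extensional_arb[of X "{1..N}" s] by auto
    qed
    then show "h X = h (restrict (pad t n (\<lambda>j\<in>{1..n}. X (t j))) {1..N})"
      by (intro arg_cong[of _ _ h] ext)
  qed
  then have "(\<integral>X. h X \<partial>PiM {1..N} M) =
      (\<integral>X. h (restrict (pad t n (\<lambda>j\<in>{1..n}. X (t j))) {1..N}) \<partial>PiM {1..N} M)"
    by (intro integral_cong_AE hM measurable_compose[OF meas h'])
  also have "\<dots> = (\<integral>X. h (restrict (pad t n X) {1..N}) \<partial>PiM {1..n} (\<lambda>j. M (t j)))"
    by (rule integral_PiM_reindex[OF _ t(1) tN h']) (use M nonneg_distributionD in auto)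
  finally show ?thesis .
qed

lemma expected_reward_fixed_order:
  assumes "m \<noteq> Random_Order"
  shows "expected_reward m D A I = (\<integral>X. reward D (A I) (length I) X \<partial>values_dist I)"
proof -
  have "order_pmf m (length I) = return_pmf id"
    using assms by (cases m) (auto simp: order_pmf_def)
  then show ?thesis
    unfolding expected_reward_def by (simp add: integral_measure_pmf[of "{id}"])
qed

lemma expected_reward_random_order:
  "expected_reward Random_Order D A I =
    (\<Sum>\<pi> | \<pi> permutes {1..length I}. \<integral>X. reward D (A I) (length I) (X \<circ> \<pi>) \<partial>values_dist I) /
      fact (length I)"
proof -
  have ne: "{\<pi>. \<pi> permutes {1..length I}} \<noteq> {}"
    using permutes_id by blast
  show ?thesis
    unfolding expected_reward_def order_pmf_def order_model.case
    by (subst integral_pmf_of_set[OF ne]) (simp_all add: finite_permutations card_permutations)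
qed

section \<open>Samples arriving in order \<open>\<sigma>\<close> at the positions given by
  \<open>t\<close>\<close>

context
  fixes D :: "nat \<Rightarrow> real \<Rightarrow> real" and S :: stopping_rule and I :: prophet_instance
    and m :: order_model and N k :: nat and t \<sigma> :: "nat \<Rightarrow> nat"
  assumes D: "decay_sequence D" and S: "measurable_rule S" and I: "admissible m I"
    and N: "1 \<le> N" and k: "k \<le> length I" and t: "strict_mono_on {1..k} t" "t ` {1..k} \<subseteq> {1..N}"
    and \<sigma>: "\<sigma> permutes {1..length I}"
begin

lemma integrable_reward_pad:
  "integrable (values_dist I) (\<lambda>X. reward D S N (pad t k (X \<circ> \<sigma>)))"
  unfolding values_dist_def
proof (rule integrable_reward_comp[OF D S N _ admissible_nonneg_distribution[OF I]])
  have p: "\<sigma> s \<in> {1..length I}" if "s \<in> {1..length I}" for s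
    using \<sigma> that permutes_in_image by fastforce
  fix s
  have "(\<lambda>X. restrict (X \<circ> \<sigma>) {1..length I}) \<in>
      measurable (PiM {1..length I} (\<lambda>_. nonneg_borel)) (PiM {1..length I} (\<lambda>_. nonneg_borel))"
    unfolding comp_def by (intro measurable_restrict measurable_component_singleton p)
  from measurable_compose[OF this measurable_pad[OF k]]
  have "(\<lambda>X. pad t k (restrict (X \<circ> \<sigma>) {1..length I}) s) \<in>
      measurable (PiM {1..length I} (\<lambda>_. nonneg_borel)) nonneg_borel" .
  moreover have "pad t k (restrict (X \<circ> \<sigma>) {1..length I}) = pad t k (X \<circ> \<sigma>)" for X
    by (rule pad_cong) (use k in auto)
  ultimately show "(\<lambda>X. pad t k (X \<circ> \<sigma>) s) \<in>
      measurable (PiM {1..length I} (\<lambda>_. nonneg_borel)) nonneg_borel"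
    by simp
  fix X assume "X \<in> space (PiM {1..length I} (\<lambda>i. I ! (i - 1)))"
  then have "0 \<le> X j" if "j \<in> {1..length I}" for j
    using values_dist_nonneg[OF I _ that] by (simp add: values_dist_def)
  then have "pad t k (X \<circ> \<sigma>) s \<le> (\<Sum>j=1..length I. (X \<circ> \<sigma>) j)"
    using p by (intro pad_bounds(2)[OF k]) simp
  then show "pad t k (X \<circ> \<sigma>) s \<le> sum X {1..length I}"
    using sum.permute[OF \<sigma>, of X] by simp
qed auto

text \<open>The fallback for positions that are not gapped; it will be weighted by a small
  probability.\<close>

lemma expected_reward_pad_le_opt:
  "(\<integral>X. reward D S N (pad t k (X \<circ> \<sigma>)) \<partial>values_dist I) \<le> expected_opt I"
  unfolding expected_opt_eq[OF I]
proof (rule integral_mono[OF integrable_reward_pad])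
  show "integrable (values_dist I) (largest {1..length I})"
    unfolding values_dist_def
    by (rule integrable_largest) (use admissible_nonneg_distribution[OF I] in auto)
  fix X assume X: "X \<in> space (values_dist I)"
  have p: "\<sigma> s \<in> {1..length I}" if "s \<in> {1..length I}" for s
    using \<sigma> that permutes_in_image by fastforce
  have nn: "0 \<le> (X \<circ> \<sigma>) j" if "j \<in> {1..length I}" for j
    using values_dist_nonneg[OF I X p[OF that]] by simp
  have inj: "inj_on t {1..k}"
    using t(1) by (rule strict_mono_on_imp_inj_on)
  have "reward D S N (pad t k (X \<circ> \<sigma>)) \<le> Max (pad t k (X \<circ> \<sigma>) ` {1..N})"
    by (rule reward_le_Max[OF D N pad_bounds(1)[OF k nn]])
  also have "\<dots> = largest {1..N} (pad t k (X \<circ> \<sigma>))"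
    by (rule Max_eq_largest) (use N pad_bounds(1)[OF k, of "X \<circ> \<sigma>" t] nn in auto)
  also have "\<dots> = largest {1..k} (X \<circ> \<sigma>)"
    by (rule largest_pad[OF inj t(2)]) (use k nn in auto)
  also have "\<dots> \<le> largest {1..length I} X"
    by (rule largest_le) (use k p in \<open>auto intro!: le_largest largest_nonneg\<close>)
  finally show "reward D S N (pad t k (X \<circ> \<sigma>)) \<le> largest {1..length I} X" .
qed

text \<open>\<open>reward_pad_le\<close> integrated. The order \<open>\<sigma>\<close> drops out of
  the error by symmetry, so one error term serves all orders.\<close>

lemma expected_reward_pad_le:
  assumes g: "1 \<le> g" "gapped g N (t ` {1..k})"
  shows "(\<integral>X. reward D S N (pad t k (X \<circ> \<sigma>)) \<partial>values_dist I) \<le>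
    (\<integral>X. reward (\<lambda>_. decay_limit D) (simulate S t k N) (length I) (X \<circ> \<sigma>) \<partial>values_dist I) +
    (\<integral>X. decay_gap D g (length I) X \<partial>values_dist I)"
proof -
  have int: "integrable (values_dist I)
      (\<lambda>X. reward (\<lambda>_. decay_limit D) (simulate S t k N) (length I) (X \<circ> \<sigma>))"
    by (rule integrable_reward_permuted[OF decay_sequence_decay_limit[OF D]
          measurable_rule_simulate[OF S] I \<sigma>])
  have int': "integrable (values_dist I) (decay_gap D g (length I))"
    unfolding values_dist_def
    by (rule integrable_decay_gap[OF D g(1)]) (rule admissible_nonneg_distribution[OF I])
  have "(\<integral>X. reward D S N (pad t k (X \<circ> \<sigma>)) \<partial>values_dist I) \<le>
      (\<integral>X. reward (\<lambda>_. decay_limit D) (simulate S t k N) (length I) (X \<circ> \<sigma>) +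
        decay_gap D g (length I) X \<partial>values_dist I)"
  proof (rule integral_mono[OF integrable_reward_pad Bochner_Integration.integrable_add[OF int int']])
    fix X assume X: "X \<in> space (values_dist I)"
    have "0 \<le> (X \<circ> \<sigma>) j" if "j \<in> {1..length I}" for j
      using values_dist_nonneg[OF I X, of "\<sigma> j"] \<sigma> that permutes_in_image by fastforce
    from reward_pad_le[of D k t N "length I" g "X \<circ> \<sigma>" S, OF D t k admissible_length[OF I] N g this]
    have "reward D S N (pad t k (X \<circ> \<sigma>)) \<le>
      reward (\<lambda>_. decay_limit D) (simulate S t k N) (length I) (X \<circ> \<sigma>) +
      (\<Sum>j=1..length I. D g ((X \<circ> \<sigma>) j) - decay_limit D ((X \<circ> \<sigma>) j))"
      by blast
    also have "(\<Sum>j=1..length I. D g ((X \<circ> \<sigma>) j) - decay_limit D ((X \<circ> \<sigma>) j)) =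
        decay_gap D g (length I) X"
      using sum.permute[OF \<sigma>, of "\<lambda>j. D g (X j) - decay_limit D (X j)"]
      by (simp add: decay_gap_def comp_def)
    finally show "reward D S N (pad t k (X \<circ> \<sigma>)) \<le>
      reward (\<lambda>_. decay_limit D) (simulate S t k N) (length I) (X \<circ> \<sigma>) +
      decay_gap D g (length I) X" .
  qed
  also have "\<dots> = (\<integral>X. reward (\<lambda>_. decay_limit D) (simulate S t k N) (length I) (X \<circ> \<sigma>) \<partial>values_dist I) +
    (\<integral>X. decay_gap D g (length I) X \<partial>values_dist I)"
    by (rule Bochner_Integration.integral_add[OF int int'])
  finally show ?thesis .
qed

end

text \<open>The passage \<open>g \<longrightarrow> \<infinity>\<close>, common to all three models.
  \<open>B\<close> is the expected maximum of \<open>I\<close>, in the IID model shrunk by the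
  factor that thinning may cost.\<close>

lemma competitive_ratio_le_limit:
  fixes c s B :: real
  assumes "decay_sequence D" "admissible m I" "0 < B"
    and "\<And>g. 1 \<le> g \<Longrightarrow> c \<le> s + (\<integral>X. decay_gap D g (length I) X \<partial>values_dist I) / B"
  shows "c \<le> s"
proof -
  have "(\<lambda>g. \<integral>X. decay_gap D (Suc g) (length I) X \<partial>values_dist I) \<longlonglongrightarrow> 0"
    unfolding values_dist_def
    by (rule decay_gap_integral_tendsto[OF assms(1)]) (rule admissible_nonneg_distribution[OF assms(2)])
  then have "(\<lambda>g. s + (\<integral>X. decay_gap D (Suc g) (length I) X \<partial>values_dist I) / B) \<longlonglongrightarrow> s + 0 / B"
    by (intro tendsto_intros) (use assms in auto)
  then show ?thesis
    by (intro LIMSEQ_le_const[where X = "\<lambda>g. s + (\<integral>X. decay_gap D (Suc g) (length I) X \<partial>values_dist I) / B"])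
       (use assms(4) in auto)
qed

text \<open>IID is excluded because deterministic zeros next to the values of \<open>I\<close> would
  make the distributions differ.\<close>

lemma zero_padded_instance:
  assumes I: "admissible m I" "m \<noteq> IID"
    and t: "inj_on t {1..length I}" "t ` {1..length I} \<subseteq> {1..length I'}"
    and It: "\<And>j. j \<in> {1..length I} \<Longrightarrow> I' ! (t j - 1) = I ! (j - 1)"
    and IZ: "\<And>s. s \<in> {1..length I'} - t ` {1..length I} \<Longrightarrow> I' ! (s - 1) = zero_dist"
  shows "admissible m I'" and "expected_opt I' = expected_opt I"
    and "h \<in> borel_measurable (PiM {1..length I'} (\<lambda>_. nonneg_borel)) \<Longrightarrow>
      (\<integral>X. h X \<partial>values_dist I' :: real) =
      (\<integral>X. h (restrict (pad t (length I) X) {1..length I'}) \<partial>values_dist I)"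
proof -
  have nn: "nonneg_distribution (I' ! (s - 1))" if s: "s \<in> {1..length I'}" for s
  proof (cases "s \<in> t ` {1..length I}")
    case True
    then obtain j where "j \<in> {1..length I}" "s = t j" by blast
    then show ?thesis
      using admissible_nonneg_distribution[OF I(1)] It by metis
  next
    case False
    with s have "I' ! (s - 1) = zero_dist"
      by (intro IZ) blast
    then show ?thesis
      by (simp add: nonneg_distribution_zero_dist)
  qed
  have "nonneg_distribution F" if F: "F \<in> set I'" for F
  proof -
    obtain s where s: "s < length I'" "F = I' ! s"
      using F unfolding in_set_conv_nth by blast
    with nn[of "s + 1"] show ?thesis by simp
  qed
  moreover have "I' \<noteq> []"
    using t(2) admissible_length[OF I(1)] by auto
  ultimately show I': "admissible m I'"
    using I(2) by (simp add: admissible_def)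
  have vd: "PiM {1..length I} (\<lambda>j. I' ! (t j - 1)) = values_dist I"
    unfolding values_dist_def by (rule PiM_cong[OF refl]) (rule It)
  have padded: "(\<integral>X. h X \<partial>values_dist I') =
      (\<integral>X. h (restrict (pad t (length I) X) {1..length I'}) \<partial>values_dist I)"
    if "h \<in> borel_measurable (PiM {1..length I'} (\<lambda>_. nonneg_borel))" for h :: "(nat \<Rightarrow> real) \<Rightarrow> real"
    unfolding vd[symmetric] values_dist_def[of I']
    by (rule integral_zero_padded[OF _ t _ that]) (use nn IZ in auto)
  have "expected_opt I' =
      (\<integral>X. largest {1..length I'} (restrict (pad t (length I) X) {1..length I'}) \<partial>values_dist I)"
    unfolding expected_opt_eq[OF I']
    by (rule padded) (auto intro: borel_measurable_largest)
  also have "\<dots> = expected_opt I"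
    unfolding expected_opt_eq[OF I(1)]
  proof (rule Bochner_Integration.integral_cong[OF refl])
    fix X assume "X \<in> space (values_dist I)"
    then have "largest {1..length I'} (pad t (length I) X) = largest {1..length I} X"
      by (intro largest_pad[OF t] values_dist_nonneg[OF I(1)])
    moreover have "largest {1..length I'} (restrict (pad t (length I) X) {1..length I'}) =
        largest {1..length I'} (pad t (length I) X)"
      by (rule largest_cong) simp
    ultimately show "largest {1..length I'} (restrict (pad t (length I) X) {1..length I'}) =
        largest {1..length I} X"
      by simp
  qed
  finally show "expected_opt I' = expected_opt I" .
  show "(\<integral>X. h X \<partial>values_dist I') =
      (\<integral>X. h (restrict (pad t (length I) X) {1..length I'}) \<partial>values_dist I)"
    if "h \<in> borel_measurable (PiM {1..length I'} (\<lambda>_. nonneg_borel))"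
    using that by (rule padded)
qed

lemma competitive_ratio_adversarial_le:
  assumes D: "decay_sequence D" and I: "admissible Adversarial I" and opt: "0 < expected_opt I"
    and A: "A \<in> online_algorithms"
  shows "competitive_ratio Adversarial D A \<le>
    (SUP A\<in>online_algorithms. expected_reward Adversarial (\<lambda>_. decay_limit D) A I / expected_opt I)"
    (is "_ \<le> ?SUP")
proof (rule competitive_ratio_le_limit[OF D I opt])
  fix g :: nat assume g: "1 \<le> g"
  define n where "n = length I"
  have n: "1 \<le> n"
    using admissible_length[OF I] by (simp add: n_def)
  \<comment> \<open>Each value is followed by \<open>g - 1\<close> zeros, the last one included, so
    \<open>t n + g = N + 1\<close> meets the deadline clause with equality.\<close>
  define N where "N = n * g"
  have N: "1 \<le> N" using n g by (simp add: N_def)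
  define I' where "I' = map (\<lambda>s. if s mod g = 0 then I ! (s div g) else zero_dist) [0..<N]"
  define t where "t j = (j - 1) * g + 1" for j
  have len: "length I' = N" by (simp add: I'_def)
  have I'_nth: "I' ! s = (if s mod g = 0 then I ! (s div g) else zero_dist)" if "s < N" for s
    using that by (simp add: I'_def)
  have div: "s div g < n" if "s < N" for s
    using that by (simp add: N_def less_mult_imp_div_less)
  have t_mono: "strict_mono_on {1..n} t"
    using g by (auto simp: strict_mono_on_def t_def)
  then have inj: "inj_on t {1..n}"
    by (rule strict_mono_on_imp_inj_on)
  have end_gap: "t j + g \<le> N + 1" if "j \<in> {1..n}" for j
  proof -
    have "t j + g = j * g + 1"
      using that by (cases j) (simp_all add: t_def)
    also have "\<dots> \<le> N + 1"
      using that by (simp add: N_def)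
    finally show ?thesis .
  qed
  then have tN: "t ` {1..n} \<subseteq> {1..N}"
    using g by (fastforce simp: t_def)
  have gapped: "gapped g N (t ` {1..n})"
    unfolding gapped_def
  proof (intro ballI conjI impI)
    fix s s' assume "s \<in> t ` {1..n}" "s' \<in> t ` {1..n}" "s < s'"
    then obtain i j where ij: "s = t i" "s' = t j" "i \<in> {1..n}" "j \<in> {1..n}" "t i < t j" by blast
    then have "i \<le> j - 1"
      by (auto simp: t_def)
    then have "i * g \<le> (j - 1) * g"
      by (rule mult_le_mono1)
    moreover have "t i + g = i * g + 1"
      using ij by (cases i) (simp_all add: t_def)
    ultimately show "s + g \<le> s'"
      using ij by (simp add: t_def)
  qed (use end_gap in auto)
  have It: "I' ! (t j - 1) = I ! (j - 1)" if "j \<in> {1..n}" for j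
  proof -
    have "(j - 1) * g < N"
      using end_gap[OF that] g by (simp add: t_def)
    then show ?thesis
      using g by (simp add: t_def I'_nth)
  qed
  have IZ: "I' ! (s - 1) = zero_dist" if s: "s \<in> {1..N} - t ` {1..n}" for s
  proof -
    have s1: "s - 1 < N"
      using s by auto
    have "(s - 1) mod g \<noteq> 0"
    proof
      assume "(s - 1) mod g = 0"
      then have "s - 1 = (s - 1) div g * g"
        by (metis add.right_neutral div_mult_mod_eq)
      then have "s = t ((s - 1) div g + 1)"
        using s by (simp add: t_def)
      moreover have "(s - 1) div g + 1 \<in> {1..n}"
        using div[OF s1] by simp
      ultimately show False
        using s by blast
    qed
    with s1 show ?thesis
      by (simp add: I'_nth)
  qed
  note zero_padded = zero_padded_instance[of Adversarial I t I', folded n_def, unfolded len, OF I _ inj tN]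
  have I': "admissible Adversarial I'"
    by (rule zero_padded(1)) (blast intro: It IZ)+
  have opt': "expected_opt I' = expected_opt I"
    by (rule zero_padded(2)) (blast intro: It IZ)+
  have padded: "(\<integral>X. h X \<partial>values_dist I') = (\<integral>X. h (restrict (pad t n X) {1..N}) \<partial>values_dist I)"
    if "h \<in> borel_measurable (PiM {1..N} (\<lambda>_. nonneg_borel))" for h :: "(nat \<Rightarrow> real) \<Rightarrow> real"
    by (rule zero_padded(3)[OF _ _ _ that]) (blast intro: It IZ)+
  \<comment> \<open>The rule is the one chosen for the padded instance and thus depends on
    \<open>g\<close>; from here on it is fixed and only imitated.\<close>
  define S where "S = A I'"
  have S: "measurable_rule S"
    using A by (simp add: S_def online_algorithms_def)
  have "expected_reward Adversarial D A I' =
      (\<integral>X. reward D S N (restrict (pad t n X) {1..N}) \<partial>values_dist I)"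
    unfolding expected_reward_fixed_order[of Adversarial, simplified] len S_def[symmetric]
    by (rule padded) (rule borel_measurable_reward[OF D S])
  also have "\<dots> = (\<integral>X. reward D S N (pad t n (X \<circ> id)) \<partial>values_dist I)"
    by (intro Bochner_Integration.integral_cong refl reward_cong) simp
  also have "\<dots> \<le> (\<integral>X. reward (\<lambda>_. decay_limit D) (simulate S t n N) (length I) (X \<circ> id) \<partial>values_dist I) +
      (\<integral>X. decay_gap D g (length I) X \<partial>values_dist I)"
    by (rule expected_reward_pad_le[OF D S I N _ t_mono tN permutes_id g gapped]) (simp add: n_def)
  also have "(\<integral>X. reward (\<lambda>_. decay_limit D) (simulate S t n N) (length I) (X \<circ> id) \<partial>values_dist I) =
      expected_reward Adversarial (\<lambda>_. decay_limit D) (\<lambda>_. simulate S t n N) I"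
    by (simp add: expected_reward_fixed_order)
  also have "\<dots> \<le> ?SUP * expected_opt I"
    by (rule expected_reward_le_SUP[OF decay_sequence_decay_limit[OF D]
          online_algorithms_const[OF measurable_rule_simulate[OF S]] I opt])
  finally have *: "expected_reward Adversarial D A I' \<le>
      ?SUP * expected_opt I + (\<integral>X. decay_gap D g (length I) X \<partial>values_dist I)"
    by simp
  have "competitive_ratio Adversarial D A \<le> expected_reward Adversarial D A I' / expected_opt I'"
    by (rule competitive_ratio_le[OF D A I']) (simp add: opt' opt)
  also have "\<dots> \<le> ?SUP + (\<integral>X. decay_gap D g (length I) X \<partial>values_dist I) / expected_opt I"
    using * opt by (simp add: opt' field_simps)
  finally show "competitive_ratio Adversarial D A \<le>
      ?SUP + (\<integral>X. decay_gap D g (length I) X \<partial>values_dist I) / expected_opt I" .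
qed

subsection \<open>Random order\<close>

lemma obtain_enumeration:
  fixes T :: "nat set"
  assumes "finite T"
  obtains t where "strict_mono_on {1..card T} t" "t ` {1..card T} = T"
proof -
  obtain h where h: "bij_betw h {..<card T} T" "strict_mono_on {..<card T} h"
    using ex_bij_betw_strict_mono_card[OF assms] .
  show ?thesis
  proof
    show "strict_mono_on {1..card T} (\<lambda>j. h (j - 1))"
    proof (rule strict_mono_onI)
      fix r s assume "r \<in> {1..card T}" "s \<in> {1..card T}" "r < s"
      then show "h (r - 1) < h (s - 1)"
        by (intro strict_mono_onD[OF h(2)]) auto
    qed
    have "(\<lambda>j. j - 1) ` {1..card T} = {..<card T}"
    proof (intro equalityI subsetI)
      fix i assume "i \<in> {..<card T}"
      then show "i \<in> (\<lambda>j. j - 1) ` {1..card T}"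
        by (intro image_eqI[of _ _ "i + 1"]) auto
    qed auto
    then have "(\<lambda>j. h (j - 1)) ` {1..card T} = h ` {..<card T}"
      by (metis image_image)
    then show "(\<lambda>j. h (j - 1)) ` {1..card T} = T"
      using h(1) by (simp add: bij_betw_def)
  qed
qed

text \<open>The image of \<open>i\<close> under a uniform permutation is uniform. Composition with a
  transposition shows that all indices give the same sum, and the sum over all indices does not
  depend on the permutation.\<close>

lemma sum_permutations_apply:
  fixes f :: "nat \<Rightarrow> real"
  assumes i: "i \<in> {1..M}"
  shows "real M * (\<Sum>q | q permutes {1..M}. f (q i)) = fact M * (\<Sum>s=1..M. f s)"
proof -
  have eq: "(\<Sum>q | q permutes {1..M}. f (q i)) = (\<Sum>q | q permutes {1..M}. f (q j))" if "j \<in> {1..M}" for j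
  proof -
    have "Transposition.transpose i j permutes {1..M}"
      using i that by (rule permutes_swap_id)
    from sum_permutations_compose_right[OF this, of "\<lambda>q. f (q i)"] show ?thesis
      by simp
  qed
  have "(\<Sum>j=1..M. \<Sum>q | q permutes {1..M}. f (q j)) =
      (\<Sum>j=1..M. \<Sum>q | q permutes {1..M}. f (q i))"
    by (rule sum.cong[OF refl]) (rule eq[symmetric])
  then have "real M * (\<Sum>q | q permutes {1..M}. f (q i)) =
      (\<Sum>j=1..M. \<Sum>q | q permutes {1..M}. f (q j))"
    by simp
  also have "\<dots> = (\<Sum>q | q permutes {1..M}. \<Sum>j=1..M. f (q j))"
    by (rule sum.swap)
  also have "\<dots> = (\<Sum>q | q permutes {1..M}. \<Sum>s=1..M. f s)"
  proof (rule sum.cong[OF refl])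
    fix q assume "q \<in> {q. q permutes {1..M}}"
    then show "(\<Sum>j=1..M. f (q j)) = (\<Sum>s=1..M. f s)"
      using sum.permute[of q "{1..M}" f] by (simp add: comp_def)
  qed
  also have "\<dots> = fact M * (\<Sum>s=1..M. f s)"
    by (simp add: card_permutations)
  finally show ?thesis .
qed

text \<open>The same symmetry for pairs: transposing \<open>i'\<close> with any \<open>j\<close>
  other than \<open>i\<close> keeps \<open>i\<close> fixed. This leaves \<open>M - 1\<close> choices
  of \<open>j\<close>, which explains the factor on the left.\<close>

lemma sum_permutations_apply2_le:
  fixes f :: "nat \<Rightarrow> nat \<Rightarrow> real"
  assumes i: "i \<in> {1..M}" "i' \<in> {1..M}" "i \<noteq> i'"
    and f: "\<And>a b. 0 \<le> f a b" "\<And>a. (\<Sum>s=1..M. f a s) \<le> B"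
  shows "real (M - 1) * (\<Sum>q | q permutes {1..M}. f (q i) (q i')) \<le> fact M * B"
proof -
  have eq: "(\<Sum>q | q permutes {1..M}. f (q i) (q i')) = (\<Sum>q | q permutes {1..M}. f (q i) (q j))"
    if "j \<in> {1..M} - {i}" for j
  proof -
    have "Transposition.transpose i' j permutes {1..M}"
      using i that by (intro permutes_swap_id) auto
    moreover have "Transposition.transpose i' j i = i"
      using i that by (auto simp: Transposition.transpose_def)
    ultimately show ?thesis
      using sum_permutations_compose_right[of "Transposition.transpose i' j" "{1..M}" "\<lambda>q. f (q i) (q i')"]
      by simp
  qed
  have "(\<Sum>j\<in>{1..M} - {i}. \<Sum>q | q permutes {1..M}. f (q i) (q j)) =
      (\<Sum>j\<in>{1..M} - {i}. \<Sum>q | q permutes {1..M}. f (q i) (q i'))"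
    by (rule sum.cong[OF refl]) (rule eq[symmetric])
  also have "\<dots> = real (M - 1) * (\<Sum>q | q permutes {1..M}. f (q i) (q i'))"
    using i by simp
  finally have "real (M - 1) * (\<Sum>q | q permutes {1..M}. f (q i) (q i')) =
      (\<Sum>j\<in>{1..M} - {i}. \<Sum>q | q permutes {1..M}. f (q i) (q j))"
    by simp
  also have "\<dots> = (\<Sum>q | q permutes {1..M}. \<Sum>j\<in>{1..M} - {i}. f (q i) (q j))"
    by (rule sum.swap)
  also have "\<dots> \<le> (\<Sum>q | q permutes {1..M}. B)"
  proof (rule sum_mono)
    fix q assume "q \<in> {q. q permutes {1..M}}"
    then have "(\<Sum>j=1..M. f (q i) (q j)) = (\<Sum>s=1..M. f (q i) s)"
      using sum.permute[of q "{1..M}" "f (q i)"] by (simp add: comp_def)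
    moreover have "(\<Sum>j\<in>{1..M} - {i}. f (q i) (q j)) \<le> (\<Sum>j=1..M. f (q i) (q j))"
      by (rule sum_mono2) (auto simp: f)
    ultimately show "(\<Sum>j\<in>{1..M} - {i}. f (q i) (q j)) \<le> B"
      using f(2)[of "q i"] by simp
  qed
  also have "\<dots> = fact M * B"
    by (simp add: card_permutations)
  finally show ?thesis .
qed

text \<open>A union bound over single values close to the deadline and pairs of values close to each
  other. As \<open>\<pi>\<close> maps times to indices, \<open>inv \<pi> i\<close> is the time at
  which value \<open>i\<close> arrives.\<close>

lemma not_gapped_le:
  assumes p: "\<pi> permutes {1..M}"
  shows "of_bool (\<not> gapped g M {s\<in>{1..M}. \<pi> s \<in> {1..n}}) \<le>
    (\<Sum>i=1..n. of_bool (M + 1 < inv \<pi> i + g)) +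
    (\<Sum>i=1..n. \<Sum>i'\<in>{1..n} - {i}. of_bool (inv \<pi> i < inv \<pi> i' \<and> inv \<pi> i' < inv \<pi> i + g) :: real)"
    (is "_ \<le> ?A + ?B")
proof (cases "gapped g M {s\<in>{1..M}. \<pi> s \<in> {1..n}}")
  case True
  then show ?thesis
    by (auto intro!: add_nonneg_nonneg sum_nonneg)
next
  case False
  have A: "0 \<le> ?A" and B: "0 \<le> ?B"
    by (auto intro!: sum_nonneg)
  have inv: "inv \<pi> (\<pi> s) = s" for s
    using permutes_inverses(2)[OF p] .
  from False obtain s where s: "\<pi> s \<in> {1..n}"
    and "M + 1 < s + g \<or> (\<exists>s'. \<pi> s' \<in> {1..n} \<and> s < s' \<and> s' < s + g)"
    unfolding gapped_def by (auto simp: not_le)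
  then consider "M + 1 < s + g" | s' where "\<pi> s' \<in> {1..n}" "s < s'" "s' < s + g"
    by blast
  then have "1 \<le> ?A \<or> 1 \<le> ?B"
  proof cases
    case 1
    have "of_bool (M + 1 < inv \<pi> (\<pi> s) + g) \<le> ?A"
      by (rule member_le_sum[OF s]) auto
    with 1 show ?thesis by (simp add: inv)
  next
    case 2
    have ne: "\<pi> s' \<in> {1..n} - {\<pi> s}"
      using 2 inv by (metis Diff_iff less_irrefl singletonD)
    have "of_bool (inv \<pi> (\<pi> s) < inv \<pi> (\<pi> s') \<and> inv \<pi> (\<pi> s') < inv \<pi> (\<pi> s) + g) \<le>
        (\<Sum>i'\<in>{1..n} - {\<pi> s}. of_bool (inv \<pi> (\<pi> s) < inv \<pi> i' \<and> inv \<pi> i' < inv \<pi> (\<pi> s) + g) :: real)"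
      by (rule member_le_sum[OF ne]) auto
    also have "\<dots> \<le> ?B"
      by (rule member_le_sum[OF s]) (auto intro!: sum_nonneg)
    finally show ?thesis
      using 2 by (simp add: inv)
  qed
  with A B False show ?thesis by auto
qed

text \<open>Each of at most \<open>n + n * n\<close> bad events has probability at most
  \<open>g / N\<close>: the relevant position is uniform on \<open>M\<close> or \<open>M - 1\<close>
  places, both at least \<open>N\<close>, and at most \<open>g\<close> of them are bad.\<close>

lemma sum_not_gapped_le:
  assumes N: "1 \<le> N" and n: "1 \<le> n" and M: "M = n + N"
  shows "real N * (\<Sum>\<pi> | \<pi> permutes {1..M}. of_bool (\<not> gapped g M {s\<in>{1..M}. \<pi> s \<in> {1..n}})) \<le>
    fact M * (real g * (real n + real n * real n))"
proof -
  define P where "P = {\<pi>. \<pi> permutes {1..M}}"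
  define a where "a i = (\<Sum>q\<in>P. of_bool (M + 1 < q i + g) :: real)" for i
  define b where "b i i' = (\<Sum>q\<in>P. of_bool (q i < q i' \<and> q i' < q i + g) :: real)" for i i'
  have nonneg: "0 \<le> a i" "0 \<le> b i i'" for i i'
    unfolding a_def b_def by (auto intro!: sum_nonneg)
  have a: "real N * a i \<le> fact M * real g" if "i \<in> {1..n}" for i
  proof -
    have "(\<Sum>s=1..M. of_bool (M + 1 < s + g) :: real) = real (card {s\<in>{1..M}. M + 1 < s + g})"
      by (simp add: sum.If_cases of_bool_def Int_def)
    also have "\<dots> \<le> real (card {M + 1 - g<..M})"
      by (intro of_nat_mono card_mono) auto
    also have "\<dots> \<le> real g"
      by simp
    finally have *: "(\<Sum>s=1..M. of_bool (M + 1 < s + g) :: real) \<le> real g" .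
    have "real N * a i \<le> real M * a i"
      by (intro mult_right_mono nonneg) (simp add: M)
    also have "\<dots> = fact M * (\<Sum>s=1..M. of_bool (M + 1 < s + g))"
      unfolding a_def P_def by (rule sum_permutations_apply) (use that M in auto)
    also have "\<dots> \<le> fact M * real g"
      by (intro mult_left_mono *) simp
    finally show ?thesis .
  qed
  have b: "real N * b i i' \<le> fact M * real g" if "i \<in> {1..n}" "i' \<in> {1..n} - {i}" for i i'
  proof -
    have *: "(\<Sum>s=1..M. of_bool (x < s \<and> s < x + g) :: real) \<le> real g" for x
    proof -
      have "(\<Sum>s=1..M. of_bool (x < s \<and> s < x + g) :: real) = real (card {s\<in>{1..M}. x < s \<and> s < x + g})"
        by (simp add: sum.If_cases of_bool_def Int_def)
      also have "\<dots> \<le> real (card {x<..<x + g})"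
        by (intro of_nat_mono card_mono) auto
      also have "\<dots> \<le> real g"
        by simp
      finally show ?thesis .
    qed
    have "real N * b i i' \<le> real (M - 1) * b i i'"
      using n by (intro mult_right_mono nonneg) (simp add: M)
    also have "\<dots> \<le> fact M * real g"
      unfolding b_def P_def
      by (rule sum_permutations_apply2_le[where f = "\<lambda>x y. of_bool (x < y \<and> y < x + g)"])
         (use that M * in auto)
    finally show ?thesis .
  qed
  have inverse: "(\<Sum>\<pi>\<in>P. f (inv \<pi>)) = (\<Sum>q\<in>P. f q)" for f :: "(nat \<Rightarrow> nat) \<Rightarrow> real"
    unfolding P_def using sum_permutations_inverse[of f "{1..M}"] by simp
  have "(\<Sum>\<pi>\<in>P. of_bool (\<not> gapped g M {s\<in>{1..M}. \<pi> s \<in> {1..n}})) \<le>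
      (\<Sum>\<pi>\<in>P. (\<Sum>i=1..n. of_bool (M + 1 < inv \<pi> i + g)) +
        (\<Sum>i=1..n. \<Sum>i'\<in>{1..n} - {i}. of_bool (inv \<pi> i < inv \<pi> i' \<and> inv \<pi> i' < inv \<pi> i + g) :: real))"
    by (rule sum_mono) (use not_gapped_le in \<open>simp add: P_def\<close>)
  also have "\<dots> = (\<Sum>q\<in>P. (\<Sum>i=1..n. of_bool (M + 1 < q i + g)) +
        (\<Sum>i=1..n. \<Sum>i'\<in>{1..n} - {i}. of_bool (q i < q i' \<and> q i' < q i + g)))"
    by (rule inverse)
  also have "\<dots> = (\<Sum>i=1..n. a i) + (\<Sum>i=1..n. \<Sum>i'\<in>{1..n} - {i}. b i i')"
    unfolding a_def b_def sum.distrib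
    by (intro arg_cong2[of _ _ _ _ "(+)"])
       (simp_all add: sum.swap[of _ P] cong: sum.cong)
  finally have "real N * (\<Sum>\<pi>\<in>P. of_bool (\<not> gapped g M {s\<in>{1..M}. \<pi> s \<in> {1..n}})) \<le>
      real N * ((\<Sum>i=1..n. a i) + (\<Sum>i=1..n. \<Sum>i'\<in>{1..n} - {i}. b i i'))"
    by (rule mult_left_mono) simp
  also have "\<dots> = (\<Sum>i=1..n. real N * a i) + (\<Sum>i=1..n. \<Sum>i'\<in>{1..n} - {i}. real N * b i i')"
    by (simp add: distrib_left sum_distrib_left)
  also have "\<dots> \<le> (\<Sum>i=1..n. fact M * real g) + (\<Sum>i=1..n. \<Sum>i'\<in>{1..n} - {i}. fact M * real g)"
    by (intro add_mono sum_mono a b)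
  also have "\<dots> \<le> (\<Sum>i=1..n. fact M * real g) + (\<Sum>i=1..n. \<Sum>i'\<in>{1..n}. fact M * real g)"
    by (intro add_mono order_refl sum_mono sum_mono2) auto
  also have "\<dots> = fact M * (real g * (real n + real n * real n))"
    by (simp add: algebra_simps)
  finally show ?thesis
    by (simp add: P_def)
qed

text \<open>Left multiplication by permutations of \<open>{1..n}\<close> leaves the set of positions of the real values
  fixed and makes their relative order uniform.\<close>

lemma expected_reward_zero_append_le:
  assumes D: "decay_sequence D" and S: "measurable_rule S" and I: "admissible m I"
    and opt: "0 < expected_opt I" and g: "1 \<le> g" and M: "length I \<le> M"
    and p: "\<pi> permutes {1..M}" and n_def: "n = length I"
  defines "s \<equiv> (SUP A\<in>online_algorithms.
      expected_reward Random_Order (\<lambda>_. decay_limit D) A I / expected_opt I) * expected_opt I"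
  shows "(\<Sum>\<sigma> | \<sigma> permutes {1..n}. \<integral>X. reward D S M (pad id n X \<circ> (\<sigma> \<circ> \<pi>)) \<partial>values_dist I) \<le>
    fact n * (s + (\<integral>X. decay_gap D g n X \<partial>values_dist I) +
      of_bool (\<not> gapped g M {s\<in>{1..M}. \<pi> s \<in> {1..n}}) * expected_opt I)"
proof -
  have IR: "admissible Random_Order I"
    using I by (simp add: admissible_def)
  define T where "T = {s\<in>{1..M}. \<pi> s \<in> {1..n}}"
  have n: "1 \<le> n" and M1: "1 \<le> M"
    using admissible_length[OF I] M by (simp_all add: n_def)
  have bij: "bij_betw \<pi> T {1..n}"
  proof -
    have "\<pi> ` T = {1..n}"
    proof (intro equalityI subsetI)
      fix i assume i: "i \<in> {1..n}"
      then have "i \<in> {1..M}" using M by (simp add: n_def)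
      then obtain s where "s \<in> {1..M}" "i = \<pi> s"
        using permutes_image[OF p] by blast
      with i show "i \<in> \<pi> ` T" by (auto simp: T_def)
    qed (auto simp: T_def)
    moreover have "inj_on \<pi> T"
      using permutes_inj_on[OF p] .
    ultimately show ?thesis by (simp add: bij_betw_def)
  qed
  then have "card T = n"
    using bij_betw_same_card by fastforce
  moreover have "finite T" by (simp add: T_def)
  ultimately obtain t where t: "strict_mono_on {1..n} t" "t ` {1..n} = T"
    using obtain_enumeration[of T] by metis
  have inj: "inj_on t {1..n}"
    using t(1) by (rule strict_mono_on_imp_inj_on)
  have tM: "t ` {1..n} \<subseteq> {1..M}"
    unfolding t(2) by (auto simp: T_def)
  \<comment> \<open>The order in which \<open>\<pi>\<close> reveals the values of \<open>I\<close>
    once the zeros are ignored, since \<open>t\<close> lists their times increasingly.\<close>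
  define \<rho> where "\<rho> j = (if j \<in> {1..n} then \<pi> (t j) else j)" for j
  have "bij_betw (\<pi> \<circ> t) {1..n} {1..n}"
    using inj t(2) bij by (intro bij_betw_trans[of t _ T]) (auto simp: bij_betw_def)
  then have "bij_betw \<rho> {1..n} {1..n}"
    by (subst bij_betw_cong[of _ _ "\<pi> \<circ> t"]) (auto simp: \<rho>_def)
  then have \<rho>: "\<rho> permutes {1..n}"
    by (rule bij_imp_permutes) (simp only: \<rho>_def if_False)
  have path: "reward D S M (pad id n X \<circ> (\<sigma> \<circ> \<pi>)) = reward D S M (pad t n (X \<circ> (\<sigma> \<circ> \<rho>)))"
    if \<sigma>: "\<sigma> permutes {1..n}" for \<sigma> X
  proof (rule reward_cong)
    fix s assume s: "s \<in> {1..M}"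
    show "(pad id n X \<circ> (\<sigma> \<circ> \<pi>)) s = pad t n (X \<circ> (\<sigma> \<circ> \<rho>)) s"
    proof (cases "s \<in> T")
      case True
      then obtain j where j: "j \<in> {1..n}" "s = t j"
        using t(2) by blast
      have "\<sigma> (\<pi> s) \<in> {1..n}"
        using True \<sigma> permutes_in_image by (fastforce simp: T_def)
      then have "pad id n X (\<sigma> (\<pi> s)) = X (\<sigma> (\<pi> s))"
        using pad_at[of id n "\<sigma> (\<pi> s)" X] by simp
      then show ?thesis
        using pad_at[OF inj j(1)] j by (simp add: \<rho>_def)
    next
      case False
      then have "\<pi> s \<notin> {1..n}" using s by (simp add: T_def)
      then have "\<sigma> (\<pi> s) \<notin> id ` {1..n}"
        using permutes_not_in[OF \<sigma>] by simp
      then have "pad id n X (\<sigma> (\<pi> s)) = 0"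
        by (rule pad_off)
      moreover have "pad t n (X \<circ> (\<sigma> \<circ> \<rho>)) s = 0"
        by (rule pad_off) (use False t(2) in simp)
      ultimately show ?thesis by simp
    qed
  qed
  have "(\<Sum>\<sigma> | \<sigma> permutes {1..n}. \<integral>X. reward D S M (pad id n X \<circ> (\<sigma> \<circ> \<pi>)) \<partial>values_dist I) =
      (\<Sum>\<sigma> | \<sigma> permutes {1..n}. \<integral>X. reward D S M (pad t n (X \<circ> (\<sigma> \<circ> \<rho>))) \<partial>values_dist I)"
    by (rule sum.cong[OF refl]) (simp add: path del: o_apply)
  \<comment> \<open>Right translation by \<open>\<rho>\<close> is a bijection of the permutations of
    \<open>{1..n}\<close>. Hence only the positions \<open>T\<close> are left of
    \<open>\<pi>\<close>, and the simulated rule can depend on them alone.\<close>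
  also have "\<dots> = (\<Sum>\<sigma> | \<sigma> permutes {1..n}. \<integral>X. reward D S M (pad t n (X \<circ> \<sigma>)) \<partial>values_dist I)"
    using sum_permutations_compose_right[OF \<rho>,
      of "\<lambda>\<sigma>. \<integral>X. reward D S M (pad t n (X \<circ> \<sigma>)) \<partial>values_dist I"] by simp
  also have "\<dots> \<le> fact n * (s + (\<integral>X. decay_gap D g n X \<partial>values_dist I) +
      of_bool (\<not> gapped g M T) * expected_opt I)"
  proof (cases "gapped g M T")
    case True
    define R where "R \<sigma> = (\<integral>X. reward (\<lambda>_. decay_limit D) (simulate S t n M) n (X \<circ> \<sigma>) \<partial>values_dist I)" for \<sigma>
    have "(\<Sum>\<sigma> | \<sigma> permutes {1..n}. \<integral>X. reward D S M (pad t n (X \<circ> \<sigma>)) \<partial>values_dist I) \<le>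
        (\<Sum>\<sigma> | \<sigma> permutes {1..n}. R \<sigma> + (\<integral>X. decay_gap D g n X \<partial>values_dist I))"
    proof (rule sum_mono)
      fix \<sigma> assume "\<sigma> \<in> {\<sigma>. \<sigma> permutes {1..n}}"
      then show "(\<integral>X. reward D S M (pad t n (X \<circ> \<sigma>)) \<partial>values_dist I) \<le>
          R \<sigma> + (\<integral>X. decay_gap D g n X \<partial>values_dist I)"
        unfolding R_def n_def
        by (intro expected_reward_pad_le[OF D S I M1 _ _ _ _ g])
           (use t tM True in \<open>simp_all add: n_def\<close>)
    qed
    also have "\<dots> = (\<Sum>\<sigma> | \<sigma> permutes {1..n}. R \<sigma>) + fact n * (\<integral>X. decay_gap D g n X \<partial>values_dist I)"
      by (simp add: sum.distrib card_permutations)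
    also have "\<dots> \<le> fact n * s + fact n * (\<integral>X. decay_gap D g n X \<partial>values_dist I)"
    proof (rule add_right_mono)
      have "(\<Sum>\<sigma> | \<sigma> permutes {1..n}. R \<sigma>) =
          fact n * expected_reward Random_Order (\<lambda>_. decay_limit D) (\<lambda>_. simulate S t n M) I"
        by (simp add: expected_reward_random_order R_def n_def)
      also have "\<dots> \<le> fact n * s"
        unfolding s_def
        by (intro mult_left_mono expected_reward_le_SUP[OF decay_sequence_decay_limit[OF D]
              online_algorithms_const[OF measurable_rule_simulate[OF S]] IR opt]) simp
      finally show "(\<Sum>\<sigma> | \<sigma> permutes {1..n}. R \<sigma>) \<le> fact n * s" .
    qed
    also have "fact n * s + fact n * (\<integral>X. decay_gap D g n X \<partial>values_dist I) =
        fact n * (s + (\<integral>X. decay_gap D g n X \<partial>values_dist I) +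
          of_bool (\<not> gapped g M T) * expected_opt I)"
      using True by (simp add: distrib_left)
    finally show ?thesis .
  next
    case False
    have "(\<Sum>\<sigma> | \<sigma> permutes {1..n}. \<integral>X. reward D S M (pad t n (X \<circ> \<sigma>)) \<partial>values_dist I) \<le>
        (\<Sum>\<sigma> | \<sigma> permutes {1..n}. expected_opt I)"
    proof (rule sum_mono)
      fix \<sigma> assume "\<sigma> \<in> {\<sigma>. \<sigma> permutes {1..n}}"
      then show "(\<integral>X. reward D S M (pad t n (X \<circ> \<sigma>)) \<partial>values_dist I) \<le> expected_opt I"
        by (intro expected_reward_pad_le_opt[OF D S I M1 _ t(1) tM]) (simp_all add: n_def)
    qed
    also have "\<dots> = fact n * expected_opt I"
      by (simp add: card_permutations)
    also have "\<dots> \<le> fact n * (s + (\<integral>X. decay_gap D g n X \<partial>values_dist I) + expected_opt I)"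
    proof -
      have "0 \<le> expected_reward Random_Order (\<lambda>_. decay_limit D) (\<lambda>_. simulate S t n M) I"
        by (rule expected_reward_bounds(1)[OF decay_sequence_decay_limit[OF D]
              online_algorithms_const[OF measurable_rule_simulate[OF S]] IR])
      also have "\<dots> \<le> s"
        unfolding s_def
        by (rule expected_reward_le_SUP[OF decay_sequence_decay_limit[OF D]
              online_algorithms_const[OF measurable_rule_simulate[OF S]] IR opt])
      finally have "0 \<le> s" .
      moreover have "0 \<le> (\<integral>X. decay_gap D g n X \<partial>values_dist I)"
        using values_dist_nonneg[OF I] unfolding n_def
        by (intro Bochner_Integration.integral_nonneg decay_gap_bounds(1)[OF D g]) blast
      ultimately show ?thesis
        by (intro mult_left_mono) auto
    qed
    finally show ?thesis
      using False by simp
  qed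
  finally show ?thesis
    by (simp add: T_def)
qed

lemma competitive_ratio_random_order_le:
  assumes D: "decay_sequence D" and I: "admissible Random_Order I" and opt: "0 < expected_opt I"
    and A: "A \<in> online_algorithms"
  shows "competitive_ratio Random_Order D A \<le>
    (SUP A\<in>online_algorithms. expected_reward Random_Order (\<lambda>_. decay_limit D) A I / expected_opt I)"
    (is "_ \<le> ?SUP")
proof (rule competitive_ratio_le_limit[OF D I opt])
  fix g :: nat assume g: "1 \<le> g"
  define n where "n = length I"
  have n: "1 \<le> n"
    using admissible_length[OF I] by (simp add: n_def)
  define \<delta> where "\<delta> = (\<integral>X. decay_gap D g n X \<partial>values_dist I)"
  \<comment> \<open>The numerator from \<open>sum_not_gapped_le\<close>, free of \<open>N'\<close>,
    so that its contribution vanishes in the inner limit.\<close>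
  define c where "c = real g * (real n + real n * real n)"
  have bound: "competitive_ratio Random_Order D A \<le> ?SUP + \<delta> / expected_opt I + c / real (Suc N')" for N'
  proof -
    define N where "N = Suc N'"
    define M where "M = n + N"
    define I' where "I' = I @ replicate N zero_dist"
    have len: "length I' = M" by (simp add: I'_def M_def n_def)
    have inj: "inj_on id {1..n}" by simp
    have tN: "id ` {1..n} \<subseteq> {1..M}" by (auto simp: M_def)
    have It: "I' ! (id j - 1) = I ! (j - 1)" if "j \<in> {1..n}" for j
      using that by (auto simp: I'_def n_def nth_append)
    have IZ: "I' ! (s - 1) = zero_dist" if "s \<in> {1..M} - id ` {1..n}" for s
      using that by (auto simp: I'_def n_def M_def nth_append)
    note zero_padded = zero_padded_instance[of Random_Order I id I', folded n_def, unfolded len, OF I _ inj tN]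
    have I': "admissible Random_Order I'"
      by (rule zero_padded(1)) (blast intro: It IZ)+
    have opt': "expected_opt I' = expected_opt I"
      by (rule zero_padded(2)) (blast intro: It IZ)+
    have padded: "(\<integral>X. h X \<partial>values_dist I') = (\<integral>X. h (restrict (pad id n X) {1..M}) \<partial>values_dist I)"
      if "h \<in> borel_measurable (PiM {1..M} (\<lambda>_. nonneg_borel))" for h :: "(nat \<Rightarrow> real) \<Rightarrow> real"
      by (rule zero_padded(3)[OF _ _ _ that]) (blast intro: It IZ)+
    define S where "S = A I'"
    have S: "measurable_rule S"
      using A by (simp add: S_def online_algorithms_def)
    define \<phi> where "\<phi> \<pi> = (\<integral>X. reward D S M (pad id n X \<circ> \<pi>) \<partial>values_dist I)" for \<pi>
    have \<phi>: "(\<integral>X. reward D S M (X \<circ> \<pi>) \<partial>values_dist I') = \<phi> \<pi>" if p: "\<pi> permutes {1..M}" for \<pi>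
    proof -
      have p': "\<pi> s \<in> {1..M}" if "s \<in> {1..M}" for s
        using p that permutes_in_image by fastforce
      have "integrable (values_dist I') (\<lambda>X. reward D S M (X \<circ> \<pi>))"
        using integrable_reward_permuted[OF D S I', unfolded len, OF p] .
      then have "(\<lambda>X. reward D S M (X \<circ> \<pi>)) \<in> borel_measurable (PiM {1..M} (\<lambda>_. nonneg_borel))"
        using measurable_PiM_nonneg[of "{1..M}" "\<lambda>i. I' ! (i - 1)" borel]
          admissible_nonneg_distribution[OF I'] borel_measurable_integrable
        unfolding values_dist_def len by blast
      from padded[OF this] have "(\<integral>X. reward D S M (X \<circ> \<pi>) \<partial>values_dist I') =
          (\<integral>X. reward D S M (restrict (pad id n X) {1..M} \<circ> \<pi>) \<partial>values_dist I)" .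
      also have "\<dots> = \<phi> \<pi>"
        unfolding \<phi>_def
        by (intro Bochner_Integration.integral_cong refl reward_cong) (use p' in \<open>auto simp: restrict_def\<close>)
      finally show ?thesis .
    qed
    define u where "u \<pi> = of_bool (\<not> gapped g M {s\<in>{1..M}. \<pi> s \<in> {1..n}}) * expected_opt I" for \<pi>
    \<comment> \<open>Each \<open>\<sigma>\<close> also permutes \<open>{1..M}\<close>, so replacing
      \<open>\<pi>\<close> by \<open>\<sigma> \<circ> \<pi>\<close> preserves the sum over
      \<open>\<pi>\<close>. Summing over \<open>\<sigma>\<close> costs the factor
      \<open>fact n\<close> and, after exchanging the sums, produces the inner sums that have been
      bounded.\<close>
    have "fact n * (\<Sum>\<pi> | \<pi> permutes {1..M}. \<phi> \<pi>) =
        (\<Sum>\<sigma> | \<sigma> permutes {1..n}. \<Sum>\<pi> | \<pi> permutes {1..M}. \<phi> (\<sigma> \<circ> \<pi>))"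
    proof -
      have "(\<Sum>\<pi> | \<pi> permutes {1..M}. \<phi> (\<sigma> \<circ> \<pi>)) = (\<Sum>\<pi> | \<pi> permutes {1..M}. \<phi> \<pi>)"
        if "\<sigma> permutes {1..n}" for \<sigma>
      proof -
        have "\<sigma> permutes {1..M}"
          by (rule permutes_subset[OF that]) (simp add: M_def)
        from setum_permutations_compose_left[OF this, of \<phi>] show ?thesis by simp
      qed
      then show ?thesis
        by (simp add: card_permutations)
    qed
    also have "\<dots> = (\<Sum>\<pi> | \<pi> permutes {1..M}. \<Sum>\<sigma> | \<sigma> permutes {1..n}. \<phi> (\<sigma> \<circ> \<pi>))"
      by (rule sum.swap)
    also have "\<dots> \<le> (\<Sum>\<pi> | \<pi> permutes {1..M}. fact n * (?SUP * expected_opt I + \<delta> + u \<pi>))"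
      unfolding \<phi>_def \<delta>_def u_def
      by (intro sum_mono expected_reward_zero_append_le[OF D S I opt g]) (simp_all add: M_def n_def)
    also have "\<dots> = fact n * (\<Sum>\<pi> | \<pi> permutes {1..M}. ?SUP * expected_opt I + \<delta> + u \<pi>)"
      by (simp add: sum_distrib_left)
    finally have "(\<Sum>\<pi> | \<pi> permutes {1..M}. \<phi> \<pi>) \<le>
        (\<Sum>\<pi> | \<pi> permutes {1..M}. ?SUP * expected_opt I + \<delta> + u \<pi>)"
      by (rule mult_left_le_imp_le) simp
    also have "\<dots> = fact M * (?SUP * expected_opt I + \<delta>) +
        (\<Sum>\<pi> | \<pi> permutes {1..M}. of_bool (\<not> gapped g M {s\<in>{1..M}. \<pi> s \<in> {1..n}})) * expected_opt I"
      by (simp add: sum.distrib card_permutations u_def sum_distrib_right)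
    also have "\<dots> \<le> fact M * (?SUP * expected_opt I + \<delta>) + fact M * (c / real N) * expected_opt I"
    proof -
      have "real N * (\<Sum>\<pi> | \<pi> permutes {1..M}. of_bool (\<not> gapped g M {s\<in>{1..M}. \<pi> s \<in> {1..n}})) \<le> fact M * c"
        unfolding c_def by (rule sum_not_gapped_le[OF _ n M_def]) (simp add: N_def)
      then have "(\<Sum>\<pi> | \<pi> permutes {1..M}. of_bool (\<not> gapped g M {s\<in>{1..M}. \<pi> s \<in> {1..n}})) \<le> fact M * (c / real N)"
        by (simp add: N_def field_simps)
      then show ?thesis
        using opt by (intro add_left_mono mult_right_mono) auto
    qed
    finally have "(\<Sum>\<pi> | \<pi> permutes {1..M}. \<phi> \<pi>) / fact M \<le>
        ?SUP * expected_opt I + \<delta> + c / real N * expected_opt I"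
      by (simp add: divide_le_eq algebra_simps)
    moreover have "expected_reward Random_Order D A I' = (\<Sum>\<pi> | \<pi> permutes {1..M}. \<phi> \<pi>) / fact M"
      unfolding expected_reward_random_order len S_def[symmetric] by (simp add: \<phi>)
    ultimately have *: "expected_reward Random_Order D A I' \<le>
        ?SUP * expected_opt I + \<delta> + c / real N * expected_opt I"
      by simp
    have "competitive_ratio Random_Order D A \<le> expected_reward Random_Order D A I' / expected_opt I'"
      by (rule competitive_ratio_le[OF D A I']) (simp add: opt' opt)
    also have "\<dots> \<le> (?SUP * expected_opt I + \<delta> + c / real N * expected_opt I) / expected_opt I"
      unfolding opt' by (intro divide_right_mono *) (use opt in simp)
    also have "\<dots> = ?SUP + \<delta> / expected_opt I + c / real N"
      using opt by (simp add: add_divide_distrib)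
    finally show ?thesis
      by (simp add: N_def)
  qed
  have "(\<lambda>N'. ?SUP + \<delta> / expected_opt I + c / real (Suc N')) \<longlonglongrightarrow> ?SUP + \<delta> / expected_opt I + 0"
    by (intro tendsto_add tendsto_const LIMSEQ_Suc lim_const_over_n)
  then show "competitive_ratio Random_Order D A \<le>
      ?SUP + (\<integral>X. decay_gap D g (length I) X \<partial>values_dist I) / expected_opt I"
    using bound by (intro LIMSEQ_le_const[where X = "\<lambda>N'. ?SUP + \<delta> / expected_opt I + c / real (Suc N')"])
      (auto simp: \<delta>_def n_def)
qed

subsection \<open>Thinning\<close>

definition thinned :: "real \<Rightarrow> real measure \<Rightarrow> real measure" where
  "thinned p F = distr (measure_pmf (bernoulli_pmf p) \<Otimes>\<^sub>M F) nonneg_borel (\<lambda>(b, x). if b then x else 0)"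

lemma measurable_thinning:
  assumes "nonneg_distribution F"
  shows "(\<lambda>(b, x). if b then x else 0) \<in>
    measurable (measure_pmf (bernoulli_pmf p) \<Otimes>\<^sub>M F) nonneg_borel"
proof -
  have "(\<lambda>z. snd z) \<in> measurable (measure_pmf (bernoulli_pmf p) \<Otimes>\<^sub>M F) F"
    by simp
  then have [measurable]: "(\<lambda>z. snd z) \<in> measurable (measure_pmf (bernoulli_pmf p) \<Otimes>\<^sub>M F) nonneg_borel"
    using measurable_cong_sets[OF refl nonneg_distributionD(2)[OF assms]] by blast
  have [measurable]: "Measurable.pred (measure_pmf (bernoulli_pmf p) \<Otimes>\<^sub>M F) fst"
    by (rule measurable_compose[OF measurable_fst]) simp
  show ?thesis
    unfolding case_prod_beta by (rule measurable_If) (auto simp: pred_def)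
qed

lemma nn_integral_thinned:
  assumes F: "nonneg_distribution F" and p: "0 \<le> p" "p \<le> 1"
    and f: "f \<in> borel_measurable nonneg_borel"
  shows "(\<integral>\<^sup>+x. f x \<partial>thinned p F) = ennreal p * (\<integral>\<^sup>+x. f x \<partial>F) + ennreal (1 - p) * f 0"
proof -
  interpret F: prob_space F
    by (rule nonneg_distributionD(1)[OF F])
  have "(\<integral>\<^sup>+x. f x \<partial>thinned p F) =
      (\<integral>\<^sup>+z. f (case z of (b, x) \<Rightarrow> if b then x else 0) \<partial>(measure_pmf (bernoulli_pmf p) \<Otimes>\<^sub>M F))"
    unfolding thinned_def by (rule nn_integral_distr[OF measurable_thinning[OF F]]) (simp add: f)
  also have "\<dots> = (\<integral>\<^sup>+b. \<integral>\<^sup>+x. f (if b then x else 0) \<partial>F \<partial>measure_pmf (bernoulli_pmf p))"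
    using F.nn_integral_fst[OF measurable_compose[OF measurable_thinning[OF F, of p] f]] by simp
  also have "\<dots> = (\<integral>\<^sup>+x. f x \<partial>F) * ennreal p + f 0 * ennreal (1 - p)"
    using p by (simp add: F.emeasure_space_1)
  finally show ?thesis
    by (simp add: mult.commute)
qed

lemma nonneg_distribution_thinned:
  assumes F: "nonneg_distribution F" and p: "0 \<le> p" "p \<le> 1"
  shows "nonneg_distribution (thinned p F)"
proof -
  interpret F: prob_space F
    by (rule nonneg_distributionD(1)[OF F])
  interpret pair_prob_space "measure_pmf (bernoulli_pmf p)" F ..
  have sets: "sets (thinned p F) = sets nonneg_borel"
    by (simp add: thinned_def)
  have "prob_space (thinned p F)"
    unfolding thinned_def by (rule prob_space_distr) (rule measurable_thinning[OF F])
  moreover have "integrable (thinned p F) (\<lambda>x. x)"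
  proof (rule integrableI_bounded)
    show "(\<lambda>x. x) \<in> borel_measurable (thinned p F)"
      using measurable_cong_sets[OF sets refl] borel_measurable_nonneg_borel by blast
    have "(\<integral>\<^sup>+x. ennreal (norm x) \<partial>F) < \<infinity>"
      using nonneg_distributionD(4)[OF F] by (simp add: integrable_iff_bounded)
    then show "(\<integral>\<^sup>+x. ennreal (norm x) \<partial>thinned p F) < \<infinity>"
      by (subst nn_integral_thinned[OF F p]) (auto simp: ennreal_mult_less_top)
  qed
  ultimately show ?thesis
    using sets by (simp add: nonneg_distribution_def)
qed

text \<open>\<open>T\<close> is the set of retained indices. Masking leaves values in place, while
  \<open>pad\<close> moves values numbered from 1 to their positions.\<close>

definition masked :: "nat set \<Rightarrow> nat set \<Rightarrow> (nat \<Rightarrow> real) \<Rightarrow> nat \<Rightarrow> real" where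
  "masked J T X = (\<lambda>i\<in>J. if i \<in> T then X i else 0)"

lemma measurable_masked:
  "masked J T \<in> measurable (PiM J (\<lambda>_. nonneg_borel)) (PiM J (\<lambda>_. nonneg_borel))"
  unfolding masked_def by (rule measurable_restrict) auto

text \<open>The probability that independent coins of bias \<open>p\<close>, one for each element of
  \<open>J\<close>, retain exactly \<open>T\<close>.\<close>

definition bernoulli_weight :: "real \<Rightarrow> nat set \<Rightarrow> nat set \<Rightarrow> real" where
  "bernoulli_weight p J T = p ^ card T * (1 - p) ^ card (J - T)"

lemma bernoulli_weight_nonneg: "0 \<le> p \<Longrightarrow> p \<le> 1 \<Longrightarrow> 0 \<le> bernoulli_weight p J T"
  by (simp add: bernoulli_weight_def)

text \<open>A product of mixtures is a mixture over retained sets, by induction on the coordinates.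
  Nonnegative integrals spare the induction all questions of integrability.\<close>

lemma nn_integral_PiM_thinned:
  assumes F: "nonneg_distribution F" and p: "0 \<le> p" "p \<le> 1" and J: "finite J"
    and f: "f \<in> borel_measurable (PiM J (\<lambda>_. nonneg_borel))"
  shows "(\<integral>\<^sup>+X. f X \<partial>PiM J (\<lambda>_. thinned p F)) =
    (\<Sum>T\<in>Pow J. ennreal (bernoulli_weight p J T) * (\<integral>\<^sup>+X. f (masked J T X) \<partial>PiM J (\<lambda>_. F)))"
  using J f
proof (induction J arbitrary: f rule: finite_induct)
  case empty
  have "masked {} {} X = X" if "X \<in> space (PiM {} (\<lambda>_. F))" for X
    using that by (auto simp: masked_def space_PiM)
  then have "(\<integral>\<^sup>+X. f X \<partial>PiM {} (\<lambda>_. F)) = (\<integral>\<^sup>+X. f (masked {} {} X) \<partial>PiM {} (\<lambda>_. F))"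
    by (intro nn_integral_cong) simp
  moreover have "PiM {} (\<lambda>_ :: nat. thinned p F) = PiM {} (\<lambda>_. F)"
    by (simp add: PiM_empty)
  ultimately show ?case
    by (simp add: bernoulli_weight_def)
next
  case (insert i J)
  note f = insert.prems
  have thin: "nonneg_distribution (thinned p F)"
    by (rule nonneg_distribution_thinned[OF F p])
  interpret F: prob_space F
    by (rule nonneg_distributionD(1)[OF F])
  interpret G: prob_space "thinned p F"
    by (rule nonneg_distributionD(1)[OF thin])
  interpret PF: product_sigma_finite "\<lambda>_. F" ..
  interpret PG: product_sigma_finite "\<lambda>_. thinned p F" ..
  \<comment> \<open>\<open>A\<close> is the case in which coordinate \<open>i\<close> is retained
    and averaged over \<open>F\<close>, \<open>B\<close> the case in which it is replaced by 0. They
    become the sets with and without \<open>i\<close>.\<close>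
  define A where "A x = (\<integral>\<^sup>+y. f (x(i := y)) \<partial>F)" for x
  define B where "B x = f (x(i := 0))" for x
  have upd: "(\<lambda>(x, y). x(i := y)) \<in>
      measurable (PiM J (\<lambda>_. nonneg_borel) \<Otimes>\<^sub>M nonneg_borel) (PiM (insert i J) (\<lambda>_. nonneg_borel))"
    by (rule measurable_add_dim)
  have "(\<lambda>(x, y). f (x(i := y))) \<in> borel_measurable (PiM J (\<lambda>_. nonneg_borel) \<Otimes>\<^sub>M nonneg_borel)"
    using measurable_compose[OF upd f] by (simp only: case_prod_unfold)
  moreover have "sets (PiM J (\<lambda>_. nonneg_borel) \<Otimes>\<^sub>M F) = sets (PiM J (\<lambda>_. nonneg_borel) \<Otimes>\<^sub>M nonneg_borel)"
    by (rule sets_pair_measure_cong) (simp_all add: nonneg_distributionD(2)[OF F])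
  ultimately have fF: "(\<lambda>(x, y). f (x(i := y))) \<in> borel_measurable (PiM J (\<lambda>_. nonneg_borel) \<Otimes>\<^sub>M F)"
    using measurable_cong_sets by blast
  have A: "A \<in> borel_measurable (PiM J (\<lambda>_. nonneg_borel))"
    unfolding A_def using F.borel_measurable_nn_integral[OF fF] .
  have pair0: "(\<lambda>x. (x, 0)) \<in>
      measurable (PiM J (\<lambda>_. nonneg_borel)) (PiM J (\<lambda>_. nonneg_borel) \<Otimes>\<^sub>M nonneg_borel)"
    by (intro measurable_Pair measurable_ident measurable_const) auto
  have B: "B \<in> borel_measurable (PiM J (\<lambda>_. nonneg_borel))"
    unfolding B_def using measurable_compose[OF pair0 measurable_compose[OF upd f]] by (simp only: prod.case)
  have fi: "(\<lambda>y. f (x(i := y))) \<in> borel_measurable nonneg_borel"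
    if "x \<in> space (PiM J (\<lambda>_. nonneg_borel))" for x
    by (rule measurable_compose[OF measurable_component_update f]) (use that insert.hyps in auto)
  have space_thin: "space (PiM J (\<lambda>_. thinned p F)) = space (PiM J (\<lambda>_. nonneg_borel))"
    by (rule sets_eq_imp_space_eq) (rule sets_PiM_nonneg[OF thin])
  have mF: "measurable (PiM K (\<lambda>_. F)) N = measurable (PiM K (\<lambda>_. nonneg_borel)) N" for K and N :: "ennreal measure"
    by (rule measurable_PiM_nonneg[OF F])
  have mT: "measurable (PiM K (\<lambda>_. thinned p F)) N = measurable (PiM K (\<lambda>_. nonneg_borel)) N"
    for K and N :: "ennreal measure"
    by (rule measurable_PiM_nonneg[OF thin])
  have AM: "(\<lambda>X. A (masked J T X)) \<in> borel_measurable (PiM J (\<lambda>_. F))"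
    and BM: "(\<lambda>X. B (masked J T X)) \<in> borel_measurable (PiM J (\<lambda>_. F))" for T
    unfolding mF by (rule measurable_compose[OF measurable_masked A] measurable_compose[OF measurable_masked B])+
  have "(\<integral>\<^sup>+X. f X \<partial>PiM (insert i J) (\<lambda>_. thinned p F)) =
      (\<integral>\<^sup>+x. \<integral>\<^sup>+y. f (x(i := y)) \<partial>thinned p F \<partial>PiM J (\<lambda>_. thinned p F))"
    by (rule PG.product_nn_integral_insert[OF insert.hyps]) (simp only: mT f)
  also have "\<dots> = (\<integral>\<^sup>+x. ennreal p * A x + ennreal (1 - p) * B x \<partial>PiM J (\<lambda>_. thinned p F))"
    unfolding A_def B_def
    by (intro nn_integral_cong nn_integral_thinned[OF F p] fi) (simp add: space_thin)
  also have "\<dots> = (\<Sum>T\<in>Pow J. ennreal (bernoulli_weight p J T) *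
      (\<integral>\<^sup>+X. ennreal p * A (masked J T X) + ennreal (1 - p) * B (masked J T X) \<partial>PiM J (\<lambda>_. F)))"
    by (rule insert.IH) (use A B in measurable)
  also have "\<dots> = (\<Sum>T\<in>Pow J. ennreal (bernoulli_weight p J T) *
      (ennreal p * (\<integral>\<^sup>+X. A (masked J T X) \<partial>PiM J (\<lambda>_. F)) +
       ennreal (1 - p) * (\<integral>\<^sup>+X. B (masked J T X) \<partial>PiM J (\<lambda>_. F))))"
    using AM BM by (simp add: nn_integral_add nn_integral_cmult)
  also have "\<dots> = (\<Sum>T\<in>Pow J. ennreal (bernoulli_weight p (insert i J) T) *
        (\<integral>\<^sup>+X. f (masked (insert i J) T X) \<partial>PiM (insert i J) (\<lambda>_. F))) +
      (\<Sum>T\<in>Pow J. ennreal (bernoulli_weight p (insert i J) (insert i T)) *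
        (\<integral>\<^sup>+X. f (masked (insert i J) (insert i T) X) \<partial>PiM (insert i J) (\<lambda>_. F)))"
    unfolding sum.distrib[symmetric]
  proof (rule sum.cong[OF refl])
    fix T assume "T \<in> Pow J"
    then have T: "T \<subseteq> J" by simp
    have fin: "finite T" "i \<notin> T"
      using T insert.hyps finite_subset by auto
    have w1: "bernoulli_weight p (insert i J) T = bernoulli_weight p J T * (1 - p)"
    proof -
      have "insert i J - T = insert i (J - T)" using fin by auto
      then show ?thesis
        using insert.hyps by (simp add: bernoulli_weight_def)
    qed
    have w2: "bernoulli_weight p (insert i J) (insert i T) = bernoulli_weight p J T * p"
    proof -
      have "insert i J - insert i T = J - T" using insert.hyps by auto
      then show ?thesis
        using fin by (simp add: bernoulli_weight_def)
    qed
    have fm: "(\<lambda>X. f (masked (insert i J) U X)) \<in> borel_measurable (PiM (insert i J) (\<lambda>_. F))" for U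
      unfolding mF by (rule measurable_compose[OF measurable_masked f])
    have "(\<integral>\<^sup>+X. f (masked (insert i J) T X) \<partial>PiM (insert i J) (\<lambda>_. F)) =
        (\<integral>\<^sup>+x. \<integral>\<^sup>+y. f (masked (insert i J) T (x(i := y))) \<partial>F \<partial>PiM J (\<lambda>_. F))"
      by (rule PF.product_nn_integral_insert[OF insert.hyps fm])
    also have "\<dots> = (\<integral>\<^sup>+x. B (masked J T x) \<partial>PiM J (\<lambda>_. F))"
    proof -
      have "masked (insert i J) T (x(i := y)) = (masked J T x)(i := 0)" for x y
        using fin insert.hyps by (auto simp: masked_def restrict_def fun_eq_iff)
      then show ?thesis
        by (simp add: B_def F.emeasure_space_1)
    qed
    finally have 1: "(\<integral>\<^sup>+X. f (masked (insert i J) T X) \<partial>PiM (insert i J) (\<lambda>_. F)) =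
      (\<integral>\<^sup>+x. B (masked J T x) \<partial>PiM J (\<lambda>_. F))" .
    have "(\<integral>\<^sup>+X. f (masked (insert i J) (insert i T) X) \<partial>PiM (insert i J) (\<lambda>_. F)) =
        (\<integral>\<^sup>+x. \<integral>\<^sup>+y. f (masked (insert i J) (insert i T) (x(i := y))) \<partial>F \<partial>PiM J (\<lambda>_. F))"
      by (rule PF.product_nn_integral_insert[OF insert.hyps fm])
    also have "\<dots> = (\<integral>\<^sup>+x. A (masked J T x) \<partial>PiM J (\<lambda>_. F))"
    proof -
      have "masked (insert i J) (insert i T) (x(i := y)) = (masked J T x)(i := y)" for x y
        using fin insert.hyps by (auto simp: masked_def restrict_def fun_eq_iff)
      then show ?thesis
        by (simp add: A_def)
    qed
    finally have 2: "(\<integral>\<^sup>+X. f (masked (insert i J) (insert i T) X) \<partial>PiM (insert i J) (\<lambda>_. F)) =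
      (\<integral>\<^sup>+x. A (masked J T x) \<partial>PiM J (\<lambda>_. F))" .
    show "ennreal (bernoulli_weight p J T) *
      (ennreal p * (\<integral>\<^sup>+X. A (masked J T X) \<partial>PiM J (\<lambda>_. F)) +
       ennreal (1 - p) * (\<integral>\<^sup>+X. B (masked J T X) \<partial>PiM J (\<lambda>_. F))) =
      ennreal (bernoulli_weight p (insert i J) T) *
        (\<integral>\<^sup>+X. f (masked (insert i J) T X) \<partial>PiM (insert i J) (\<lambda>_. F)) +
      ennreal (bernoulli_weight p (insert i J) (insert i T)) *
        (\<integral>\<^sup>+X. f (masked (insert i J) (insert i T) X) \<partial>PiM (insert i J) (\<lambda>_. F))"
      unfolding 1 2 w1 w2
      using p by (simp add: ennreal_mult bernoulli_weight_nonneg distrib_left mult.assoc add.commute)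
  qed
  also have "\<dots> = (\<Sum>T\<in>Pow (insert i J). ennreal (bernoulli_weight p (insert i J) T) *
      (\<integral>\<^sup>+X. f (masked (insert i J) T X) \<partial>PiM (insert i J) (\<lambda>_. F)))"
  proof -
    have inj: "inj_on (insert i) (Pow J)"
      using insert.hyps by (auto simp: inj_on_def)
    have "Pow J \<inter> insert i ` Pow J = {}"
      using insert.hyps by auto
    then show ?thesis
      unfolding Pow_insert using insert.hyps
      by (subst sum.union_disjoint) (auto simp: sum.reindex[OF inj])
  qed
  finally show ?case .
qed

text \<open>Nonnegativity lets the Bochner integral be read off from the nonnegative one;
  integrability is asked only of the masked functions under \<open>F\<close>.\<close>

lemma integral_PiM_thinned:
  fixes f :: "(nat \<Rightarrow> real) \<Rightarrow> real"
  assumes F: "nonneg_distribution F" and p: "0 \<le> p" "p \<le> 1" and J: "finite J"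
    and f: "f \<in> borel_measurable (PiM J (\<lambda>_. nonneg_borel))"
    and nonneg: "\<And>X. X \<in> space (PiM J (\<lambda>_. nonneg_borel)) \<Longrightarrow> 0 \<le> f X"
    and int: "\<And>T. T \<subseteq> J \<Longrightarrow> integrable (PiM J (\<lambda>_. F)) (\<lambda>X. f (masked J T X))"
  shows "(\<integral>X. f X \<partial>PiM J (\<lambda>_. thinned p F)) =
    (\<Sum>T\<in>Pow J. bernoulli_weight p J T * (\<integral>X. f (masked J T X) \<partial>PiM J (\<lambda>_. F)))"
proof -
  have thin: "nonneg_distribution (thinned p F)"
    by (rule nonneg_distribution_thinned[OF F p])
  have space: "space (PiM J (\<lambda>_. G)) = space (PiM J (\<lambda>_. nonneg_borel))" if "nonneg_distribution G" for G
    by (rule sets_eq_imp_space_eq) (rule sets_PiM_nonneg[OF that])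
  have mask_nonneg: "0 \<le> f (masked J T X)" if "X \<in> space (PiM J (\<lambda>_. F))" for T X
    using that measurable_space[OF measurable_masked[of J T]] by (intro nonneg) (simp add: space[OF F])
  have I_nonneg: "0 \<le> (\<integral>X. f (masked J T X) \<partial>PiM J (\<lambda>_. F))" for T
    by (rule Bochner_Integration.integral_nonneg) (rule mask_nonneg)
  have "(\<integral>\<^sup>+X. ennreal (f X) \<partial>PiM J (\<lambda>_. thinned p F)) =
      (\<Sum>T\<in>Pow J. ennreal (bernoulli_weight p J T) * (\<integral>\<^sup>+X. ennreal (f (masked J T X)) \<partial>PiM J (\<lambda>_. F)))"
    by (rule nn_integral_PiM_thinned[OF F p J]) (use f in measurable)
  also have "\<dots> = (\<Sum>T\<in>Pow J. ennreal (bernoulli_weight p J T * (\<integral>X. f (masked J T X) \<partial>PiM J (\<lambda>_. F))))"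
  proof (rule sum.cong[OF refl])
    fix T assume "T \<in> Pow J"
    then have "(\<integral>\<^sup>+X. ennreal (f (masked J T X)) \<partial>PiM J (\<lambda>_. F)) = ennreal (\<integral>X. f (masked J T X) \<partial>PiM J (\<lambda>_. F))"
      by (intro nn_integral_eq_integral int AE_I2 mask_nonneg) auto
    then show "ennreal (bernoulli_weight p J T) * (\<integral>\<^sup>+X. ennreal (f (masked J T X)) \<partial>PiM J (\<lambda>_. F)) =
        ennreal (bernoulli_weight p J T * (\<integral>X. f (masked J T X) \<partial>PiM J (\<lambda>_. F)))"
      by (simp add: ennreal_mult bernoulli_weight_nonneg[OF p] I_nonneg)
  qed
  also have "\<dots> = ennreal (\<Sum>T\<in>Pow J. bernoulli_weight p J T * (\<integral>X. f (masked J T X) \<partial>PiM J (\<lambda>_. F)))"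
    by (rule sum_ennreal) (intro mult_nonneg_nonneg bernoulli_weight_nonneg[OF p] I_nonneg)
  finally have "(\<integral>\<^sup>+X. ennreal (f X) \<partial>PiM J (\<lambda>_. thinned p F)) =
      ennreal (\<Sum>T\<in>Pow J. bernoulli_weight p J T * (\<integral>X. f (masked J T X) \<partial>PiM J (\<lambda>_. F)))" .
  moreover have "0 \<le> (\<Sum>T\<in>Pow J. bernoulli_weight p J T * (\<integral>X. f (masked J T X) \<partial>PiM J (\<lambda>_. F)))"
    by (intro sum_nonneg mult_nonneg_nonneg bernoulli_weight_nonneg[OF p] I_nonneg)
  moreover have "(\<integral>X. f X \<partial>PiM J (\<lambda>_. thinned p F)) = enn2real (\<integral>\<^sup>+X. ennreal (f X) \<partial>PiM J (\<lambda>_. thinned p F))"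
    by (rule integral_eq_nn_integral)
       (use f nonneg in \<open>auto simp: measurable_PiM_nonneg[OF thin] space[OF thin]\<close>)
  ultimately show ?thesis by simp
qed

subsection \<open>Binomial estimates and expected maxima\<close>

text \<open>The source of all moment and union bounds on the retained set. In the expansion of a
  product of sums, setting the second summand to 0 on \<open>Q\<close> removes exactly the sets that
  do not contain \<open>Q\<close>.\<close>

lemma sum_bernoulli_weight_superset:
  assumes J: "finite J" and Q: "Q \<subseteq> J"
  shows "(\<Sum>T\<in>Pow J. bernoulli_weight p J T * of_bool (Q \<subseteq> T)) = p ^ card Q"
proof -
  have "(\<Sum>T\<in>Pow J. bernoulli_weight p J T * of_bool (Q \<subseteq> T)) =
      (\<Sum>T\<in>Pow J. (\<Prod>i\<in>T. p) * (\<Prod>i\<in>J - T. if i \<in> Q then 0 else 1 - p))"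
  proof (rule sum.cong[OF refl])
    fix T assume "T \<in> Pow J"
    show "bernoulli_weight p J T * of_bool (Q \<subseteq> T) =
        (\<Prod>i\<in>T. p) * (\<Prod>i\<in>J - T. if i \<in> Q then 0 else 1 - p)"
    proof (cases "Q \<subseteq> T")
      case True
      then have "(\<Prod>i\<in>J - T. if i \<in> Q then 0 else 1 - p) = (\<Prod>i\<in>J - T. 1 - p)"
        by (intro prod.cong) auto
      with True show ?thesis
        by (simp add: bernoulli_weight_def)
    next
      case False
      then obtain i where "i \<in> Q" "i \<notin> T" by blast
      then have "(\<Prod>i\<in>J - T. if i \<in> Q then 0 else 1 - p) = 0"
        using J Q by (intro prod_zero) auto
      with False show ?thesis by simp
    qed
  qed
  also have "\<dots> = (\<Prod>i\<in>J. p + (if i \<in> Q then 0 else 1 - p))"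
    by (rule prod_add[OF J, symmetric])
  also have "\<dots> = (\<Prod>i\<in>J. if i \<in> Q then p else 1)"
    by (intro prod.cong) auto
  also have "\<dots> = p ^ card Q"
    using J Q by (simp add: prod.If_cases Int_absorb1)
  finally show ?thesis .
qed

lemma sum_bernoulli_weight: "finite J \<Longrightarrow> (\<Sum>T\<in>Pow J. bernoulli_weight p J T) = 1"
  using sum_bernoulli_weight_superset[of J "{}" p] by simp

lemma card_eq_sum_of_bool:
  assumes "finite J" "T \<subseteq> J"
  shows "real (card T) = (\<Sum>i\<in>J. of_bool ({i} \<subseteq> T))"
  using assms by (simp add: of_bool_def sum.If_cases Int_absorb1)

lemma bernoulli_weight_mean:
  assumes "finite J"
  shows "(\<Sum>T\<in>Pow J. bernoulli_weight p J T * real (card T)) = real (card J) * p"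
proof -
  have "(\<Sum>T\<in>Pow J. bernoulli_weight p J T * real (card T)) =
      (\<Sum>T\<in>Pow J. \<Sum>i\<in>J. bernoulli_weight p J T * of_bool ({i} \<subseteq> T))"
    by (intro sum.cong refl) (simp only: card_eq_sum_of_bool[OF assms] Pow_iff sum_distrib_left)
  also have "\<dots> = (\<Sum>i\<in>J. \<Sum>T\<in>Pow J. bernoulli_weight p J T * of_bool ({i} \<subseteq> T))"
    by (rule sum.swap)
  also have "\<dots> = (\<Sum>i\<in>J. p)"
  proof (rule sum.cong[OF refl])
    fix i assume "i \<in> J"
    then show "(\<Sum>T\<in>Pow J. bernoulli_weight p J T * of_bool ({i} \<subseteq> T)) = p"
      using sum_bernoulli_weight_superset[OF assms, of "{i}" p] by simp
  qed
  finally show ?thesis by simp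
qed

text \<open>The square of the cardinality counts ordered pairs in \<open>T\<close>. Off the diagonal
  a pair has weight \<open>p\<^sup>2\<close>; the diagonal weight \<open>p\<close> is enlarged to
  \<open>p + p\<^sup>2\<close>, and the variance bound \<open>\<mu>\<close> survives this.\<close>

lemma bernoulli_weight_second_moment:
  assumes J: "finite J" and p: "0 \<le> p"
  shows "(\<Sum>T\<in>Pow J. bernoulli_weight p J T * (real (card T))\<^sup>2) \<le>
    real (card J) * p + (real (card J) * p)\<^sup>2"
proof -
  have "(\<Sum>T\<in>Pow J. bernoulli_weight p J T * (real (card T))\<^sup>2) =
      (\<Sum>T\<in>Pow J. \<Sum>i\<in>J. \<Sum>j\<in>J. bernoulli_weight p J T * of_bool ({i, j} \<subseteq> T))"
  proof (rule sum.cong[OF refl])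
    fix T assume "T \<in> Pow J"
    then have T: "real (card T) = (\<Sum>i\<in>J. of_bool ({i} \<subseteq> T))"
      by (intro card_eq_sum_of_bool[OF J]) simp
    have "(real (card T))\<^sup>2 = (\<Sum>i\<in>J. \<Sum>j\<in>J. of_bool ({i} \<subseteq> T) * of_bool ({j} \<subseteq> T))"
      unfolding T power2_eq_square by (rule sum_product)
    also have "\<dots> = (\<Sum>i\<in>J. \<Sum>j\<in>J. of_bool ({i, j} \<subseteq> T))"
      by (intro sum.cong refl) auto
    finally show "bernoulli_weight p J T * (real (card T))\<^sup>2 =
        (\<Sum>i\<in>J. \<Sum>j\<in>J. bernoulli_weight p J T * of_bool ({i, j} \<subseteq> T))"
      by (simp only: sum_distrib_left)
  qed
  also have "\<dots> = (\<Sum>i\<in>J. \<Sum>T\<in>Pow J. \<Sum>j\<in>J. bernoulli_weight p J T * of_bool ({i, j} \<subseteq> T))"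
    by (rule sum.swap)
  also have "\<dots> = (\<Sum>i\<in>J. \<Sum>j\<in>J. \<Sum>T\<in>Pow J. bernoulli_weight p J T * of_bool ({i, j} \<subseteq> T))"
    by (intro sum.cong refl sum.swap)
  also have "\<dots> = (\<Sum>i\<in>J. \<Sum>j\<in>J. p ^ card {i, j})"
    by (intro sum.cong refl sum_bernoulli_weight_superset[OF J]) auto
  also have "\<dots> \<le> (\<Sum>i\<in>J. \<Sum>j\<in>J. (if j = i then p else 0) + p\<^sup>2)"
    by (intro sum_mono) (use p in \<open>auto simp: card_insert_if power2_eq_square\<close>)
  also have "\<dots> = real (card J) * p + (real (card J) * p)\<^sup>2"
    using J by (simp add: sum.distrib power2_eq_square algebra_simps)
  finally show ?thesis .
qed

text \<open>Chebyshev's inequality for a tail weighted by \<open>k\<close>. With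
  \<open>x = (k - \<mu>) / (n - \<mu>)\<close>, each \<open>k > n\<close> satisfies
  \<open>x \<ge> 1\<close> and \<open>k \<le> n * x\<close>, hence
  \<open>k \<le> n * x\<^sup>2\<close>, whose mean is controlled by the variance.\<close>

lemma bernoulli_weight_tail:
  assumes J: "finite J" and p: "0 \<le> p" "p \<le> 1" and \<mu>: "\<mu> = real (card J) * p" "\<mu> < real n"
  shows "(\<Sum>T\<in>Pow J. bernoulli_weight p J T * (real (card T) * of_bool (n < card T))) \<le>
    real n * (\<mu> / (real n - \<mu>)\<^sup>2)"
proof -
  have "0 \<le> \<mu>" using p \<mu> by simp
  have pointwise: "real k * of_bool (n < k) \<le> real n / (real n - \<mu>)\<^sup>2 * (real k - \<mu>)\<^sup>2" for k
  proof (cases "n < k")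
    case True
    define x where "x = (real k - \<mu>) / (real n - \<mu>)"
    have x1: "1 \<le> x"
      using True \<mu>(2) by (simp add: x_def)
    have "real k * (real n - \<mu>) \<le> real n * (real k - \<mu>)"
      using True mult_right_mono[of "real n" "real k" \<mu>] \<open>0 \<le> \<mu>\<close> by (simp add: algebra_simps)
    then have "real k \<le> real n * x"
      using \<mu>(2) by (simp add: x_def pos_le_divide_eq)
    also have "\<dots> \<le> real n * x\<^sup>2"
      using x1 by (intro mult_left_mono) (simp_all add: power2_eq_square)
    finally show ?thesis
      using True by (simp add: x_def power_divide)
  qed simp
  have variance: "(\<Sum>T\<in>Pow J. bernoulli_weight p J T * (real (card T) - \<mu>)\<^sup>2) \<le> \<mu>"
  proof -
    have "(\<Sum>T\<in>Pow J. bernoulli_weight p J T * (real (card T) - \<mu>)\<^sup>2) =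
        (\<Sum>T\<in>Pow J. bernoulli_weight p J T * (real (card T))\<^sup>2) -
        2 * \<mu> * (\<Sum>T\<in>Pow J. bernoulli_weight p J T * real (card T)) +
        \<mu>\<^sup>2 * (\<Sum>T\<in>Pow J. bernoulli_weight p J T)"
      by (simp add: sum_distrib_left sum_subtractf[symmetric] sum.distrib[symmetric]
          power2_eq_square algebra_simps)
    also have "\<dots> \<le> \<mu> + \<mu>\<^sup>2 - 2 * \<mu> * \<mu> + \<mu>\<^sup>2 * 1"
      using bernoulli_weight_second_moment[OF J p(1)] bernoulli_weight_mean[OF J, of p]
        sum_bernoulli_weight[OF J, of p] by (simp add: \<mu>(1))
    finally show ?thesis
      by (simp add: power2_eq_square)
  qed
  have "(\<Sum>T\<in>Pow J. bernoulli_weight p J T * (real (card T) * of_bool (n < card T))) \<le>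
      (\<Sum>T\<in>Pow J. bernoulli_weight p J T * (real n / (real n - \<mu>)\<^sup>2 * (real (card T) - \<mu>)\<^sup>2))"
    by (intro sum_mono mult_left_mono pointwise bernoulli_weight_nonneg[OF p])
  also have "\<dots> = real n / (real n - \<mu>)\<^sup>2 * (\<Sum>T\<in>Pow J. bernoulli_weight p J T * (real (card T) - \<mu>)\<^sup>2)"
    by (simp add: sum_distrib_left mult_ac)
  also have "\<dots> \<le> real n / (real n - \<mu>)\<^sup>2 * \<mu>"
    by (intro mult_left_mono variance) simp
  finally show ?thesis by simp
qed

text \<open>A union bound: at most \<open>g\<close> positions near the deadline, each with weight
  \<open>p\<close>, and for each position at most \<open>g\<close> close successors, each pair with
  weight \<open>p\<^sup>2\<close>. If \<open>N * p\<close> is kept fixed, this is of order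
  \<open>1 / N\<close>.\<close>

lemma bernoulli_weight_not_gapped:
  assumes p: "0 \<le> p" "p \<le> 1"
  shows "(\<Sum>T\<in>Pow {1..N}. bernoulli_weight p {1..N} T * of_bool (\<not> gapped g N T)) \<le>
    real g * p + real N * (real g * p\<^sup>2)"
proof -
  let ?w = "bernoulli_weight p {1..N}"
  have "of_bool (\<not> gapped g N T) \<le>
      (\<Sum>i\<in>{i\<in>{1..N}. N + 1 < i + g}. of_bool ({i} \<subseteq> T) :: real) +
      (\<Sum>i=1..N. \<Sum>j\<in>{j\<in>{1..N}. i < j \<and> j < i + g}. of_bool ({i, j} \<subseteq> T))" (is "_ \<le> ?A + ?B")
    if T: "T \<subseteq> {1..N}" for T
  proof (cases "gapped g N T")
    case True
    then show ?thesis by (auto intro!: add_nonneg_nonneg sum_nonneg)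
  next
    case False
    have A: "0 \<le> ?A" and B: "0 \<le> ?B"
      by (auto intro!: sum_nonneg)
    from False obtain i where i: "i \<in> T" "N + 1 < i + g \<or> (\<exists>j\<in>T. i < j \<and> j < i + g)"
      unfolding gapped_def by (auto simp: not_le)
    then consider "N + 1 < i + g" | j where "j \<in> T" "i < j" "j < i + g" by blast
    then have "1 \<le> ?A \<or> 1 \<le> ?B"
    proof cases
      case 1
      then have "i \<in> {i\<in>{1..N}. N + 1 < i + g}"
        using i(1) T by blast
      then have "of_bool ({i} \<subseteq> T) \<le> ?A"
        by (rule member_le_sum) auto
      with i show ?thesis by simp
    next
      case 2
      then have "j \<in> {j\<in>{1..N}. i < j \<and> j < i + g}"
        using T by blast
      then have "of_bool ({i, j} \<subseteq> T) \<le> (\<Sum>j\<in>{j\<in>{1..N}. i < j \<and> j < i + g}. of_bool ({i, j} \<subseteq> T) :: real)"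
        by (rule member_le_sum) auto
      also have "\<dots> \<le> ?B"
        by (rule member_le_sum) (use i T in \<open>auto intro!: sum_nonneg\<close>)
      finally show ?thesis
        using 2 i by simp
    qed
    with A B False show ?thesis by auto
  qed
  then have "(\<Sum>T\<in>Pow {1..N}. ?w T * of_bool (\<not> gapped g N T)) \<le>
      (\<Sum>T\<in>Pow {1..N}. ?w T * ((\<Sum>i\<in>{i\<in>{1..N}. N + 1 < i + g}. of_bool ({i} \<subseteq> T)) +
      (\<Sum>i=1..N. \<Sum>j\<in>{j\<in>{1..N}. i < j \<and> j < i + g}. of_bool ({i, j} \<subseteq> T))))"
    by (intro sum_mono mult_left_mono bernoulli_weight_nonneg[OF p]) blast
  also have "\<dots> = (\<Sum>T\<in>Pow {1..N}. \<Sum>i\<in>{i\<in>{1..N}. N + 1 < i + g}. ?w T * of_bool ({i} \<subseteq> T)) +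
      (\<Sum>T\<in>Pow {1..N}. \<Sum>i=1..N. \<Sum>j\<in>{j\<in>{1..N}. i < j \<and> j < i + g}. ?w T * of_bool ({i, j} \<subseteq> T))"
    by (simp only: distrib_left sum.distrib sum_distrib_left)
  also have "(\<Sum>T\<in>Pow {1..N}. \<Sum>i\<in>{i\<in>{1..N}. N + 1 < i + g}. ?w T * of_bool ({i} \<subseteq> T)) =
      (\<Sum>i\<in>{i\<in>{1..N}. N + 1 < i + g}. \<Sum>T\<in>Pow {1..N}. ?w T * of_bool ({i} \<subseteq> T))"
    by (rule sum.swap)
  also have "\<dots> = (\<Sum>i\<in>{i\<in>{1..N}. N + 1 < i + g}. p ^ card {i})"
    by (intro sum.cong refl sum_bernoulli_weight_superset) auto
  also have "(\<Sum>T\<in>Pow {1..N}. \<Sum>i=1..N. \<Sum>j\<in>{j\<in>{1..N}. i < j \<and> j < i + g}. ?w T * of_bool ({i, j} \<subseteq> T)) =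
      (\<Sum>i=1..N. \<Sum>T\<in>Pow {1..N}. \<Sum>j\<in>{j\<in>{1..N}. i < j \<and> j < i + g}. ?w T * of_bool ({i, j} \<subseteq> T))"
    by (rule sum.swap)
  also have "\<dots> = (\<Sum>i=1..N. \<Sum>j\<in>{j\<in>{1..N}. i < j \<and> j < i + g}. \<Sum>T\<in>Pow {1..N}. ?w T * of_bool ({i, j} \<subseteq> T))"
    by (intro sum.cong refl sum.swap)
  also have "\<dots> = (\<Sum>i=1..N. \<Sum>j\<in>{j\<in>{1..N}. i < j \<and> j < i + g}. p ^ card {i, j})"
    by (intro sum.cong refl sum_bernoulli_weight_superset) auto
  also have "\<dots> = (\<Sum>i=1..N. \<Sum>j\<in>{j\<in>{1..N}. i < j \<and> j < i + g}. p\<^sup>2)"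
    by (intro sum.cong refl) (auto simp: card_insert_if power2_eq_square)
  also have "(\<Sum>i\<in>{i\<in>{1..N}. N + 1 < i + g}. p ^ card {i}) + \<dots> =
      real (card {i\<in>{1..N}. N + 1 < i + g}) * p + (\<Sum>i=1..N. real (card {j\<in>{1..N}. i < j \<and> j < i + g}) * p\<^sup>2)"
    by simp
  also have "\<dots> \<le> real g * p + (\<Sum>i=1..N. real g * p\<^sup>2)"
  proof (intro add_mono sum_mono mult_right_mono of_nat_mono)
    have "card {i\<in>{1..N}. N + 1 < i + g} \<le> card {N + 1 - g<..N}"
      by (intro card_mono) auto
    then show "card {i\<in>{1..N}. N + 1 < i + g} \<le> g" by simp
    have "card {j\<in>{1..N}. i < j \<and> j < i + g} \<le> card {i<..<i + g}" for i
      by (intro card_mono) auto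
    then show "card {j\<in>{1..N}. i < j \<and> j < i + g} \<le> g" for i
      by (rule order_trans) simp
  qed (use p in auto)
  finally show ?thesis by simp
qed

section \<open>Expected maxima of IID samples\<close>

definition mean_max :: "real measure \<Rightarrow> nat \<Rightarrow> real" where
  "mean_max F k = (\<integral>X. largest {1..k} X \<partial>PiM {1..k} (\<lambda>_. F))"

lemma mean_max_nonneg: "0 \<le> mean_max F k"
  unfolding mean_max_def by (intro Bochner_Integration.integral_nonneg largest_nonneg) simp

lemma integral_largest_iid:
  assumes F: "nonneg_distribution F" and J: "finite J" "T \<subseteq> J"
  shows "(\<integral>X. largest T X \<partial>PiM J (\<lambda>_. F)) = mean_max F (card T)"
proof -
  have fin: "finite T" using J finite_subset by blast
  have "card {1..card T} = card T" by simp
  then obtain f where f: "bij_betw f {1..card T} T"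
    using finite_same_card_bij[of "{1..card T}" T] fin by auto
  have "largest T X = largest {1..card T} (\<lambda>j\<in>{1..card T}. X (f j))" for X
  proof -
    have "X ` T = (\<lambda>j. X (f j)) ` {1..card T}"
      using f by (simp only: bij_betw_def image_image[symmetric])
    also have "\<dots> = (\<lambda>j\<in>{1..card T}. X (f j)) ` {1..card T}"
      by (rule image_cong) auto
    finally have "X ` T = (\<lambda>j\<in>{1..card T}. X (f j)) ` {1..card T}" .
    then show ?thesis by (simp only: largest_def)
  qed
  then have "(\<integral>X. largest T X \<partial>PiM J (\<lambda>_. F)) =
      (\<integral>X. largest {1..card T} (\<lambda>j\<in>{1..card T}. X (f j)) \<partial>PiM J (\<lambda>_. F))"
    by simp
  also have "\<dots> = mean_max F (card T)"
    unfolding mean_max_def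
  proof (rule integral_PiM_reindex)
    show "largest {1..card T} \<in> borel_measurable (PiM {1..card T} (\<lambda>_. F))"
      using measurable_PiM_nonneg[OF F] borel_measurable_largest[of "{1..card T}" "{1..card T}"] by auto
  qed (use f F J nonneg_distributionD in \<open>auto simp: bij_betw_def\<close>)
  finally show ?thesis .
qed

text \<open>Leave one out: deleting an index different from that of the maximum keeps the maximum.\<close>

lemma mean_max_Suc:
  assumes F: "nonneg_distribution F"
  shows "real n * mean_max F (Suc n) \<le> real (Suc n) * mean_max F n"
proof -
  let ?J = "{1..Suc n}"
  let ?P = "PiM ?J (\<lambda>_. F)"
  have int: "integrable ?P (largest T)" if "T \<subseteq> ?J" for T
    by (rule integrable_largest) (use F that in auto)
  have "(\<integral>X. real n * largest ?J X \<partial>?P) \<le> (\<integral>X. (\<Sum>j\<in>?J. largest (?J - {j}) X) \<partial>?P)"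
  proof (rule integral_mono)
    show "integrable ?P (\<lambda>X. real n * largest ?J X)"
      by (intro integrable_mult_right int) simp
    show "integrable ?P (\<lambda>X. \<Sum>j\<in>?J. largest (?J - {j}) X)"
      by (intro Bochner_Integration.integrable_sum int) auto
    fix X assume X: "X \<in> space ?P"
    have nn: "0 \<le> X j" if "j \<in> ?J" for j
      by (rule PiM_nonneg[OF F X that])
    have "Max (X ` ?J) = largest ?J X"
      by (rule Max_eq_largest) (use nn in auto)
    moreover have "Max (X ` ?J) \<in> X ` ?J"
      by (rule Max_in) auto
    ultimately obtain i where i: "i \<in> ?J" "largest ?J X = X i" by auto
    have "real n * largest ?J X = (\<Sum>j\<in>?J - {i}. X i)"
      using i by simp
    also have "\<dots> \<le> (\<Sum>j\<in>?J - {i}. largest (?J - {j}) X)"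
      by (intro sum_mono le_largest) (use i in auto)
    also have "\<dots> \<le> (\<Sum>j\<in>?J. largest (?J - {j}) X)"
      by (rule sum_mono2) (auto intro!: largest_nonneg)
    finally show "real n * largest ?J X \<le> (\<Sum>j\<in>?J. largest (?J - {j}) X)" .
  qed
  also have "\<dots> = (\<Sum>j\<in>?J. \<integral>X. largest (?J - {j}) X \<partial>?P)"
    by (intro Bochner_Integration.integral_sum int) auto
  also have "\<dots> = (\<Sum>j\<in>?J. mean_max F n)"
  proof (rule sum.cong[OF refl])
    fix j assume "j \<in> ?J"
    then show "(\<integral>X. largest (?J - {j}) X \<partial>?P) = mean_max F n"
      by (subst integral_largest_iid[OF F]) auto
  qed
  finally show ?thesis
    by (simp add: mean_max_def)
qed

lemma mean_max_ratio:
  assumes F: "nonneg_distribution F" and n: "1 \<le> n" "n \<le> k"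
  shows "real n * mean_max F k \<le> real k * mean_max F n"
  using n(2)
proof (induction k rule: dec_induct)
  case (step k)
  have "real k * (real n * mean_max F (Suc k)) \<le> real n * (real (Suc k) * mean_max F k)"
    using mult_left_mono[OF mean_max_Suc[OF F, of k], of "real n"] by (simp add: mult_ac)
  also have "\<dots> = real (Suc k) * (real n * mean_max F k)"
    by (simp add: mult_ac)
  also have "\<dots> \<le> real (Suc k) * (real k * mean_max F n)"
    by (intro mult_left_mono step.IH) simp
  finally have "real k * (real n * mean_max F (Suc k)) \<le> real k * (real (Suc k) * mean_max F n)"
    by (simp add: mult_ac)
  then show ?case
    using step n by simp
qed simp

subsection \<open>The IID model\<close>

lemma masked_le_sum:
  assumes "finite J" "i \<in> J" "\<And>j. j \<in> J \<Longrightarrow> 0 \<le> X j"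
  shows "masked J T X i \<le> (\<Sum>j\<in>J. X j)"
  using assms member_le_sum[of i J X] sum_nonneg[of J X] by (simp add: masked_def)

lemma masked_nonneg: "i \<in> J \<Longrightarrow> 0 \<le> X i \<Longrightarrow> 0 \<le> masked J T X i"
  by (simp add: masked_def)

lemma integrable_reward_masked:
  assumes D: "decay_sequence D" and S: "measurable_rule S" and N: "1 \<le> N"
    and F: "nonneg_distribution F"
  shows "integrable (PiM {1..N} (\<lambda>_. F)) (\<lambda>X. reward D S N (masked {1..N} T X))"
proof (rule integrable_reward_comp[OF D S N _ F])
  fix s assume s: "s \<in> {1..N}"
  show "(\<lambda>X. masked {1..N} T X s) \<in> measurable (PiM {1..N} (\<lambda>_. nonneg_borel)) nonneg_borel"
    by (rule measurable_compose[OF measurable_masked measurable_component_singleton[OF s]])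
  fix X assume "X \<in> space (PiM {1..N} (\<lambda>_. F))"
  then show "masked {1..N} T X s \<le> sum X {1..N}"
    by (intro masked_le_sum s PiM_nonneg[OF F]) simp
qed simp

lemma largest_masked:
  assumes "T \<subseteq> {1..N}"
  shows "largest {1..N} (masked {1..N} T X) = largest T X"
proof (rule antisym)
  have fin: "finite T" using assms finite_subset by blast
  show "largest {1..N} (masked {1..N} T X) \<le> largest T X"
    by (rule largest_le) (auto simp: masked_def intro!: le_largest largest_nonneg fin)
  show "largest T X \<le> largest {1..N} (masked {1..N} T X)"
  proof (rule largest_le[OF fin])
    fix i assume i: "i \<in> T"
    then have "masked {1..N} T X i \<le> largest {1..N} (masked {1..N} T X)"
      using assms by (intro le_largest) auto
    moreover have "masked {1..N} T X i = X i"
      using i assms by (auto simp: masked_def)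
    ultimately show "X i \<le> largest {1..N} (masked {1..N} T X)" by simp
  qed (simp add: largest_nonneg)
qed

lemma values_dist_replicate: "values_dist (replicate n F) = PiM {1..n} (\<lambda>_. F)"
  unfolding values_dist_def by (rule PiM_cong) auto

lemma admissible_replicate: "nonneg_distribution F \<Longrightarrow> 1 \<le> n \<Longrightarrow> admissible IID (replicate n F)"
  by (auto simp: admissible_def)

lemma expected_opt_replicate:
  "nonneg_distribution F \<Longrightarrow> 1 \<le> n \<Longrightarrow> expected_opt (replicate n F) = mean_max F n"
  by (simp only: expected_opt_eq[OF admissible_replicate] length_replicate values_dist_replicate mean_max_def)

text \<open>The values of a long sample at the positions \<open>T\<close> and the first
  \<open>k\<close> values of a sample of size \<open>n\<close> have the same law. Both integrals
  reduce to a sample of size \<open>k\<close>, which is why \<open>k \<le> n\<close> is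
  required.\<close>

lemma expected_reward_masked_eq:
  assumes D: "decay_sequence D" and S: "measurable_rule S" and F: "nonneg_distribution F"
    and t: "strict_mono_on {1..k} t" "t ` {1..k} = T" and T: "T \<subseteq> {1..N}" and k: "k \<le> n"
  shows "(\<integral>X. reward D S N (masked {1..N} T X) \<partial>PiM {1..N} (\<lambda>_. F)) =
    (\<integral>X. reward D S N (pad t k (X \<circ> id)) \<partial>PiM {1..n} (\<lambda>_. F))"
proof -
  have inj: "inj_on t {1..k}"
    using t(1) by (rule strict_mono_on_imp_inj_on)
  have prob: "prob_space F"
    by (rule nonneg_distributionD(1)[OF F])
  have "(\<lambda>y. reward D S N (restrict (pad t k y) {1..N})) \<in> borel_measurable (PiM {1..k} (\<lambda>_. nonneg_borel))"
    by (rule measurable_compose[OF measurable_restrict_pad borel_measurable_reward[OF D S]]) simp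
  moreover have "reward D S N (restrict (pad t k y) {1..N}) = reward D S N (pad t k y)" for y
    by (rule reward_cong) simp
  ultimately have meas: "(\<lambda>y. reward D S N (pad t k y)) \<in> borel_measurable (PiM {1..k} (\<lambda>_. F))"
    by (simp only: measurable_PiM_nonneg[OF F])
  have "reward D S N (masked {1..N} T X) = reward D S N (pad t k (\<lambda>j\<in>{1..k}. X (t j)))" for X
  proof (rule reward_cong)
    fix s assume s: "s \<in> {1..N}"
    show "masked {1..N} T X s = pad t k (\<lambda>j\<in>{1..k}. X (t j)) s"
    proof (cases "s \<in> T")
      case True
      then obtain j where j: "j \<in> {1..k}" "s = t j"
        using t(2) by blast
      then show ?thesis
        using True s pad_at[OF inj j(1)] by (simp add: masked_def)
    next
      case False
      then show ?thesis
        using s t(2) by (simp add: masked_def pad_off)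
    qed
  qed
  then have "(\<integral>X. reward D S N (masked {1..N} T X) \<partial>PiM {1..N} (\<lambda>_. F)) =
      (\<integral>X. reward D S N (pad t k (\<lambda>j\<in>{1..k}. X (t j))) \<partial>PiM {1..N} (\<lambda>_. F))"
    by simp
  also have "\<dots> = (\<integral>X. reward D S N (pad t k X) \<partial>PiM {1..k} (\<lambda>_. F))"
    by (rule integral_PiM_reindex[OF prob inj _ meas]) (use t T in blast)
  also have "\<dots> = (\<integral>X. reward D S N (pad t k (\<lambda>j\<in>{1..k}. X (id j))) \<partial>PiM {1..n} (\<lambda>_. F))"
    by (rule integral_PiM_reindex[OF prob _ _ meas, symmetric]) (use k in auto)
  also have "\<dots> = (\<integral>X. reward D S N (pad t k (X \<circ> id)) \<partial>PiM {1..n} (\<lambda>_. F))"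
    by (intro Bochner_Integration.integral_cong refl arg_cong[of _ _ "reward D S N"] pad_cong) simp
  finally show ?thesis .
qed

text \<open>Three cases for the retained set. If it has more than \<open>n\<close> elements, the
  instance \<open>I\<close> cannot supply the values; the expected maximum then exceeds that of
  \<open>I\<close> by at most the factor \<open>card T / n\<close>. If it is small but not gapped,
  the reward is bounded by the maximum, and otherwise the imitation applies. Since all summands are
  nonnegative, one bound covers the cases.\<close>

lemma expected_reward_masked_le:
  assumes D: "decay_sequence D" and S: "measurable_rule S" and F: "nonneg_distribution F"
    and n: "1 \<le> n" and N: "1 \<le> N" and g: "1 \<le> g" and T: "T \<subseteq> {1..N}"
    and I: "I = replicate n F" and opt: "0 < expected_opt I"
  defines "s \<equiv> (SUP A\<in>online_algorithms.
      expected_reward IID (\<lambda>_. decay_limit D) A I / expected_opt I) * expected_opt I"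
  shows "(\<integral>X. reward D S N (masked {1..N} T X) \<partial>PiM {1..N} (\<lambda>_. F)) \<le>
    s + (\<integral>X. decay_gap D g n X \<partial>values_dist I) + of_bool (\<not> gapped g N T) * expected_opt I +
    real (card T) * of_bool (n < card T) * (expected_opt I / real n)"
proof -
  have adm: "admissible IID I" and len: "length I = n"
    using admissible_replicate[OF F n] by (simp_all add: I)
  have opt_eq: "expected_opt I = mean_max F n"
    unfolding I by (rule expected_opt_replicate[OF F n])
  have L: "decay_sequence (\<lambda>_. decay_limit D)"
    by (rule decay_sequence_decay_limit[OF D])
  have R_le: "expected_reward IID (\<lambda>_. decay_limit D) (\<lambda>_. simulate S t k N) I \<le> s" for t k
    unfolding s_def
    by (rule expected_reward_le_SUP[OF L online_algorithms_const[OF measurable_rule_simulate[OF S]] adm opt])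
  have s: "0 \<le> s"
    using expected_reward_bounds(1)[OF L online_algorithms_const[OF measurable_rule_simulate[OF S]] adm]
      R_le by (rule order_trans)
  have gap: "0 \<le> (\<integral>X. decay_gap D g n X \<partial>values_dist I)"
    using values_dist_nonneg[OF adm] unfolding len
    by (intro Bochner_Integration.integral_nonneg decay_gap_bounds(1)[OF D g]) blast
  show ?thesis
  proof (cases "n < card T")
    case True
    have int: "integrable (PiM {1..N} (\<lambda>_. F)) (largest T)"
      by (rule integrable_largest) (use T F in auto)
    have "(\<integral>X. reward D S N (masked {1..N} T X) \<partial>PiM {1..N} (\<lambda>_. F)) \<le>
        (\<integral>X. largest T X \<partial>PiM {1..N} (\<lambda>_. F))"
    proof (rule integral_mono[OF integrable_reward_masked[OF D S N F] int])
      fix X assume X: "X \<in> space (PiM {1..N} (\<lambda>_. F))"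
      have nn: "0 \<le> masked {1..N} T X j" if "j \<in> {1..N}" for j
        by (rule masked_nonneg[of j "{1..N}" X, OF that PiM_nonneg[OF F X that]])
      have "reward D S N (masked {1..N} T X) \<le> Max (masked {1..N} T X ` {1..N})"
        by (rule reward_le_Max[OF D N nn])
      also have "\<dots> = largest {1..N} (masked {1..N} T X)"
        by (rule Max_eq_largest) (use N nn in auto)
      also have "\<dots> = largest T X"
        by (rule largest_masked[OF T])
      finally show "reward D S N (masked {1..N} T X) \<le> largest T X" .
    qed
    also have "\<dots> = mean_max F (card T)"
      by (rule integral_largest_iid[OF F _ T]) simp
    also have "\<dots> \<le> real (card T) * (expected_opt I / real n)"
      using mean_max_ratio[OF F n, of "card T"] True n by (simp add: opt_eq pos_le_divide_eq mult_ac)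
    finally show ?thesis
      using True s gap opt by simp
  next
    case False
    then have k: "card T \<le> n" by simp
    have "finite T" using T finite_subset by blast
    then obtain t where t: "strict_mono_on {1..card T} t" "t ` {1..card T} = T"
      using obtain_enumeration by blast
    have tN: "t ` {1..card T} \<subseteq> {1..N}"
      using t(2) T by simp
    have eq: "(\<integral>X. reward D S N (masked {1..N} T X) \<partial>PiM {1..N} (\<lambda>_. F)) =
        (\<integral>X. reward D S N (pad t (card T) (X \<circ> id)) \<partial>values_dist I)"
      unfolding I values_dist_replicate by (rule expected_reward_masked_eq[OF D S F t T k])
    show ?thesis
    proof (cases "gapped g N T")
      case True
      have "(\<integral>X. reward D S N (pad t (card T) (X \<circ> id)) \<partial>values_dist I) \<le>
          (\<integral>X. reward (\<lambda>_. decay_limit D) (simulate S t (card T) N) (length I) (X \<circ> id) \<partial>values_dist I) +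
          (\<integral>X. decay_gap D g (length I) X \<partial>values_dist I)"
        by (rule expected_reward_pad_le[OF D S adm N _ t(1) tN permutes_id g])
           (use k True t(2) in \<open>simp_all add: len\<close>)
      also have "(\<integral>X. reward (\<lambda>_. decay_limit D) (simulate S t (card T) N) (length I) (X \<circ> id) \<partial>values_dist I) =
          expected_reward IID (\<lambda>_. decay_limit D) (\<lambda>_. simulate S t (card T) N) I"
        by (simp add: expected_reward_fixed_order)
      finally show ?thesis
        using R_le[of t "card T"] True False eq by (simp add: len)
    next
      case not_gapped: False
      have "(\<integral>X. reward D S N (pad t (card T) (X \<circ> id)) \<partial>values_dist I) \<le> expected_opt I"
        by (rule expected_reward_pad_le_opt[OF D S adm N _ t(1) tN permutes_id]) (simp add: len k)
      then show ?thesis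
        using not_gapped False eq s gap by simp
    qed
  qed
qed

text \<open>Averages the bound over the retained set. Later the term with \<open>g * p\<close>
  vanishes as \<open>N\<close> grows and the decay gap as \<open>g\<close> grows; the tail term
  alone persists and depends only on \<open>n\<close> and \<open>\<mu>\<close>.\<close>

lemma expected_reward_thinned_le:
  assumes D: "decay_sequence D" and A: "A \<in> online_algorithms" and F: "nonneg_distribution F"
    and n: "1 \<le> n" and N: "1 \<le> N" and g: "1 \<le> g" and p: "0 \<le> p" "p \<le> 1"
    and \<mu>: "\<mu> = real N * p" "\<mu> < real n"
    and I: "I = replicate n F" and opt: "0 < expected_opt I"
  shows "expected_reward IID D A (replicate N (thinned p F)) \<le>
    ((SUP A\<in>online_algorithms. expected_reward IID (\<lambda>_. decay_limit D) A I / expected_opt I) +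
      (\<integral>X. decay_gap D g n X \<partial>values_dist I) / expected_opt I +
      (real g * p + real N * (real g * p\<^sup>2)) + \<mu> / (real n - \<mu>)\<^sup>2) * expected_opt I"
    (is "_ \<le> (?SUP + ?\<delta> / _ + ?bad + ?tail) * _")
proof -
  define S where "S = A (replicate N (thinned p F))"
  have S: "measurable_rule S"
    using A by (simp add: S_def online_algorithms_def)
  let ?w = "bernoulli_weight p {1..N}"
  let ?E = "expected_opt I"
  have "expected_reward IID D A (replicate N (thinned p F)) =
      (\<integral>X. reward D S N X \<partial>PiM {1..N} (\<lambda>_. thinned p F))"
    by (simp add: expected_reward_fixed_order S_def values_dist_replicate del: replicate.simps)
  also have "\<dots> = (\<Sum>T\<in>Pow {1..N}. ?w T * (\<integral>X. reward D S N (masked {1..N} T X) \<partial>PiM {1..N} (\<lambda>_. F)))"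
  proof (rule integral_PiM_thinned[OF F p])
    show "reward D S N \<in> borel_measurable (PiM {1..N} (\<lambda>_. nonneg_borel))"
      by (rule borel_measurable_reward[OF D S])
    show "0 \<le> reward D S N X" if "X \<in> space (PiM {1..N} (\<lambda>_. nonneg_borel))" for X
      by (rule reward_nonneg[OF D N]) (use that in \<open>auto simp: space_PiM\<close>)
  qed (use integrable_reward_masked[OF D S N F] in auto)
  also have "\<dots> \<le> (\<Sum>T\<in>Pow {1..N}. ?w T * (?SUP * ?E + ?\<delta> + of_bool (\<not> gapped g N T) * ?E +
      real (card T) * of_bool (n < card T) * (?E / real n)))"
    by (intro sum_mono mult_left_mono bernoulli_weight_nonneg[OF p]
        expected_reward_masked_le[OF D S F n N g _ I opt]) simp
  also have "\<dots> = (?SUP * ?E + ?\<delta>) * (\<Sum>T\<in>Pow {1..N}. ?w T) +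
      ?E * (\<Sum>T\<in>Pow {1..N}. ?w T * of_bool (\<not> gapped g N T)) +
      ?E / real n * (\<Sum>T\<in>Pow {1..N}. ?w T * (real (card T) * of_bool (n < card T)))"
    unfolding sum_distrib_left sum.distrib[symmetric] by (intro sum.cong refl) (simp add: algebra_simps)
  also have "\<dots> \<le> (?SUP * ?E + ?\<delta>) * 1 + ?E * ?bad + ?E / real n * (real n * ?tail)"
    unfolding sum_bernoulli_weight[OF finite_atLeastAtMost]
  proof (intro add_mono order_refl mult_left_mono)
    show "(\<Sum>T\<in>Pow {1..N}. ?w T * (real (card T) * of_bool (n < card T))) \<le> real n * ?tail"
      by (rule bernoulli_weight_tail[OF _ p _ \<mu>(2)]) (simp_all add: \<mu>(1))
    show "(\<Sum>T\<in>Pow {1..N}. ?w T * of_bool (\<not> gapped g N T)) \<le> ?bad"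
      by (rule bernoulli_weight_not_gapped[OF p])
  qed (use opt in simp_all)
  also have "\<dots> = (?SUP + ?\<delta> / ?E + ?bad + ?tail) * ?E"
    using opt n by (simp add: algebra_simps)
  finally show ?thesis .
qed

text \<open>A sample of size \<open>k \<le> n\<close> has at least the fraction \<open>k / n\<close>
  of the expected maximum for \<open>n\<close>, while sets with more than \<open>n\<close> elements
  are estimated by 0. What remains is the mean of \<open>card T\<close> without its tail.\<close>

lemma expected_opt_thinned_ge:
  assumes F: "nonneg_distribution F" and n: "1 \<le> n" and N: "1 \<le> N" and p: "0 \<le> p" "p \<le> 1"
    and \<mu>: "\<mu> = real N * p" "\<mu> < real n"
  shows "(\<mu> / real n - \<mu> / (real n - \<mu>)\<^sup>2) * mean_max F n \<le> expected_opt (replicate N (thinned p F))"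
proof -
  let ?w = "bernoulli_weight p {1..N}"
  let ?c = "\<lambda>T. real (card T) - real (card T) * of_bool (n < card T)"
  have tail: "(\<Sum>T\<in>Pow {1..N}. ?w T * (real (card T) * of_bool (n < card T))) \<le>
      real n * (\<mu> / (real n - \<mu>)\<^sup>2)"
    by (rule bernoulli_weight_tail[OF _ p _ \<mu>(2)]) (simp_all add: \<mu>(1))
  have mean: "(\<Sum>T\<in>Pow {1..N}. ?w T * real (card T)) = \<mu>"
    by (subst bernoulli_weight_mean) (simp_all add: \<mu>(1))
  have "(\<mu> / real n - \<mu> / (real n - \<mu>)\<^sup>2) * mean_max F n =
      (\<mu> - real n * (\<mu> / (real n - \<mu>)\<^sup>2)) * (mean_max F n / real n)"
    using n by (simp add: field_simps)
  also have "\<dots> \<le> ((\<Sum>T\<in>Pow {1..N}. ?w T * real (card T)) -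
      (\<Sum>T\<in>Pow {1..N}. ?w T * (real (card T) * of_bool (n < card T)))) * (mean_max F n / real n)"
    using tail mean by (intro mult_right_mono) (simp_all add: mean_max_nonneg)
  also have "\<dots> = (\<Sum>T\<in>Pow {1..N}. ?w T * (?c T * (mean_max F n / real n)))"
    unfolding sum_subtractf[symmetric] sum_distrib_right by (intro sum.cong refl) (simp add: algebra_simps)
  also have "\<dots> \<le> (\<Sum>T\<in>Pow {1..N}. ?w T * mean_max F (card T))"
  proof (intro sum_mono mult_left_mono bernoulli_weight_nonneg[OF p])
    fix T :: "nat set"
    show "?c T * (mean_max F n / real n) \<le> mean_max F (card T)"
    proof (cases "1 \<le> card T \<and> card T \<le> n")
      case True
      then show ?thesis
        using mean_max_ratio[OF F, of "card T" n] n by (simp add: pos_divide_le_eq mult_ac)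
    next
      case False
      \<comment> \<open>Covers \<open>card T = 0\<close> as well as \<open>card T > n\<close>, where
        the indicator cancels the cardinality.\<close>
      then have "?c T = 0" by (cases "card T") auto
      then show ?thesis
        by (simp only: mult_zero_left mean_max_nonneg)
    qed
  qed
  also have "\<dots> = (\<Sum>T\<in>Pow {1..N}. ?w T * (\<integral>X. largest {1..N} (masked {1..N} T X) \<partial>PiM {1..N} (\<lambda>_. F)))"
  proof (rule sum.cong[OF refl])
    fix T assume "T \<in> Pow {1..N}"
    then have T: "T \<subseteq> {1..N}" by simp
    show "?w T * mean_max F (card T) =
        ?w T * (\<integral>X. largest {1..N} (masked {1..N} T X) \<partial>PiM {1..N} (\<lambda>_. F))"
      using integral_largest_iid[OF F finite_atLeastAtMost T] by (simp only: largest_masked[OF T])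
  qed
  also have "\<dots> = (\<integral>X. largest {1..N} X \<partial>PiM {1..N} (\<lambda>_. thinned p F))"
  proof (rule integral_PiM_thinned[OF F p, symmetric])
    show "integrable (PiM {1..N} (\<lambda>_. F)) (\<lambda>X. largest {1..N} (masked {1..N} T X))" if "T \<subseteq> {1..N}" for T
      unfolding largest_masked[OF that] by (rule integrable_largest) (use that F in auto)
  qed (auto intro: borel_measurable_largest largest_nonneg)
  also have "\<dots> = expected_opt (replicate N (thinned p F))"
    using expected_opt_replicate[OF nonneg_distribution_thinned[OF F p] N] by (simp add: mean_max_def)
  finally show ?thesis .
qed

lemma competitive_ratio_iid_le:
  assumes D: "decay_sequence D" and I: "admissible IID I" and opt: "0 < expected_opt I"
    and A: "A \<in> online_algorithms"
  shows "competitive_ratio IID D A \<le>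
    (SUP A\<in>online_algorithms. expected_reward IID (\<lambda>_. decay_limit D) A I / expected_opt I) +
      6 * real (length I) powr (- 1 / 3)"
    (is "_ \<le> ?SUP + 6 * ?r")
proof -
  define n where "n = length I"
  have n: "1 \<le> n"
    using admissible_length[OF I] by (simp add: n_def)
  obtain F where "I = replicate (length I) F"
    using I by (auto simp: admissible_def)
  then have IF: "I = replicate n F"
    by (simp add: n_def)
  then have "F \<in> set I"
    using n by simp
  then have F: "nonneg_distribution F"
    using I by (simp add: admissible_def)
  have opt_eq: "expected_opt I = mean_max F n"
    unfolding IF by (rule expected_opt_replicate[OF F n])
  define r where "r = ?r"
  have r0: "0 < r" using n by (simp add: r_def n_def[symmetric])
  have r3: "real n * r ^ 3 = 1"
  proof -
    have "r ^ 3 = real n powr (- 1)"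
      unfolding r_def n_def[symmetric] using n by (subst powr_power) auto
    then show ?thesis
      using n by (simp add: powr_minus_divide)
  qed
  have L: "decay_sequence (\<lambda>_. decay_limit D)"
    by (rule decay_sequence_decay_limit[OF D])
  have never: "(\<lambda>_ _. False) \<in> online_algorithms"
    by (simp add: online_algorithms_def measurable_rule_def)
  have SUP0: "0 \<le> ?SUP"
  proof -
    have "0 \<le> ?SUP * expected_opt I"
      by (rule order_trans[OF expected_reward_bounds(1)[OF L never I] expected_reward_le_SUP[OF L never I opt]])
    then show ?thesis
      using opt by (simp add: zero_le_mult_iff)
  qed
  have SUP1: "?SUP \<le> 1"
    by (rule cSUP_least) (use never expected_reward_bounds(2)[OF L _ I] opt in auto)
  have "competitive_ratio IID D A \<le> ?SUP + 6 * r"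
  proof (cases "r \<le> 1 / 4")
    \<comment> \<open>For \<open>r > 1 / 4\<close> the error \<open>6 * r\<close> exceeds 1, and the
      trivial bound on a ratio suffices.\<close>
    case False
    have "competitive_ratio IID D A \<le> expected_reward IID D A I / expected_opt I"
      by (rule competitive_ratio_le[OF D A I opt])
    also have "\<dots> \<le> 1"
      using expected_reward_bounds(2)[OF D A I] opt by simp
    finally show ?thesis
      using False SUP0 by simp
  next
    case r4: True
    \<comment> \<open>The mean number of retained values. The relative shortfall is
      \<open>r\<close>, and \<open>n * r ^ 3 = 1\<close> makes the tail term at most
      \<open>r\<close> too.\<close>
    define \<mu> where "\<mu> = real n * (1 - r)"
    have \<mu>0: "0 \<le> \<mu>" and \<mu>n: "\<mu> < real n"
      using r0 r4 n by (simp_all add: \<mu>_def)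
    have tail: "\<mu> / (real n - \<mu>)\<^sup>2 \<le> r"
    proof -
      have "real n - \<mu> = real n * r"
        by (simp add: \<mu>_def algebra_simps)
      then have "\<mu> / (real n - \<mu>)\<^sup>2 = (1 - r) / (real n * r\<^sup>2)"
        using n r0 by (simp add: \<mu>_def power2_eq_square)
      also have "\<dots> \<le> 1 / (real n * r\<^sup>2)"
        using r0 by (intro divide_right_mono) auto
      also have "\<dots> = r"
        using r3 r0 n by (simp add: field_simps power2_eq_square power3_eq_cube)
      finally show ?thesis .
    qed
    \<comment> \<open>The numerator carries the tail. In the denominator, one \<open>r\<close> is
      the shortfall and the other the tail omitted in the lower bound on the expected
      maximum.\<close>
    have "competitive_ratio IID D A \<le> (?SUP + r) / (1 - 2 * r)"
    proof (rule competitive_ratio_le_limit[OF D I, of "expected_opt I * (1 - 2 * r)"])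
      show "0 < expected_opt I * (1 - 2 * r)"
        using opt r4 by simp
      fix g :: nat assume g: "1 \<le> g"
      define \<delta> where "\<delta> = (\<integral>X. decay_gap D g n X \<partial>values_dist I)"
      define c where "c = real g * (\<mu> + \<mu>\<^sup>2)"
      \<comment> \<open>\<open>n \<le> N\<close> ensures that \<open>p = \<mu> / N\<close> is a
        probability.\<close>
      have bound: "competitive_ratio IID D A \<le>
          (?SUP + \<delta> / expected_opt I + c / real N + r) / (1 - 2 * r)" if Nn: "n \<le> N" for N
      proof -
        have N: "1 \<le> N" using n Nn by simp
        define p where "p = \<mu> / real N"
        have p0: "0 \<le> p" using \<mu>0 by (simp add: p_def)
        have p1: "p \<le> 1" using \<mu>n Nn N by (simp add: p_def)
        have \<mu>: "\<mu> = real N * p" using N by (simp add: p_def)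
        have bad: "real g * p + real N * (real g * p\<^sup>2) = c / real N"
          using N by (simp add: p_def c_def power2_eq_square field_simps)
        define I' where "I' = replicate N (thinned p F)"
        have I': "admissible IID I'"
          unfolding I'_def by (rule admissible_replicate[OF nonneg_distribution_thinned[OF F p0 p1] N])
        have opt': "(1 - 2 * r) * expected_opt I \<le> expected_opt I'"
        proof -
          have "1 - 2 * r \<le> \<mu> / real n - \<mu> / (real n - \<mu>)\<^sup>2"
            using tail n by (simp add: \<mu>_def)
          then have "(1 - 2 * r) * expected_opt I \<le> (\<mu> / real n - \<mu> / (real n - \<mu>)\<^sup>2) * expected_opt I"
            using opt by (intro mult_right_mono) auto
          also have "\<dots> \<le> expected_opt I'"
            unfolding I'_def opt_eq by (rule expected_opt_thinned_ge[OF F n N p0 p1 \<mu> \<mu>n])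
          finally show ?thesis .
        qed
        moreover have pos: "0 < (1 - 2 * r) * expected_opt I"
          using opt r4 by simp
        ultimately have opt'0: "0 < expected_opt I'" by simp
        have rew: "expected_reward IID D A I' \<le>
            (?SUP + \<delta> / expected_opt I + c / real N + r) * expected_opt I"
        proof -
          have "expected_reward IID D A I' \<le>
              (?SUP + \<delta> / expected_opt I + c / real N + \<mu> / (real n - \<mu>)\<^sup>2) * expected_opt I"
            unfolding I'_def \<delta>_def bad[symmetric]
            by (rule expected_reward_thinned_le[OF D A F n N g p0 p1 \<mu> \<mu>n IF opt])
          also have "\<dots> \<le> (?SUP + \<delta> / expected_opt I + c / real N + r) * expected_opt I"
            using tail opt by (intro mult_right_mono) auto
          finally show ?thesis .
        qed
        have "competitive_ratio IID D A \<le> expected_reward IID D A I' / expected_opt I'"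
          by (rule competitive_ratio_le[OF D A I' opt'0])
        also have "\<dots> \<le> expected_reward IID D A I' / ((1 - 2 * r) * expected_opt I)"
          by (rule divide_left_mono[OF opt' expected_reward_bounds(1)[OF D A I'] mult_pos_pos[OF opt'0 pos]])
        also have "\<dots> \<le> (?SUP + \<delta> / expected_opt I + c / real N + r) * expected_opt I / ((1 - 2 * r) * expected_opt I)"
          using pos by (intro divide_right_mono rew) simp
        also have "\<dots> = (?SUP + \<delta> / expected_opt I + c / real N + r) / (1 - 2 * r)"
          using opt by simp
        finally show ?thesis .
      qed
      have "(\<lambda>N. (?SUP + \<delta> / expected_opt I + c / real N + r) / (1 - 2 * r)) \<longlonglongrightarrow>
          (?SUP + \<delta> / expected_opt I + 0 + r) / (1 - 2 * r)"
        by (intro tendsto_divide tendsto_add tendsto_const lim_const_over_n) (use r4 in simp)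
      then have "competitive_ratio IID D A \<le> (?SUP + \<delta> / expected_opt I + 0 + r) / (1 - 2 * r)"
        by (rule LIMSEQ_le_const) (use bound in blast)
      also have "\<dots> = (?SUP + r) / (1 - 2 * r) + \<delta> / (expected_opt I * (1 - 2 * r))"
        by (simp add: add_divide_distrib)
      finally show "competitive_ratio IID D A \<le> (?SUP + r) / (1 - 2 * r) +
          (\<integral>X. decay_gap D g (length I) X \<partial>values_dist I) / (expected_opt I * (1 - 2 * r))"
        by (simp add: \<delta>_def n_def)
    qed
    also have "\<dots> \<le> ?SUP + 6 * r"
    proof -
      \<comment> \<open>After multiplying out and using \<open>?SUP \<le> 1\<close>, the claim
        reduces to \<open>12 * r\<^sup>2 \<le> 3 * r\<close>, which is precisely the threshold
        \<open>r \<le> 1 / 4\<close>.\<close>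
      have "?SUP * r \<le> 1 * r" "r * r \<le> 1 / 4 * r"
        using SUP1 r0 r4 by (intro mult_right_mono; simp)+
      moreover have "(?SUP + 6 * r) * (1 - 2 * r) = ?SUP + 6 * r - 2 * (?SUP * r) - 12 * (r * r)"
        by (simp add: algebra_simps)
      ultimately have "?SUP + r \<le> (?SUP + 6 * r) * (1 - 2 * r)"
        by linarith
      then show ?thesis
        using r4 by (simp add: pos_divide_le_eq)
    qed
    finally show ?thesis .
  qed
  then show ?thesis
    by (simp only: r_def)
qed

theorem theorem1:
  "\<exists>\<epsilon> :: nat \<Rightarrow> real. \<epsilon> \<in> O(\<lambda>n. real n powr (- 1 / 3)) \<and>
     (\<forall>D. decay_sequence D \<longrightarrow>
       (\<forall>m\<in>{Adversarial, Random_Order}. \<forall>I. admissible m I \<and> 0 < expected_opt I \<longrightarrow>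
         (\<forall>ALG\<in>online_algorithms.
            competitive_ratio m D ALG
              \<le> (SUP A\<in>online_algorithms.
                    expected_reward m (\<lambda>_. decay_limit D) A I / expected_opt I))) \<and>
       (\<forall>I. admissible IID I \<and> 0 < expected_opt I \<longrightarrow>
         (\<forall>ALG\<in>online_algorithms.
            competitive_ratio IID D ALG
              \<le> (SUP A\<in>online_algorithms.
                    expected_reward IID (\<lambda>_. decay_limit D) A I / expected_opt I)
                 + \<epsilon> (length I))))"
proof (intro exI[of _ "\<lambda>n. 6 * real n powr (- 1 / 3)"] conjI allI impI ballI)
  show "(\<lambda>n. 6 * real n powr (- 1 / 3)) \<in> O(\<lambda>n. real n powr (- 1 / 3))"
    by simp
next
  fix D m I ALG
  assume "decay_sequence D" "m \<in> {Adversarial, Random_Order}"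
    "admissible m I \<and> 0 < expected_opt I" "ALG \<in> online_algorithms"
  then show "competitive_ratio m D ALG
      \<le> (SUP A\<in>online_algorithms. expected_reward m (\<lambda>_. decay_limit D) A I / expected_opt I)"
    using competitive_ratio_adversarial_le competitive_ratio_random_order_le by blast
next
  fix D I ALG
  assume "decay_sequence D" "admissible IID I \<and> 0 < expected_opt I" "ALG \<in> online_algorithms"
  then show "competitive_ratio IID D ALG
      \<le> (SUP A\<in>online_algorithms. expected_reward IID (\<lambda>_. decay_limit D) A I / expected_opt I)
         + 6 * real (length I) powr (- 1 / 3)"
    using competitive_ratio_iid_le by blast
qed

end
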